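(* Let $G$ be a subgroup of $S_{\mathbb N}$. The algebras $\mathscr W_G$, $\mathscr A_G$ and $\mathscr O_{b,G}$ are projective free.
   Context: A commutative unital ring $A$ is projective free if every finitely generated projective $A$-module is free (isomorphic to $A^k$ for some integer $k\ge0$). Let $\mathbb C_+=\{\mathrm{Re}\,s>0\}$. $\mathscr O_u$ is the algebra of holomorphic functions on $\mathbb C_+$ that are limits of Dirichlet series $\sum_{n\ge1}a_nn^{-s}$ converging uniformly on each half-plane $\{\mathrm{Re}\,s>\varepsilon\}$, $\varepsilon>0$ (the series is unique). $\Omega(n)$ is the number of prime factors of $n$ counted with multiplicity; for $f\in\mathscr O_u$ with Dirichlet series $\sum a_nn^{-s}$ and $r\in(0,1)$, $f_r\in\mathscr O_u$ is the limit function of $\sum r^{\Omega(n)}a_nn^{-s}$. - $\mathscr O_b$: all $f\in\mathscr O_u$ with $f_r$ bounded on $\mathbb C_+$ for every $r\in(0,1)$. - $\mathscr W$: limit functions of Dirichlet series with $\sum|a_n|<\infty$. - $\mathscr A$: the uniform closure of $\mathscr W$ in the algebra of bounded functions in $\mathscr O_u$ with the supremum norm. $S_{\mathbb N}$ is the group of all permutations of $\mathbb N=\{1,2,\dots\}$; $p_1<p_2<\cdots$ are the primes, $\nu_p(n)$ the exponent of $p$ in $n$; for $\sigma\in S_{\mathbb N}$, $\hat\sigma(n)=\prod_ip_{\sigma(i)}^{\nu_{p_i}(n)}$. $\mathscr W_G,\mathscr A_G,\mathscr O_{b,G}$ are the subalgebras of $\mathscr W,\mathscr A,\mathscr O_b$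 of those functions whose Dirichlet series satisfies $a_{\hat\sigma(n)}=a_n$ for all $n\in\mathbb N$, $\sigma\in G$. *)

theory Defs
  imports
    "HOL-Analysis.Analysis"
    "HOL-Computational_Algebra.Primes"
    "HOL-Library.Infinite_Set"
    "HOL-Algebra.Module"
    "HOL-Algebra.AbelCoset"
    "HOL-Algebra.Bij"
begin

section \<open>Projective free rings\<close>

text \<open>The free module \<open>R\<^sup>(\<^sup>I\<^sup>)\<close>: families in \<open>R\<close> with finite support contained in \<open>I\<close>.  The fields
  \<open>mult\<close> and \<open>one\<close> of a \<open>module\<close> record play no role in the locale \<open>Module.module\<close>.\<close>

definition free_module :: "('a, 'b) ring_scheme \<Rightarrow> 'i set \<Rightarrow> ('a, 'i \<Rightarrow> 'a) module" where
  "free_module R I = \<lparr>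
     carrier = {v. (\<forall>i. v i \<in> carrier R) \<and> (\<forall>i. i \<notin> I \<longrightarrow> v i = \<zero>\<^bsub>R\<^esub>) \<and> finite {i. v i \<noteq> \<zero>\<^bsub>R\<^esub>}},
     mult = undefined,
     one = undefined,
     zero = (\<lambda>i. \<zero>\<^bsub>R\<^esub>),
     add = (\<lambda>v w i. v i \<oplus>\<^bsub>R\<^esub> w i),
     smult = (\<lambda>a v i. a \<otimes>\<^bsub>R\<^esub> v i)\<rparr>"

definition module_isomorphic ::
  "('a, 'b) ring_scheme \<Rightarrow> ('a, 'm, 'c) module_scheme \<Rightarrow> ('a, 'n, 'd) module_scheme \<Rightarrow> bool" where
  "module_isomorphic R M N \<longleftrightarrow> (\<exists>h. bij_betw h (carrier M) (carrier N) \<and>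
     (\<forall>x\<in>carrier M. \<forall>y\<in>carrier M. h (x \<oplus>\<^bsub>M\<^esub> y) = h x \<oplus>\<^bsub>N\<^esub> h y) \<and>
     (\<forall>a\<in>carrier R. \<forall>x\<in>carrier M. h (a \<odot>\<^bsub>M\<^esub> x) = a \<odot>\<^bsub>N\<^esub> h x))"

definition finitely_generated_module ::
  "('a, 'b) ring_scheme \<Rightarrow> ('a, 'm, 'c) module_scheme \<Rightarrow> bool" where
  "finitely_generated_module R M \<longleftrightarrow> Module.module R M \<and>
     (\<exists>S. finite S \<and> S \<subseteq> carrier M \<and>
        (\<forall>x\<in>carrier M. \<exists>c. c \<in> S \<rightarrow> carrier R \<and> x = (\<Oplus>\<^bsub>M\<^esub>s\<in>S. c s \<odot>\<^bsub>M\<^esub> s)))"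

text \<open>A module is projective if it is isomorphic to a direct summand of a free module.  Drawing the
  index set \<open>I\<close> of the free module from the type of the elements of \<open>M\<close> is no restriction: if \<open>M\<close> is
  a direct summand of any free module, then the canonical surjection onto \<open>M\<close> from the free module
  on the set \<open>carrier M\<close> splits.\<close>

definition projective_module ::
  "('a, 'b) ring_scheme \<Rightarrow> ('a, 'm, 'c) module_scheme \<Rightarrow> bool" where
  "projective_module R M \<longleftrightarrow> Module.module R M \<and>
     (\<exists>(I :: 'm set) P Q.
        submodule P R (free_module R I) \<and> submodule Q R (free_module R I) \<and>
        P \<inter> Q = {\<zero>\<^bsub>free_module R I\<^esub>} \<and>
        set_add (free_module R I) P Q = carrier (free_module R I) \<and>
        module_isomorphic R M ((free_module R I)\<lparr>carrier := P\<rparr>))"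

text \<open>The type argument is the type of the elements of the modules considered; a statement about all
  modules is a statement that is polymorphic in it.\<close>

definition projective_free :: "'m itself \<Rightarrow> ('a, 'b) ring_scheme \<Rightarrow> bool" where
  "projective_free T R \<longleftrightarrow> cring R \<and>
     (\<forall>M :: ('a, 'm) module. finitely_generated_module R M \<and> projective_module R M \<longrightarrow>
        (\<exists>k::nat. module_isomorphic R M (free_module R {..<k})))"


section \<open>Algebras of Dirichlet series\<close>

definition right_half_plane :: "complex set" where
  "right_half_plane = {s. 0 < Re s}"

text \<open>Functions on the half-plane are represented by their extension that is \<open>undefined\<close> off it.
  The value \<open>a 0\<close> is irrelevant here and below.\<close>

definition dirichlet_limit :: "(nat \<Rightarrow> complex) \<Rightarrow> (complex \<Rightarrow> complex) \<Rightarrow> bool" where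
  "dirichlet_limit a f \<longleftrightarrow> f \<in> extensional right_half_plane \<and>
     (\<forall>\<epsilon>>0. uniform_limit {s. Re s > \<epsilon>} (\<lambda>N s. \<Sum>n=1..N. a n * of_nat n powr (- s)) f sequentially)"

definition O_u :: "(complex \<Rightarrow> complex) set" where
  "O_u = {f. f holomorphic_on right_half_plane \<and> (\<exists>a. dirichlet_limit a f)}"

definition big_omega :: "nat \<Rightarrow> nat" where
  "big_omega n = size (prime_factorization n)"

text \<open>The coefficients \<open>a n\<close>, \<open>n \<ge> 1\<close>, are determined by \<open>f\<close>, and \<open>g\<close> below is the function
  \<open>f\<^sub>r\<close>.\<close>

definition O_b :: "(complex \<Rightarrow> complex) set" where
  "O_b = {f \<in> O_u. \<exists>a. dirichlet_limit a f \<and>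
     (\<forall>r::real. 0 < r \<and> r < 1 \<longrightarrow>
        (\<exists>g\<in>O_u. dirichlet_limit (\<lambda>n. of_real (r ^ big_omega n) * a n) g \<and>
           bounded (g ` right_half_plane)))}"

definition W_alg :: "(complex \<Rightarrow> complex) set" where
  "W_alg = {f. \<exists>a. dirichlet_limit a f \<and> summable (\<lambda>n. norm (a n))}"

definition A_alg :: "(complex \<Rightarrow> complex) set" where
  "A_alg = {f \<in> O_u. bounded (f ` right_half_plane) \<and>
     (\<forall>\<epsilon>>0. \<exists>g\<in>W_alg. \<forall>s\<in>right_half_plane. norm (f s - g s) < \<epsilon>)}"


section \<open>Symmetric subalgebras\<close>

text \<open>\<open>nth_prime i\<close> is the \<open>i\<close>-th prime counted from \<open>i = 1\<close>, while \<open>enumerate\<close> counts from \<open>0\<close>.\<close>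

definition nth_prime :: "nat \<Rightarrow> nat" where
  "nth_prime i = Infinite_Set.enumerate {p. prime p} (i - 1)"

definition prime_perm :: "(nat \<Rightarrow> nat) \<Rightarrow> nat \<Rightarrow> nat" where
  "prime_perm \<sigma> n =
     (\<Prod>i | 1 \<le> i \<and> nth_prime i dvd n. nth_prime (\<sigma> i) ^ multiplicity (nth_prime i) n)"

definition symmetric_part ::
  "(nat \<Rightarrow> nat) set \<Rightarrow> (complex \<Rightarrow> complex) set \<Rightarrow> (complex \<Rightarrow> complex) set" where
  "symmetric_part G X = {f \<in> X. \<exists>a. dirichlet_limit a f \<and>
     (\<forall>\<sigma>\<in>G. \<forall>n\<ge>1. a (prime_perm \<sigma> n) = a n)}"

definition function_ring :: "(complex \<Rightarrow> complex) set \<Rightarrow> (complex \<Rightarrow> complex) ring" where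
  "function_ring X = \<lparr>
     carrier = X,
     mult = (\<lambda>f g. \<lambda>s\<in>right_half_plane. f s * g s),
     one = (\<lambda>s\<in>right_half_plane. 1),
     zero = (\<lambda>s\<in>right_half_plane. 0),
     add = (\<lambda>f g. \<lambda>s\<in>right_half_plane. f s + g s)\<rparr>"

end

theory Submission
  imports
    Defs
    "HOL-Complex_Analysis.Complex_Analysis"
    "HOL-Library.Function_Algebras"
begin

text \<open>
  A finitely generated projective module is the image of an idempotent matrix E, and it is
  free as soon as E = X Y with Y X = 1 for some rectangular matrices X, Y over the ring
  (projective_free_if_idempotents_factor). Over the complex numbers such a factorization
  exists by linear algebra, and the proof carries it from a constant matrix to E along a
  path: replacing the coefficients a_n by r to the power \<Omega>(n) times a_n is a ring
  endomorphism f \<mapsto> f_r, so the matrices E_r are idempotents that join the constant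
  matrix E_0 to E_1 = E.

  The transport is a linear differential equation. Let D be the derivation that multiplies a_n
  by \<Omega>(n) and let A = (D E) E - E (D E); then D E = A E - E A. If D X = A X and D Y =
  - Y A with constant terms that factor E_0, then D (Y X) = 0, so Y X = 1, while X Y and E
  solve the same equation D Z = A Z - Z A with the same constant term, so X Y = E. On formal
  Dirichlet series these equations are recursions for the coefficients
  (formal_idempotent_factorization). On parts of fixed \<Omega>-degree the first of them
  reads m X_m = A_1 X_(m-1) + \<dots> + A_m X_0, and the factor m on the left forces X_m to
  grow subexponentially in any algebra norm in which the parts of E do
  (tame_idempotent_factorization).

  For the algebra O_b this is the end, because O_b consists precisely of the series whose
  homogeneous parts grow subexponentially in the supremum norm (O_b_iff). In W_alg and A_alg
  the factors X_r, Y_r of E_r lie in the algebra for r < 1, and E_r tends to E in norm as r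
  tends to 1; since nearby idempotents of a Banach algebra are conjugate by means of a
  Neumann series, E factors as well (idempotent_factorization).

  Two estimates for Dirichlet polynomials carry the analysis. By a theorem of Bohr the partial
  sums are bounded on Re s > \<epsilon> by a constant times the supremum of the polynomial
  on Re s > 0 (partial_sums_uniformly_bounded); this gives the uniqueness of the
  coefficients, the completeness of the algebra of bounded functions in O_u, and closure
  under products. Second, multiplying the coefficients by a completely multiplicative
  function with values in the closed unit disc does not increase the supremum
  (contractive_cmult): for unimodular values this is Kronecker's approximation theorem, and
  the maximum modulus principle, applied to one prime at a time, does the rest. This
  controls f_r, the homogeneous parts, and the convergence of series with subexponentially
  growing parts.

  The group G acts on Dirichlet series by ring automorphisms that preserve \<Omega>. Each step
  of the construction is equivariant, so it stays among the invariant series.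
\<close>

section \<open>Formal Dirichlet series graded by the number of prime factors\<close>

text \<open>A coefficient sequence indexed by the positive integers; the value at 0 is fixed
  so that equality of series is equality of sequences.\<close>

typedef fds = "{a :: nat \<Rightarrow> complex. a 0 = 0}"
  morphisms coeff Fds
  by auto

lemma coeff_0 [simp]: "coeff a 0 = 0"
  using coeff[of a] by simp

lemma fds_eqI: "(\<And>n. n \<ge> 1 \<Longrightarrow> coeff a n = coeff b n) \<Longrightarrow> a = b"
  by (metis One_nat_def Suc_leI coeff_0 coeff_inject ext gr0I)

definition mk_fds :: "(nat \<Rightarrow> complex) \<Rightarrow> fds" where
  "mk_fds a = Fds (\<lambda>n. if n = 0 then 0 else a n)"

lemma coeff_mk_fds: "coeff (mk_fds a) n = (if n = 0 then 0 else a n)"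
  by (simp add: mk_fds_def Fds_inverse)

instantiation fds :: comm_ring_1
begin
definition "0 = mk_fds (\<lambda>_. 0)"
definition "1 = mk_fds (\<lambda>n. if n = 1 then 1 else 0)"
definition "a + b = mk_fds (\<lambda>n. coeff a n + coeff b n)"
definition "a - b = mk_fds (\<lambda>n. coeff a n - coeff b n)"
definition "- a = mk_fds (\<lambda>n. - coeff a n)"
definition "a * b = mk_fds (\<lambda>n. \<Sum>(d,e)\<in>{(d,e). d * e = n}. coeff a d * coeff b e)"

lemma finite_factor_pairs:
  assumes "n > 0" shows "finite {(d::nat, e). d * e = n}"
proof (rule finite_subset)
  show "{(d::nat, e). d * e = n} \<subseteq> {..n} \<times> {..n}"
    using assms by auto
qed auto

lemma coeff_zero [simp]: "coeff 0 n = 0"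
  and coeff_one: "coeff 1 n = (if n = 1 then 1 else 0)"
  and coeff_add [simp]: "coeff (a + b) n = coeff a n + coeff b n"
  and coeff_diff [simp]: "coeff (a - b) n = coeff a n - coeff b n"
  and coeff_minus [simp]: "coeff (- a) n = - coeff a n"
  by (auto simp: zero_fds_def one_fds_def plus_fds_def minus_fds_def uminus_fds_def coeff_mk_fds)

lemma coeff_mult:
  "n > 0 \<Longrightarrow> coeff (a * b) n = (\<Sum>(d,e)\<in>{(d,e). d * e = n}. coeff a d * coeff b e)"
  by (simp add: times_fds_def coeff_mk_fds)

instance
proof
  fix a b c :: fds
  show "a * b * c = a * (b * c)"
  proof (rule fds_eqI)
    fix n :: nat assume "n \<ge> 1"
    then have n: "n > 0" by simp
    have fin: "finite {(d::nat, e). d * e = n}" using finite_factor_pairs[OF n] .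
    have 1: "coeff (a * b * c) n =
        (\<Sum>((d,e),(f,g))\<in>Sigma {(d,e). d * e = n} (\<lambda>(d,e). {(f,g). f * g = d}). 
            coeff a f * coeff b g * coeff c e)" 
    proof -
      have "coeff (a * b * c) n = (\<Sum>p\<in>{(d,e). d * e = n}. \<Sum>q\<in>{(f,g). f * g = fst p}.
                coeff a (fst q) * coeff b (snd q) * coeff c (snd p))"
        using n by (auto simp: coeff_mult case_prod_unfold sum_distrib_right intro!: sum.cong)
      also have "\<dots> = (\<Sum>(p,q)\<in>Sigma {(d,e). d * e = n} (\<lambda>p. {(f,g). f * g = fst p}).
                coeff a (fst q) * coeff b (snd q) * coeff c (snd p))"
        using n by (intro sum.Sigma fin ballI) (auto intro!: finite_factor_pairs)
      finally show ?thesis by (simp add: case_prod_unfold)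
    qed
    have 2: "coeff (a * (b * c)) n =
        (\<Sum>((d,e),(f,g))\<in>Sigma {(d,e). d * e = n} (\<lambda>(d,e). {(f,g). f * g = e}). 
            coeff a d * coeff b f * coeff c g)" 
    proof -
      have "coeff (a * (b * c)) n = (\<Sum>p\<in>{(d,e). d * e = n}. \<Sum>q\<in>{(f,g). f * g = snd p}.
                coeff a (fst p) * coeff b (fst q) * coeff c (snd q))"
        using n by (auto simp: coeff_mult case_prod_unfold sum_distrib_left mult.assoc intro!: sum.cong)
      also have "\<dots> = (\<Sum>(p,q)\<in>Sigma {(d,e). d * e = n} (\<lambda>p. {(f,g). f * g = snd p}).
                coeff a (fst p) * coeff b (fst q) * coeff c (snd q))"
        using n by (intro sum.Sigma fin ballI) (auto intro!: finite_factor_pairs)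
      finally show ?thesis by (simp add: case_prod_unfold)
    qed
    show "coeff (a * b * c) n = coeff (a * (b * c)) n"
      unfolding 1 2
      by (rule sum.reindex_bij_witness[where i="\<lambda>((d,e),(f,g)). ((d*f,g),(d,f))"
            and j="\<lambda>((d,e),(f,g)). ((f,g*e),(g,e))"]) (auto simp: mult.assoc)
  qed
  show "a * b = b * a"
  proof (rule fds_eqI)
    fix n :: nat assume "n \<ge> 1"
    then have n: "n > 0" by simp
    show "coeff (a * b) n = coeff (b * a) n"
      unfolding coeff_mult[OF n]
      by (rule sum.reindex_bij_witness[where i="\<lambda>(x,y). (y,x)" and j="\<lambda>(x,y). (y,x)"])
         (auto simp: mult.commute)
  qed
  show "1 * a = a"
  proof (rule fds_eqI)
    fix n :: nat assume "n \<ge> 1"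
    then have n: "n > 0" by simp
    have "(\<Sum>(d,e)\<in>{(d,e). d * e = n}. coeff 1 d * coeff a e)
        = (\<Sum>p\<in>{(1,n)}. coeff 1 (fst p) * coeff a (snd p))"
      unfolding case_prod_unfold
      by (rule sum.mono_neutral_right)
        (use finite_factor_pairs[OF n] in \<open>auto simp: coeff_one case_prod_unfold\<close>)
    then show "coeff (1 * a) n = coeff a n"
      by (simp add: coeff_mult n coeff_one)
  qed
  show "(a + b) * c = a * c + b * c"
  proof (rule fds_eqI)
    fix n :: nat assume "n \<ge> 1"
    then show "coeff ((a + b) * c) n = coeff (a * c + b * c) n"
      by (simp add: coeff_mult case_prod_unfold algebra_simps sum.distrib)
  qed
  have "coeff (0::fds) 1 \<noteq> coeff 1 1" by (simp add: coeff_one)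
  then show "(0::fds) \<noteq> 1" by metis
qed (rule fds_eqI; simp; fail)+

end

lemma coeff_sum [simp]: "coeff (sum f I) n = (\<Sum>i\<in>I. coeff (f i) n)"
  by (induction I rule: infinite_finite_induct) auto

lemma coeff_one_1 [simp]: "coeff 1 (Suc 0) = 1"
  by (simp add: coeff_one)

lemma coeff_mult_1 [simp]: "coeff (a * b) (Suc 0) = coeff a (Suc 0) * coeff b (Suc 0)"
proof -
  have "{(d::nat,e). d * e = Suc 0} = {(Suc 0, Suc 0)}" by auto
  then show ?thesis by (simp add: coeff_mult)
qed

definition fconst :: "complex \<Rightarrow> fds" where
  "fconst c = mk_fds (\<lambda>n. if n = 1 then c else 0)"

lemma coeff_fconst: "coeff (fconst c) n = (if n = 1 then c else 0)"
  by (simp add: fconst_def coeff_mk_fds)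

lemma fconst_1 [simp]: "fconst 1 = 1"
  by (rule fds_eqI) (simp add: coeff_fconst coeff_one)

lemma coeff_fconst_mult [simp]: "coeff (fconst c * a) n = c * coeff a n"
proof (cases "n = 0")
  case False
  then have n: "n > 0" by simp
  have "(\<Sum>(d,e)\<in>{(d,e). d * e = n}. coeff (fconst c) d * coeff a e)
      = (\<Sum>p\<in>{(1,n)}. coeff (fconst c) (fst p) * coeff a (snd p))"
    unfolding case_prod_unfold
    by (rule sum.mono_neutral_right)
      (use finite_factor_pairs[OF n] in \<open>auto simp: coeff_fconst case_prod_unfold\<close>)
  then show ?thesis
    by (simp add: coeff_mult n coeff_fconst)
qed auto

lemma big_omega_mult: "m > 0 \<Longrightarrow> n > 0 \<Longrightarrow> big_omega (m * n) = big_omega m + big_omega n"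
  by (simp add: big_omega_def prime_factorization_mult)

lemma big_omega_eq_0_iff: "n > 0 \<Longrightarrow> big_omega n = 0 \<longleftrightarrow> n = 1"
  by (auto simp: big_omega_def prime_factorization_empty_iff)

text \<open>The derivation D, that is r d/dr at r = 1 of the dilations defined below.\<close>

definition omega_deriv :: "fds \<Rightarrow> fds" where
  "omega_deriv a = mk_fds (\<lambda>n. of_nat (big_omega n) * coeff a n)"

definition hom_part :: "nat \<Rightarrow> fds \<Rightarrow> fds" where
  "hom_part m a = mk_fds (\<lambda>n. if big_omega n = m then coeff a n else 0)"

text \<open>The coefficients of f_r.\<close>

definition dilate :: "real \<Rightarrow> fds \<Rightarrow> fds" where
  "dilate r a = mk_fds (\<lambda>n. of_real (r ^ big_omega n) * coeff a n)"

lemma coeff_omega_deriv [simp]: "coeff (omega_deriv a) n = of_nat (big_omega n) * coeff a n"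
  and coeff_hom_part: "coeff (hom_part m a) n = (if big_omega n = m then coeff a n else 0)"
  and coeff_dilate [simp]: "coeff (dilate r a) n = of_real (r ^ big_omega n) * coeff a n"
  by (auto simp: omega_deriv_def hom_part_def dilate_def coeff_mk_fds)

lemma omega_deriv_diff: "omega_deriv (a - b) = omega_deriv a - omega_deriv b"
  and omega_deriv_sum: "omega_deriv (sum f I) = (\<Sum>i\<in>I. omega_deriv (f i))"
  by (rule fds_eqI, simp add: algebra_simps sum_distrib_left)+

lemma omega_deriv_mult: "omega_deriv (a * b) = omega_deriv a * b + a * omega_deriv b"
proof (rule fds_eqI)
  fix n :: nat assume "n \<ge> 1"
  then have n: "n > 0" by simp
  show "coeff (omega_deriv (a * b)) n = coeff (omega_deriv a * b + a * omega_deriv b) n"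
    unfolding coeff_add coeff_omega_deriv coeff_mult[OF n] sum_distrib_left sum.distrib[symmetric]
    using n by (intro sum.cong) (auto simp: big_omega_mult algebra_simps)
qed

lemma dilate_mult: "dilate r (a * b) = dilate r a * dilate r b"
proof (rule fds_eqI)
  fix n :: nat assume "n \<ge> 1"
  then have n: "n > 0" by simp
  show "coeff (dilate r (a * b)) n = coeff (dilate r a * dilate r b) n"
    unfolding coeff_dilate coeff_mult[OF n] sum_distrib_left
    using n by (intro sum.cong) (auto simp: big_omega_mult power_add algebra_simps)
qed

lemma dilate_diff: "dilate r (a - b) = dilate r a - dilate r b"
  and dilate_sum: "dilate r (sum f I) = (\<Sum>i\<in>I. dilate r (f i))"
  by (rule fds_eqI, simp add: algebra_simps sum_distrib_left)+

lemma dilate_fconst [simp]: "dilate r (fconst c) = fconst c"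
  by (rule fds_eqI) (auto simp: coeff_fconst big_omega_def)

text \<open>Since \<Omega> is completely additive, the homogeneous parts make the ring of
  formal Dirichlet series graded.\<close>

lemma hom_part_mult: "hom_part m (a * b) = (\<Sum>j\<le>m. hom_part j a * hom_part (m - j) b)"
proof (rule fds_eqI)
  fix n :: nat assume "n \<ge> 1"
  then have n: "n > 0" by simp
  have *: "(\<Sum>j\<le>m. coeff (hom_part j a) d * coeff (hom_part (m - j) b) e) =
      (if big_omega n = m then coeff a d * coeff b e else 0)" if "d * e = n" for d e
  proof -
    have "big_omega n = big_omega d + big_omega e"
      using that n big_omega_mult[of d e] by auto
    then have "(\<Sum>j\<le>m. coeff (hom_part j a) d * coeff (hom_part (m - j) b) e) =
      (\<Sum>j\<le>m. if j = big_omega d then (if big_omega n = m then coeff a d * coeff b e else 0) else 0)"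
      by (intro sum.cong) (auto simp: coeff_hom_part)
    also have "\<dots> = (if big_omega n = m then coeff a d * coeff b e else 0)"
      using \<open>big_omega n = _\<close> by auto
    finally show ?thesis .
  qed
  have "coeff (\<Sum>j\<le>m. hom_part j a * hom_part (m - j) b) n =
     (\<Sum>p\<in>{(d,e). d * e = n}. \<Sum>j\<le>m. coeff (hom_part j a) (fst p) * coeff (hom_part (m - j) b) (snd p))"
    by (subst sum.swap) (simp add: coeff_mult[OF n] case_prod_unfold)
  also have "\<dots> = (\<Sum>p\<in>{(d,e). d * e = n}. if big_omega n = m then coeff a (fst p) * coeff b (snd p) else 0)"
    by (intro sum.cong refl) (simp add: case_prod_unfold *)
  also have "\<dots> = coeff (hom_part m (a * b)) n"
    by (auto simp: coeff_hom_part coeff_mult[OF n] case_prod_unfold)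
  finally show "coeff (hom_part m (a * b)) n = coeff (\<Sum>j\<le>m. hom_part j a * hom_part (m - j) b) n" ..
qed

lemma hom_part_add: "hom_part m (a + b) = hom_part m a + hom_part m b"
  and hom_part_diff: "hom_part m (a - b) = hom_part m a - hom_part m b"
  and hom_part_sum: "hom_part m (sum f I) = (\<Sum>i\<in>I. hom_part m (f i))"
  by (rule fds_eqI, auto simp: coeff_hom_part)+

section \<open>Factoring idempotent matrices of formal Dirichlet series\<close>

text \<open>The columns of X form a basis of the column space of E, chosen among the columns
  of E, and Y records the coordinates of the columns of E. An idempotent matrix fixes its own
  columns, so X (Y X) = X, and Y X = 1 follows from the independence of the columns of
  X.\<close>

lemma complex_idempotent_factorization:
  fixes E :: "nat \<Rightarrow> nat \<Rightarrow> complex"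
  assumes idem: "\<And>i j. i < n \<Longrightarrow> j < n \<Longrightarrow> (\<Sum>l<n. E i l * E l j) = E i j"
  shows "\<exists>(k::nat) X Y. (\<forall>i<n. \<forall>j<n. (\<Sum>l<k. X i l * Y l j) = E i j) \<and>
           (\<forall>i<k. \<forall>j<k. (\<Sum>l<n. Y i l * X l j) = (if i = j then 1 else 0))"
proof -
  interpret vs: vector_space "\<lambda>(c::complex) (f :: nat \<Rightarrow> complex) i. c * f i"
    by unfold_locales (auto simp: fun_eq_iff algebra_simps)
  define col where "col j = (\<lambda>i. if i < n then E i j else 0)" for j
  obtain B where B: "B \<subseteq> col ` {..<n}" "vs.independent B" "col ` {..<n} \<subseteq> vs.span B"
    using vs.maximal_independent_subset by metis
  have finB: "finite B" using B(1) finite_subset by blast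
  obtain b where b: "bij_betw b {..<card B} B"
    using ex_bij_betw_nat_finite[OF finB] by (auto simp: atLeast0LessThan)
  have "\<exists>u. col j = (\<Sum>v\<in>B. (\<lambda>i. u v * v i))" if "j < n" for j
    using B(3) that unfolding vs.span_finite[OF finB] by auto
  then obtain u where u: "\<And>j. j < n \<Longrightarrow> col j = (\<Sum>v\<in>B. (\<lambda>i. u j v * v i))" by metis
  have sum_b: "(\<Sum>v\<in>B. g v) = (\<Sum>l<card B. g (b l))" for g :: "_ \<Rightarrow> complex"
    by (rule sum.reindex_bij_betw[OF b, symmetric])
  have sum_app: "(\<Sum>v\<in>B. f v) i = (\<Sum>v\<in>B. f v i)" for f :: "_ \<Rightarrow> nat \<Rightarrow> complex" and i
    using finB by (induction B) (auto simp: plus_fun_def zero_fun_def)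
  define X where "X i l = b l i" for i l
  define Y where "Y l j = u j (b l)" for l j
  have XY: "(\<Sum>l<card B. X i l * Y l j) = col j i" if "j < n" for i j
    unfolding u[OF that] sum_app sum_b X_def Y_def by (simp add: mult.commute)
  have Eb: "(\<Sum>i<n. col i m * b l i) = b l m" if l: "l < card B" for l m
  proof -
    obtain j where j: "j < n" "b l = col j"
      using B(1) b l by (auto simp: bij_betw_def)
    show ?thesis
      using idem[of m j] j by (auto simp: col_def)
  qed
  have YX: "(\<Sum>i<n. Y l' i * X i l) = (if l' = l then 1 else 0)"
    if l: "l < card B" and l': "l' < card B" for l l'
  proof -
    define w where "w v = (\<Sum>i<n. u i v * b l i) - (if v = b l then 1 else 0)" for v
    have "(\<Sum>v\<in>B. (\<lambda>i. w v * v i)) = 0"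
    proof
      fix m
      have "(\<Sum>v\<in>B. (\<lambda>i. w v * v i)) m = (\<Sum>v\<in>B. (\<Sum>i<n. u i v * b l i) * v m)
             - (\<Sum>v\<in>B. if v = b l then v m else 0)"
        unfolding sum_app w_def by (simp add: left_diff_distrib sum_subtractf if_distrib[of "\<lambda>x. x * _"] cong: if_cong)
      also have "(\<Sum>v\<in>B. if v = b l then v m else 0) = b l m"
        using b l finB by (auto simp: bij_betw_def)
      also have "(\<Sum>v\<in>B. (\<Sum>i<n. u i v * b l i) * v m) = (\<Sum>i<n. (\<Sum>v\<in>B. u i v * v m) * b l i)"
        unfolding sum_distrib_right by (subst sum.swap) (simp add: mult_ac)
      also have "\<dots> = (\<Sum>i<n. col i m * b l i)"
        by (intro sum.cong refl) (simp add: u sum_app)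
      finally show "(\<Sum>v\<in>B. (\<lambda>i. w v * v i)) m = 0 m" using Eb[OF l] by simp
    qed
    then have "w (b l') = 0"
      using B(2) finB b l' unfolding vs.independent_explicit_finite_subsets bij_betw_def by blast
    moreover have "b l' = b l \<longleftrightarrow> l' = l"
      using b l l' by (auto simp: bij_betw_def inj_on_def)
    ultimately show ?thesis by (auto simp: w_def X_def Y_def split: if_splits)
  qed
  show ?thesis
    using XY YX by (intro exI[of _ "card B"] exI[of _ X] exI[of _ Y]) (auto simp: col_def)
qed

type_synonym fmat = "nat \<Rightarrow> nat \<Rightarrow> fds"

text \<open>The inner dimension is an argument, not part of the type, because the rank of a
  factorization is only known to exist. Products are formed at all indices, which makes
  associativity and distributivity unconditional.\<close>

definition mmul :: "nat \<Rightarrow> fmat \<Rightarrow> fmat \<Rightarrow> fmat" where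
  "mmul n A B = (\<lambda>i j. \<Sum>l<n. A i l * B l j)"

lemma mmul_assoc: "mmul n (mmul m A B) C = mmul m A (mmul n B C)"
proof (intro ext)
  fix i j
  show "mmul n (mmul m A B) C i j = mmul m A (mmul n B C) i j"
    unfolding mmul_def sum_distrib_left sum_distrib_right
    by (subst sum.swap) (simp add: mult.assoc)
qed

lemma mmul_add_left: "mmul n (A + B) C = mmul n A C + mmul n B C"
  and mmul_add_right: "mmul n C (A + B) = mmul n C A + mmul n C B"
  and mmul_diff_left: "mmul n (A - B) C = mmul n A C - mmul n B C"
  and mmul_diff_right: "mmul n C (A - B) = mmul n C A - mmul n C B"
  and mmul_uminus_left: "mmul n (- A) C = - mmul n A C"
  and mmul_uminus_right: "mmul n C (- A) = - mmul n C A"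
  by (auto simp: mmul_def fun_eq_iff algebra_simps sum.distrib sum_subtractf sum_negf)

lemmas mmul_algebra = mmul_add_left mmul_add_right mmul_diff_left mmul_diff_right
  mmul_uminus_left mmul_uminus_right mmul_assoc

definition mderiv :: "fmat \<Rightarrow> fmat" where
  "mderiv A = (\<lambda>i j. omega_deriv (A i j))"

lemma mderiv_mmul: "mderiv (mmul n A B) = mmul n (mderiv A) B + mmul n A (mderiv B)"
  by (auto simp: mderiv_def mmul_def fun_eq_iff omega_deriv_sum omega_deriv_mult sum.distrib)

text \<open>The matrix A = (D E) E - E (D E) that drives the transport.\<close>

definition connection :: "nat \<Rightarrow> fmat \<Rightarrow> fmat" where
  "connection n E = mmul n (mderiv E) E - mmul n E (mderiv E)"

text \<open>From D E = (D E) E + E (D E) one gets E (D E) E = 0 by multiplying with E on both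
  sides, and then A E - E A = (D E) E + E (D E).\<close>

lemma mderiv_idempotent:
  assumes "mmul n E E = E"
  shows "mderiv E = mmul n (connection n E) E - mmul n E (connection n E)"
proof -
  define D where "D = mderiv E"
  have E2: "mmul n E (mmul n E Z) = mmul n E Z" for Z
    using assms by (simp add: mmul_assoc[symmetric])
  have D: "D = mmul n D E + mmul n E D"
    using mderiv_mmul[of n E E] by (simp add: assms D_def)
  have "mmul n E (mmul n D E) = mmul n E (mmul n (mmul n D E + mmul n E D) E)"
    using D by simp
  then have EDE: "mmul n E (mmul n D E) = 0"
    by (simp add: mmul_algebra E2 assms)
  show ?thesis
    using D unfolding connection_def D_def[symmetric]
    by (simp add: mmul_algebra E2 assms EDE)
qed

lemma finite_divisors_set: "n > 0 \<Longrightarrow> finite {d. d dvd n \<and> P (d::nat)}"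
  by (rule finite_subset[of _ "{..n}"]) (auto dest: dvd_imp_le)

lemma coeff_mult_divisors:
  assumes "n > 0" shows "coeff (a * b) n = (\<Sum>d | d dvd n. coeff a d * coeff b (n div d))"
  unfolding coeff_mult[OF assms]
  by (rule sum.reindex_bij_witness[where i="\<lambda>d. (d, n div d)" and j=fst]) (use assms in auto)

lemma coeff_mult_proper:
  assumes "n > 0" "coeff a 1 = 0"
  shows "coeff (a * b) n = (\<Sum>d | d dvd n \<and> d > 1. coeff a d * coeff b (n div d))"
  unfolding coeff_mult_divisors[OF assms(1)]
proof (rule sum.mono_neutral_right)
  show "\<forall>i\<in>{d. d dvd n} - {d. d dvd n \<and> 1 < d}. fds.coeff a i * fds.coeff b (n div i) = 0"
  proof
    fix i assume "i \<in> {d. d dvd n} - {d. d dvd n \<and> 1 < d}"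
    then have "i = 1" using assms(1) by (cases "i = 0") auto
    then show "fds.coeff a i * fds.coeff b (n div i) = 0" using assms by simp
  qed
qed (use assms finite_divisors_set[of n "\<lambda>_. True"] in auto)

text \<open>The coefficient at m > 1 of the solution x of D x = A x. As the constant term of A
  vanishes, the right-hand side of the equation involves x only at proper divisors of
  m.\<close>

function ode_coeff :: "nat \<Rightarrow> fmat \<Rightarrow> (nat \<Rightarrow> complex) \<Rightarrow> nat \<Rightarrow> nat \<Rightarrow> complex" where
  "ode_coeff n A x m i =
     (if m \<le> 1 then x i
      else (\<Sum>l<n. \<Sum>d | d dvd m \<and> d > 1. coeff (A i l) d * ode_coeff n A x (m div d) l)
             / of_nat (big_omega m))"
  by auto
termination
  by (relation "Wellfounded.measure (\<lambda>(n, A, x, m, i). m)") auto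

declare ode_coeff.simps [simp del]

lemma ode_solution:
  fixes A :: fmat
  assumes "\<And>i l. i < n \<Longrightarrow> l < n \<Longrightarrow> coeff (A i l) 1 = 0"
  shows "\<exists>x. \<forall>i<n. omega_deriv (x i) = (\<Sum>l<n. A i l * x l) \<and> coeff (x i) 1 = init i"
proof (intro exI allI impI conjI)
  define x where "x = (\<lambda>i. mk_fds (\<lambda>m. ode_coeff n A init m i))"
  fix i assume i: "i < n"
  show "coeff (x i) 1 = init i"
    by (simp add: x_def coeff_mk_fds ode_coeff.simps)
  show "omega_deriv (x i) = (\<Sum>l<n. A i l * x l)"
  proof (rule fds_eqI)
    fix m :: nat assume m: "m \<ge> 1"
    have "coeff (\<Sum>l<n. A i l * x l) m
        = (\<Sum>l<n. \<Sum>d | d dvd m \<and> d > 1. coeff (A i l) d * coeff (x l) (m div d))"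
      using m i assms by (simp add: coeff_mult_proper)
    also have "\<dots> = (\<Sum>l<n. \<Sum>d | d dvd m \<and> d > 1. coeff (A i l) d * ode_coeff n A init (m div d) l)"
      using m by (intro sum.cong refl) (auto simp: x_def coeff_mk_fds dvd_def)
    also have "\<dots> = of_nat (big_omega m) * coeff (x i) m"
    proof (cases "m = 1")
      case True
      then show ?thesis by (auto simp: big_omega_def intro!: sum.neutral)
    next
      case False
      then have "big_omega m \<noteq> 0" using m by (simp add: big_omega_eq_0_iff)
      moreover have "coeff (x i) m = ode_coeff n A init m i"
        using m by (simp add: x_def coeff_mk_fds)
      ultimately show ?thesis using False m
        by (simp add: ode_coeff.simps[of n A init m i])
    qed
    finally show "coeff (omega_deriv (x i)) m = coeff (\<Sum>l<n. A i l * x l) m" by simp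
  qed
qed

text \<open>At m > 1 the left-hand side is \<Omega>(m) \<noteq> 0 times the coefficient of Z,
  and the right-hand side is a combination of coefficients of Z at proper divisors of
  m.\<close>

lemma commutator_ode_unique:
  fixes A Z :: fmat
  assumes A: "\<And>i l. i < n \<Longrightarrow> l < n \<Longrightarrow> coeff (A i l) 1 = 0"
    and Z: "\<And>i j. i < n \<Longrightarrow> j < n \<Longrightarrow> omega_deriv (Z i j) = (mmul n A Z - mmul n Z A) i j"
    and Z1: "\<And>i j. i < n \<Longrightarrow> j < n \<Longrightarrow> coeff (Z i j) 1 = 0"
    and ij: "i < n" "j < n"
  shows "Z i j = 0"
proof -
  have "m \<ge> 1 \<Longrightarrow> \<forall>i<n. \<forall>j<n. coeff (Z i j) m = 0" for m
  proof (induction m rule: less_induct)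
    case (less m)
    show ?case
    proof (cases "m = 1")
      case True then show ?thesis using Z1 by simp
    next
      case False
      with less.prems have m: "m > 1" by simp
      show ?thesis
      proof (intro allI impI)
        fix i j assume ij: "i < n" "j < n"
        have zero: "coeff (Z i' j') (m div d) = 0" if "d dvd m" "1 < d" "i' < n" "j' < n" for d i' j'
        proof -
          from \<open>d dvd m\<close> obtain e where "m = d * e" by (auto simp: dvd_def)
          then show ?thesis using less.IH[of e] that m by (cases "e = 0") auto
        qed
        have "coeff (omega_deriv (Z i j)) m = (\<Sum>l<n. coeff (A i l * Z l j) m) - (\<Sum>l<n. coeff (A l j * Z i l) m)"
          unfolding Z[OF ij] by (simp add: mmul_def mult.commute)
        also have "\<dots> = 0"
          using m ij A zero by (simp add: coeff_mult_proper)
        finally show "coeff (Z i j) m = 0"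
          using m big_omega_eq_0_iff[of m] by simp
      qed
    qed
  qed
  then show ?thesis using ij by (intro fds_eqI) simp
qed

text \<open>Parallel transport along the path of dilations of E, starting from a factorization
  of its constant term over the complex numbers. The differential equations for X and Y are
  part of the conclusion because the growth of the factors is read off from them.\<close>

theorem formal_idempotent_factorization:
  assumes E: "mmul n E E = E"
  shows "\<exists>k X Y x0 y0. (\<forall>i<n. \<forall>j<n. mmul k X Y i j = E i j)
      \<and> (\<forall>i<k. \<forall>j<k. mmul n Y X i j = (if i = j then 1 else 0))
      \<and> (\<forall>j<k. \<forall>i<n. omega_deriv (X i j) = (\<Sum>l<n. connection n E i l * X l j) \<and> coeff (X i j) 1 = x0 i j)
      \<and> (\<forall>j<k. \<forall>i<n. omega_deriv (Y j i) = (\<Sum>l<n. - connection n E l i * Y j l) \<and> coeff (Y j i) 1 = y0 i j)"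
proof -
  define A where "A = connection n E"
  have A1: "coeff (A i l) 1 = 0" for i l
    by (simp add: A_def connection_def mmul_def mderiv_def big_omega_def)
  define E0 where "E0 i j = coeff (E i j) 1" for i j
  have "(\<Sum>l<n. E0 i l * E0 l j) = E0 i j" for i j
    using arg_cong[OF fun_cong[OF fun_cong[OF E, of i], of j], of "\<lambda>a. coeff a 1"]
    by (simp add: mmul_def E0_def)
  then obtain k :: nat and X0 Y0 where
      XY0: "\<forall>i<n. \<forall>j<n. (\<Sum>l<k. X0 i l * Y0 l j) = E0 i j"
    and YX0: "\<forall>i<k. \<forall>j<k. (\<Sum>l<n. Y0 i l * X0 l j) = (if i = j then 1 else (0::complex))"
    using complex_idempotent_factorization[of n E0] by auto
  obtain X' where X': "\<And>j i. i < n \<Longrightarrow> omega_deriv (X' j i) = (\<Sum>l<n. A i l * X' j l) \<and> coeff (X' j i) 1 = X0 i j"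
    using ode_solution[of n A, OF A1, where init="\<lambda>i. X0 i j" for j] by metis
  have "coeff (- A l i) 1 = 0" for i l using A1 by simp
  then obtain Y where Y: "\<And>j i. i < n \<Longrightarrow> omega_deriv (Y j i) = (\<Sum>l<n. - A l i * Y j l) \<and> coeff (Y j i) 1 = Y0 j i"
    using ode_solution[of n "\<lambda>i l. - A l i" "Y0 j" for j] by metis
  define X where "X i j = X' j i" for i j
  have X: "omega_deriv (X i j) = (\<Sum>l<n. A i l * X l j) \<and> coeff (X i j) 1 = X0 i j" if "i < n" for i j
    using X'[OF that] by (simp add: X_def)
  \<comment> \<open>The two derivatives cancel, so Y X is constant.\<close>
  have YX: "mmul n Y X i j = (if i = j then 1 else 0)" if ij: "i < k" "j < k" for i j
  proof -
    have "omega_deriv (mmul n Y X i j) = (\<Sum>m<n. omega_deriv (Y i m) * X m j) + (\<Sum>m<n. Y i m * omega_deriv (X m j))"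
      by (simp add: mmul_def omega_deriv_sum omega_deriv_mult sum.distrib)
    also have "(\<Sum>m<n. omega_deriv (Y i m) * X m j) = (\<Sum>m<n. (\<Sum>l<n. - A l m * Y i l) * X m j)"
      using Y by (intro sum.cong) auto
    also have "\<dots> = - (\<Sum>l<n. Y i l * (\<Sum>m<n. A l m * X m j))"
      unfolding sum_distrib_right sum_distrib_left sum_negf[symmetric]
      by (subst sum.swap) (simp add: mult_ac)
    also have "(\<Sum>m<n. Y i m * omega_deriv (X m j)) = (\<Sum>l<n. Y i l * (\<Sum>m<n. A l m * X m j))"
      using X by (intro sum.cong) auto
    finally have *: "omega_deriv (mmul n Y X i j) = 0" by simp
    show ?thesis
    proof (rule fds_eqI)
      fix m :: nat assume m: "m \<ge> 1"
      show "coeff (mmul n Y X i j) m = coeff (if i = j then 1 else 0) m"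
      proof (cases "m = 1")
        case True
        then show ?thesis using YX0 ij X Y by (simp add: mmul_def)
      next
        case False
        then have "big_omega m \<noteq> 0" using m by (simp add: big_omega_eq_0_iff)
        then show ?thesis using arg_cong[OF *, of "\<lambda>a. coeff a m"] False
          by (simp add: coeff_one)
      qed
    qed
  qed
  \<comment> \<open>X Y and E satisfy the same commutator equation.\<close>
  define Z where "Z = mmul k X Y - E"
  have dZ: "omega_deriv (Z i j) = (mmul n A Z - mmul n Z A) i j" if ij: "i < n" "j < n" for i j
  proof -
    have "omega_deriv (mmul k X Y i j) = (\<Sum>m<k. omega_deriv (X i m) * Y m j) + (\<Sum>m<k. X i m * omega_deriv (Y m j))"
      by (simp add: mmul_def omega_deriv_sum omega_deriv_mult sum.distrib)
    also have "(\<Sum>m<k. omega_deriv (X i m) * Y m j) = mmul k (mmul n A X) Y i j"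
      unfolding mmul_def using X[OF ij(1)] by (intro sum.cong) auto
    also have "(\<Sum>m<k. X i m * omega_deriv (Y m j)) = - mmul k X (mmul n Y A) i j"
      unfolding mmul_def using Y[OF ij(2)] by (simp add: sum_negf mult.commute)
    finally have XY: "omega_deriv (mmul k X Y i j) = (mmul n A (mmul k X Y) - mmul n (mmul k X Y) A) i j"
      by (simp add: mmul_assoc)
    have "omega_deriv (E i j) = (mmul n A E - mmul n E A) i j"
      using mderiv_idempotent[OF E] by (simp add: A_def mderiv_def fun_eq_iff)
    then show ?thesis using XY by (simp add: Z_def omega_deriv_diff mmul_algebra)
  qed
  have "coeff (Z i j) 1 = 0" if ij: "i < n" "j < n" for i j
    using XY0 X Y ij by (simp add: Z_def mmul_def E0_def)
  then have "Z i j = 0" if "i < n" "j < n" for i j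
    using commutator_ode_unique[of n A Z, OF A1 dZ _ that] by blast
  then have XY: "mmul k X Y i j = E i j" if "i < n" "j < n" for i j
    using that by (simp add: Z_def)
  show ?thesis
    unfolding A_def[symmetric]
    by (rule exI[of _ k], rule exI[of _ X], rule exI[of _ Y], rule exI[of _ X0],
        rule exI[of _ "\<lambda>i j. Y0 j i"], intro conjI allI impI) (use XY YX X Y in simp_all)
qed

section \<open>Growth of the homogeneous parts of the factors\<close>

lemma Suc_le_const_power:
  fixes p :: real
  assumes "p > 1"
  shows "\<exists>M\<ge>0. \<forall>m. real m + 1 \<le> M * p ^ m"
proof (intro exI[of _ "1 + 1 / (p - 1)"] conjI allI)
  fix m
  have "1 + real m * (p - 1) \<le> p ^ m"
    using Bernoulli_inequality[of "p - 1" m] assms by simp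
  then have "(1 + 1 / (p - 1)) * (1 + real m * (p - 1)) \<le> (1 + 1 / (p - 1)) * p ^ m"
    using assms by (intro mult_left_mono) auto
  moreover have "(1 + 1 / (p - 1)) * (1 + real m * (p - 1)) = 1 + real m + (real m * (p - 1) + 1 / (p - 1))"
    using assms by (simp add: field_simps)
  moreover have "real m * (p - 1) + 1 / (p - 1) \<ge> 0" using assms by simp
  ultimately show "real m + 1 \<le> (1 + 1 / (p - 1)) * p ^ m" by linarith
qed (use assms in auto)

text \<open>A Banach algebra of Dirichlet series, given by its norm bounds: bd a C means that
  a lies in the algebra and has norm at most C. Completeness (bd_sums) is convergence of
  absolutely convergent series; coefficientwise convergence suffices to identify the sum since
  the coefficients are continuous (bd_coeff). The projections to the homogeneous parts are
  contractions.\<close>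

locale graded_algebra =
  fixes bd :: "fds \<Rightarrow> real \<Rightarrow> bool"
  assumes bd_zero: "bd 0 0"
    and bd_one: "bd 1 1"
    and bd_nonneg: "bd a C \<Longrightarrow> 0 \<le> C"
    and bd_mono: "bd a C \<Longrightarrow> C \<le> D \<Longrightarrow> bd a D"
    and bd_add: "bd a C \<Longrightarrow> bd b D \<Longrightarrow> bd (a + b) (C + D)"
    and bd_scale: "bd a C \<Longrightarrow> bd (fconst c * a) (norm c * C)"
    and bd_mult: "bd a C \<Longrightarrow> bd b D \<Longrightarrow> bd (a * b) (C * D)"
    and bd_hom_part: "bd a C \<Longrightarrow> bd (hom_part m a) C"
    and bd_coeff: "\<exists>K. \<forall>a C. bd a C \<longrightarrow> norm (coeff a n) \<le> K * C"
    and bd_sums: "(\<And>k. bd (f k) (B k)) \<Longrightarrow> summable B \<Longrightarrow>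
                    \<exists>b. bd b (suminf B) \<and> (\<forall>n. (\<lambda>k. coeff (f k) n) sums coeff b n)"
begin

lemma bd_sum: "(\<And>i. i \<in> I \<Longrightarrow> bd (f i) (C i)) \<Longrightarrow> bd (sum f I) (sum C I)"
  by (induction I rule: infinite_finite_induct) (auto intro: bd_zero bd_add)

lemma bd_sum_const: "(\<And>i. i < n \<Longrightarrow> bd (f i) C) \<Longrightarrow> bd (\<Sum>i<n. f i) (real n * C)"
  using bd_sum[of "{..<n}" f "\<lambda>_. C"] by simp

lemma minus_eq_fconst: "- a = fconst (- 1) * a"
  by (rule fds_eqI) simp

lemma bd_uminus: "bd a C \<Longrightarrow> bd (- a) C"
  using bd_scale[of a C "-1"] by (simp add: minus_eq_fconst)

lemma bd_diff: "bd a C \<Longrightarrow> bd b D \<Longrightarrow> bd (a - b) (C + D)"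
  using bd_add[of a C "- b" D] bd_uminus[of b D] by simp

lemma bd_fconst: "bd (fconst c) (norm c)"
  using bd_scale[OF bd_one, of c] by simp

lemma bd_uniform: 
  assumes "\<And>i. i < n \<Longrightarrow> \<exists>C. bd (f i) C"
  shows "\<exists>C. \<forall>i<(n::nat). bd (f i) C"
proof -
  obtain C where C: "\<And>i. i < n \<Longrightarrow> bd (f i) (C i)" using assms by metis
  have "bd (f i) (\<Sum>j<n. C j)" if "i < n" for i
  proof (rule bd_mono[OF C[OF that]])
    show "C i \<le> (\<Sum>j<n. C j)"
      by (rule member_le_sum) (use that C bd_nonneg in auto)
  qed
  then show ?thesis by blast
qed

lemma bd_uniform2:
  fixes f :: fmat
  assumes "\<And>i j. i < n \<Longrightarrow> j < m \<Longrightarrow> \<exists>C. bd (f i j) C"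
    and "\<And>i j. \<not> (i < n \<and> j < m) \<Longrightarrow> f i j = 0"
  shows "\<exists>C\<ge>0. \<forall>i j. bd (f i j) C"
proof -
  have "\<exists>C. bd (f i j) C" for i j
    using assms[of i j] bd_zero by (cases "i < n \<and> j < m") auto
  then have "\<exists>C. \<forall>j<m. bd (f i j) C" for i by (intro bd_uniform)
  then obtain D where D: "\<And>i j. j < m \<Longrightarrow> bd (f i j) (D i)" by metis
  define C where "C = (\<Sum>i<n. \<bar>D i\<bar>)"
  have C0: "C \<ge> 0" unfolding C_def by (intro sum_nonneg) auto
  have "bd (f i j) C" for i j
  proof (cases "i < n \<and> j < m")
    case True
    then have "\<bar>D i\<bar> \<le> C" unfolding C_def by (intro member_le_sum) auto
    then show ?thesis using bd_mono[OF D[of j i]] True by simp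
  next
    case False
    then show ?thesis using bd_mono[OF bd_zero C0] assms(2) by simp
  qed
  then show ?thesis using C0 by blast
qed

text \<open>Subexponential growth of the homogeneous parts: by the root test, the expansion of
  dilate r a into homogeneous parts converges absolutely in norm for every r in (0,1).\<close>

definition tame :: "fds \<Rightarrow> bool" where
  "tame a \<longleftrightarrow> (\<forall>q>1. \<exists>K. \<forall>m. bd (hom_part m a) (K * q ^ m))"

lemma tameE:
  assumes "tame a" "q > 1"
  obtains K where "K \<ge> 0" "\<And>m. bd (hom_part m a) (K * q ^ m)"
  using assms bd_nonneg unfolding tame_def by (metis mult.right_neutral power_0)

lemma tameI: 
  assumes "\<And>q. q > 1 \<Longrightarrow> \<exists>K. \<forall>m. bd (hom_part m a) (K * q ^ m)" shows "tame a"
  using assms by (auto simp: tame_def)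

lemma tame_bd: assumes "bd a C" shows "tame a"
proof (rule tameI)
  fix q :: real assume "q > 1"
  then have "C \<le> C * q ^ m" for m
    using mult_left_mono[of 1 "q ^ m" C] bd_nonneg[OF assms] by simp
  then show "\<exists>K. \<forall>m. bd (hom_part m a) (K * q ^ m)"
    using bd_mono[OF bd_hom_part[OF assms]] by blast
qed

lemma tame_add:
  assumes "tame a" "tame b" shows "tame (a + b)"
proof (rule tameI)
  fix q :: real assume q: "q > 1"
  obtain K where K: "\<And>m. bd (hom_part m a) (K * q ^ m)" using tameE[OF assms(1) q] by metis
  obtain L where L: "\<And>m. bd (hom_part m b) (L * q ^ m)" using tameE[OF assms(2) q] by metis
  show "\<exists>K. \<forall>m. bd (hom_part m (a + b)) (K * q ^ m)"
    using bd_add[OF K L] by (intro exI[of _ "K + L"]) (simp add: hom_part_add distrib_right)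
qed

lemma tame_mult:
  assumes "tame a" "tame b" shows "tame (a * b)"
proof (rule tameI)
  fix q :: real assume q: "q > 1"
  \<comment> \<open>Splitting q = p^2 leaves a factor p^m to absorb the number m + 1 of
    summands.\<close>
  define p where "p = sqrt q"
  have p: "p > 1" "q = p * p" using q by (auto simp: p_def)
  obtain K where K: "K \<ge> 0" "\<And>m. bd (hom_part m a) (K * p ^ m)" using tameE[OF assms(1) p(1)] by metis
  obtain L where L: "L \<ge> 0" "\<And>m. bd (hom_part m b) (L * p ^ m)" using tameE[OF assms(2) p(1)] by metis
  obtain M where M: "M \<ge> 0" "\<And>m. real m + 1 \<le> M * p ^ m"
    using Suc_le_const_power[OF p(1)] by blast
  have "bd (hom_part m (a * b)) (K * L * M * q ^ m)" for m
  proof -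
    have "bd (hom_part m (a * b)) (\<Sum>j\<le>m. K * p ^ j * (L * p ^ (m - j)))"
      unfolding hom_part_mult by (intro bd_sum bd_mult K L)
    also have "(\<Sum>j\<le>m. K * p ^ j * (L * p ^ (m - j))) = (\<Sum>j\<le>m. K * L * p ^ m)"
      by (intro sum.cong) (auto simp: power_add[symmetric] mult_ac)
    also have "\<dots> = K * L * p ^ m * (real m + 1)" by simp
    finally have *: "bd (hom_part m (a * b)) (K * L * p ^ m * (real m + 1))" .
    have "K * L * p ^ m * (real m + 1) \<le> K * L * p ^ m * (M * p ^ m)"
      by (rule mult_left_mono[OF M(2)]) (use K L p in auto)
    also have "\<dots> = K * L * M * q ^ m" by (simp add: p(2) power_mult_distrib)
    finally show ?thesis using bd_mono[OF *] by blast
  qed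
  then show "\<exists>K. \<forall>m. bd (hom_part m (a * b)) (K * q ^ m)" by blast
qed

lemma tame_fconst: "tame (fconst c)"
  using tame_bd[OF bd_fconst] .

lemma tame_zero: "tame 0" using tame_bd[OF bd_zero] .

lemma tame_uminus: "tame a \<Longrightarrow> tame (- a)"
  unfolding minus_eq_fconst by (intro tame_mult tame_fconst)

lemma tame_diff: "tame a \<Longrightarrow> tame b \<Longrightarrow> tame (a - b)"
  using tame_add[of a "- b"] tame_uminus[of b] by simp

lemma tame_sum: "(\<And>i. i \<in> I \<Longrightarrow> tame (f i)) \<Longrightarrow> tame (sum f I)"
  by (induction I rule: infinite_finite_induct) (auto intro: tame_zero tame_add)

lemma hom_part_omega_deriv: "hom_part m (omega_deriv a) = fconst (of_nat m) * hom_part m a"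
  by (rule fds_eqI) (simp add: coeff_hom_part)

lemma tame_omega_deriv: assumes "tame a" shows "tame (omega_deriv a)"
proof (rule tameI)
  fix q :: real assume q: "q > 1"
  define p where "p = sqrt q"
  have p: "p > 1" "q = p * p" using q by (auto simp: p_def)
  obtain K where K: "K \<ge> 0" "\<And>m. bd (hom_part m a) (K * p ^ m)" using tameE[OF assms(1) p(1)] by metis
  obtain M where M: "M \<ge> 0" "\<And>m. real m + 1 \<le> M * p ^ m"
    using Suc_le_const_power[OF p(1)] by blast
  have "bd (hom_part m (omega_deriv a)) (K * M * q ^ m)" for m
  proof -
    have *: "bd (hom_part m (omega_deriv a)) (real m * (K * p ^ m))"
      using bd_scale[OF K(2), of "of_nat m" m] by (simp add: hom_part_omega_deriv)
    have "real m * (K * p ^ m) \<le> (M * p ^ m) * (K * p ^ m)"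
      using M(2)[of m] K p by (intro mult_right_mono) auto
    also have "\<dots> = K * M * q ^ m" by (simp add: p(2) power_mult_distrib)
    finally show ?thesis using bd_mono[OF *] by blast
  qed
  then show "\<exists>K. \<forall>m. bd (hom_part m (omega_deriv a)) (K * q ^ m)" by blast
qed

lemma tame_mmul:
  "(\<And>i j. tame (A i j)) \<Longrightarrow> (\<And>i j. tame (B i j)) \<Longrightarrow> tame (mmul n A B i j)"
  unfolding mmul_def by (intro tame_sum tame_mult)

text \<open>The homogeneous parts satisfy m x_m = A_1 x_(m-1) + \<dots> + A_m x_0. If A_j is
  bounded by L p^j with p < q, then a bound M q^j for j < m yields (n L g / m) M q^m for x_m,
  where g is the sum of a geometric series, and this is at most M q^m once m exceeds n L g.
  The finitely many smaller degrees only affect the choice of M.\<close>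

lemma ode_solution_tame:
  fixes A :: fmat and n :: nat
  assumes A: "\<And>i l. i < n \<Longrightarrow> l < n \<Longrightarrow> tame (A i l)"
    and A1: "\<And>i l. i < n \<Longrightarrow> l < n \<Longrightarrow> coeff (A i l) 1 = 0"
    and x: "\<And>i. i < n \<Longrightarrow> omega_deriv (x i) = (\<Sum>l<n. A i l * x l) \<and> coeff (x i) 1 = x0 i"
    and i: "i < n"
  shows "tame (x i)"
proof (rule tameI)
  fix q :: real assume q: "q > 1"
  define p where "p = sqrt q"
  have p: "p > 1" "q = p * p" using q by (auto simp: p_def)
  have hom0: "hom_part 0 a = fconst (coeff a 1)" for a
    by (rule fds_eqI) (auto simp: coeff_hom_part coeff_fconst big_omega_eq_0_iff)
  have rec: "hom_part m (x i) = fconst (1 / of_nat m) *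
      (\<Sum>l<n. \<Sum>j\<in>{1..m}. hom_part j (A i l) * hom_part (m - j) (x l))"
    if m: "m > 0" and i: "i < n" for m i
  proof -
    have "hom_part j (A i l) * hom_part (m - j) (x l) = 0" if "j \<in> {..m} - {1..m}" "l < n" for j l
    proof -
      have "j = 0" using that by auto
      then show ?thesis using A1[OF i \<open>l < n\<close>]
        by (simp add: hom0) (metis coeff_fconst_mult coeff_zero fds_eqI mult_zero_left)
    qed
    then have "(\<Sum>l<n. \<Sum>j\<in>{1..m}. hom_part j (A i l) * hom_part (m - j) (x l))
         = (\<Sum>l<n. \<Sum>j\<le>m. hom_part j (A i l) * hom_part (m - j) (x l))"
      by (intro sum.cong sum.mono_neutral_left ballI) auto
    also have "\<dots> = hom_part m (omega_deriv (x i))"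
      using x[OF i] by (simp add: hom_part_sum hom_part_mult)
    finally have "(\<Sum>l<n. \<Sum>j\<in>{1..m}. hom_part j (A i l) * hom_part (m - j) (x l))
        = fconst (of_nat m) * hom_part m (x i)" by (simp add: hom_part_omega_deriv)
    then show ?thesis using m by (intro fds_eqI) (simp only: coeff_fconst_mult, simp)
  qed
  \<comment> \<open>Bounds without uniformity in m, which provide M.\<close>
  have stage1: "\<exists>C. \<forall>i<n. bd (hom_part m (x i)) C" for m
  proof (induction m rule: less_induct)
    case (less m)
    show ?case
    proof (rule bd_uniform)
      fix i assume i: "i < n"
      show "\<exists>C. bd (hom_part m (x i)) C"
      proof (cases "m = 0")
        case True
        then show ?thesis using bd_fconst hom0 by metis
      next
        case False
        obtain C where C: "\<And>m' l. m' < m \<Longrightarrow> l < n \<Longrightarrow> bd (hom_part m' (x l)) (C m')"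
          using less.IH by metis
        have "\<exists>K. \<forall>j. bd (hom_part j (A i l)) (K * q ^ j)" if "l < n" for l
          using A[OF i that] q unfolding tame_def by blast
        then obtain K where K: "\<And>l j. l < n \<Longrightarrow> bd (hom_part j (A i l)) (K l * q ^ j)"
          by metis
        have "bd (hom_part m (x i)) (norm (1 / of_nat m :: complex) *
            (\<Sum>l<n. \<Sum>j\<in>{1..m}. (K l * q ^ j) * C (m - j)))"
          unfolding rec[OF False[unfolded neq0_conv] i] by (intro bd_scale bd_sum bd_mult C K) auto
        then show ?thesis by blast
      qed
    qed
  qed
  obtain C where C: "\<And>m i. i < n \<Longrightarrow> bd (hom_part m (x i)) (C m)"
    using stage1 by metis
  have Cnn: "C m \<ge> 0" for m using C[OF i] bd_nonneg by blast
  have "\<exists>K. K \<ge> 0 \<and> (\<forall>m. bd (hom_part m (A i l)) (K * p ^ m))" if "i < n" "l < n" for i l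
    using tameE[OF A[OF that] p(1)] by metis
  then obtain K where K: "\<And>i l. i < n \<Longrightarrow> l < n \<Longrightarrow> K i l \<ge> 0"
       "\<And>i l m. i < n \<Longrightarrow> l < n \<Longrightarrow> bd (hom_part m (A i l)) (K i l * p ^ m)" by metis
  define L where "L = (\<Sum>i<n. \<Sum>l<n. K i l)"
  have KL: "K i l \<le> L" if "i < n" "l < n" for i l
  proof -
    have "K i l \<le> (\<Sum>l<n. K i l)" by (rule member_le_sum) (use that K in auto)
    also have "\<dots> \<le> L" unfolding L_def
      by (rule member_le_sum[of i _ "\<lambda>i. \<Sum>l<n. K i l"]) (use that K in \<open>auto intro: sum_nonneg\<close>)
    finally show ?thesis .
  qed
  have L: "bd (hom_part m (A i l)) (L * p ^ m)" if "i < n" "l < n" for i l m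
    by (rule bd_mono[OF K(2)[OF that]]) (use KL[OF that] p in auto)
  have L0: "L \<ge> 0" using KL[OF i i] K(1)[OF i i] by simp
  define g where "g = (1 / p) / (1 - 1 / p)"
  have g: "(\<Sum>j\<in>{1..m}. (1 / p) ^ j) \<le> g" for m
  proof -
    have "(\<lambda>j. (1/p) ^ Suc j) sums (1/p * (1 / (1 - 1 / p)))"
      using p(1) unfolding power_Suc by (intro sums_mult geometric_sums) auto
    then have "(\<lambda>j. (1/p) ^ Suc j) sums g" by (simp add: g_def)
    moreover have "(\<Sum>j\<in>{1..m}. (1 / p) ^ j) = (\<Sum>j<m. (1 / p) ^ Suc j)"
      unfolding One_nat_def sum.atLeast1_atMost_eq ..
    ultimately show ?thesis
      using sum_le_suminf[of "\<lambda>j. (1/p) ^ Suc j" "{..<m}"] p(1)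
      by (auto simp: sums_iff)
  qed
  have g0: "g \<ge> 0" using g[of 0] by simp
  obtain m0 where m0: "real n * L * g < real m0" using reals_Archimedean2 by blast
  define M where "M = (\<Sum>m\<le>m0. C m)"
  have M0: "M \<ge> 0" unfolding M_def by (intro sum_nonneg Cnn)
  have "\<forall>i<n. bd (hom_part m (x i)) (M * q ^ m)" for m
  proof (induction m rule: less_induct)
    case (less m)
    show ?case
    proof (intro allI impI)
      fix i assume i: "i < n"
      show "bd (hom_part m (x i)) (M * q ^ m)"
      proof (cases "m \<le> m0")
        case True
        have "C m \<le> M" unfolding M_def by (rule member_le_sum) (use True Cnn in auto)
        also have "M * 1 \<le> M * q ^ m" using M0 q by (intro mult_left_mono) auto
        finally show ?thesis using bd_mono[OF C[OF i]] by simp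
      next
        case False
        then have m: "m > 0" by simp
        have *: "bd (hom_part m (x i)) (norm (1 / of_nat m :: complex) *
           (\<Sum>l<n. \<Sum>j\<in>{1..m}. (L * p ^ j) * (M * q ^ (m - j))))"
          unfolding rec[OF m i] using less i by (intro bd_scale bd_sum bd_mult L) auto
        have "(\<Sum>j\<in>{1..m}. (L * p ^ j) * (M * q ^ (m - j))) = L * M * q ^ m * (\<Sum>j\<in>{1..m}. (1 / p) ^ j)"
          unfolding sum_distrib_left
        proof (intro sum.cong refl)
          fix j assume "j \<in> {1..m}"
          then have "q ^ m = q ^ (m - j) * (p ^ j * p ^ j)"
            using p by (metis atLeastAtMost_iff le_add_diff_inverse2 power_add power_mult_distrib)
          then show "(L * p ^ j) * (M * q ^ (m - j)) = L * M * q ^ m * (1 / p) ^ j"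
            using p by (simp add: power_divide)
        qed
        also have "\<dots> \<le> L * M * q ^ m * g"
          using L0 M0 q by (intro mult_left_mono[OF g]) auto
        finally have "(\<Sum>l<n. \<Sum>j\<in>{1..m}. (L * p ^ j) * (M * q ^ (m - j))) \<le> real n * (L * M * q ^ m * g)"
          unfolding sum_constant card_lessThan by (rule mult_left_mono) simp
        then have "norm (1 / of_nat m :: complex) * (\<Sum>l<n. \<Sum>j\<in>{1..m}. (L * p ^ j) * (M * q ^ (m - j)))
             \<le> 1 / real m * (real n * (L * M * q ^ m * g))"
          by (simp add: norm_divide divide_right_mono)
        also have "\<dots> = (real n * L * g) / real m * (M * q ^ m)" by simp
        also have "\<dots> \<le> 1 * (M * q ^ m)"
          using m0 False m M0 q by (intro mult_right_mono) (auto simp: divide_simps)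
        finally show ?thesis using bd_mono[OF *] by simp
      qed
    qed
  qed
  then show "\<exists>K. \<forall>m. bd (hom_part m (x i)) (K * q ^ m)" using i by blast
qed

text \<open>The tame series form a ring that is closed under D, so the matrix A is tame, and
  the columns of X and the rows of Y solve linear differential equations with coefficients
  from A.\<close>

theorem tame_idempotent_factorization:
  assumes E: "mmul n E E = E" and "\<And>i j. tame (E i j)"
  shows "\<exists>k X Y. (\<forall>i<n. \<forall>j<n. mmul k X Y i j = E i j)
      \<and> (\<forall>i<k. \<forall>j<k. mmul n Y X i j = (if i = j then 1 else 0))
      \<and> (\<forall>i<n. \<forall>j<k. tame (X i j)) \<and> (\<forall>j<k. \<forall>i<n. tame (Y j i))"
proof -
  have A: "tame (connection n E i l)" for i l
    unfolding connection_def fun_diff_def mderiv_def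
    by (intro tame_diff tame_mmul tame_omega_deriv assms)
  have A': "tame (- connection n E i l)" for i l
    by (intro tame_uminus A)
  have A1: "coeff (connection n E i l) 1 = 0" for i l
    by (simp add: connection_def mmul_def mderiv_def big_omega_def)
  obtain k X Y x0 y0 where 1: "\<forall>i<n. \<forall>j<n. mmul k X Y i j = E i j"
      "\<forall>i<k. \<forall>j<k. mmul n Y X i j = (if i = j then 1 else 0)"
    and X: "\<forall>j<k. \<forall>i<n. omega_deriv (X i j) = (\<Sum>l<n. connection n E i l * X l j) \<and> coeff (X i j) 1 = x0 i j"
    and Y: "\<forall>j<k. \<forall>i<n. omega_deriv (Y j i) = (\<Sum>l<n. - connection n E l i * Y j l) \<and> coeff (Y j i) 1 = y0 i j"
    using formal_idempotent_factorization[OF E] by (elim exE conjE) (rule that)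
  have "tame (X i j)" if "i < n" "j < k" for i j
    by (rule ode_solution_tame[of n "connection n E" "\<lambda>i. X i j" "\<lambda>i. x0 i j"])
       (use A A1 X that in auto)
  moreover have "tame (Y j i)" if "i < n" "j < k" for i j
    by (rule ode_solution_tame[of n "\<lambda>i l. - connection n E l i" "\<lambda>i. Y j i" "\<lambda>i. y0 i j"])
       (use A' A1 Y that in auto)
  ultimately show ?thesis
    using 1 by blast
qed

lemma bd_dilate_tame:
  assumes a: "tame a" and r: "0 < r" "r < 1"
  shows "\<exists>C. bd (dilate r a) C"
proof -
  define s where "s = sqrt r"
  have s: "0 < s" "s < 1" "r = s * s" using r by (auto simp: s_def)
  obtain K where K: "\<And>m. bd (hom_part m a) (K * (1 / s) ^ m)"
    using tameE[OF a, of "1 / s"] s by auto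
  have "r ^ k * (1 / s) ^ k = s ^ k" for k
    using s by (simp add: power_mult_distrib power_divide)
  then have "bd (fconst (of_real (r ^ k)) * hom_part k a) (K * s ^ k)" for k
    using bd_scale[OF K[of k], of "of_real (r ^ k)"] r by (simp add: norm_power mult_ac)
  moreover have "summable (\<lambda>k. K * s ^ k)"
    using s by (intro summable_mult summable_geometric) auto
  ultimately obtain b where b: "bd b (\<Sum>k. K * s ^ k)"
      "\<And>n. (\<lambda>k. coeff (fconst (of_real (r ^ k)) * hom_part k a) n) sums coeff b n"
    using bd_sums[of "\<lambda>k. fconst (of_real (r ^ k)) * hom_part k a" "\<lambda>k. K * s ^ k"] by blast
  have "b = dilate r a"
  proof (rule fds_eqI)
    fix n
    have "(\<lambda>k. coeff (fconst (of_real (r ^ k)) * hom_part k a) n) sums coeff (dilate r a) n"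
      using sums_single[of "big_omega n" "\<lambda>k. of_real (r ^ k) * coeff a n"]
      by (simp add: coeff_hom_part if_distrib[of "\<lambda>x. _ * x"] eq_commute[of "big_omega n"] cong: if_cong)
    then show "coeff b n = coeff (dilate r a) n" using b(2) sums_unique2 by blast
  qed
  then show ?thesis using b(1) by blast
qed

lemma bd_eq_zero:
  assumes "\<And>e. e > 0 \<Longrightarrow> bd a e" shows "a = 0"
proof (rule fds_eqI)
  fix n
  obtain K where K: "\<And>a C. bd a C \<Longrightarrow> norm (coeff a n) \<le> K * C"
    using bd_coeff by blast
  have *: "norm (coeff a n) \<le> K * e" if "e > 0" for e using K assms that by blast
  have "norm (coeff a n) \<le> 0"
  proof (cases "K \<le> 0")
    case True
    then show ?thesis using *[of 1] by linarith
  next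
    case False
    show ?thesis
    proof (rule field_le_epsilon)
      fix e :: real assume "e > 0"
      then show "norm (coeff a n) \<le> 0 + e" using *[of "e / K"] False by simp
    qed
  qed
  then show "coeff a n = coeff 0 n" by simp
qed

end

section \<open>From an idempotent to a nearby idempotent\<close>

locale dilation_continuous_algebra = graded_algebra +
  assumes dilate_tendsto:
    "bd a C \<Longrightarrow> \<delta> > 0 \<Longrightarrow> \<exists>r0<1. \<forall>r. r0 < r \<and> r < 1 \<longrightarrow> bd (dilate r a - a) \<delta>"
begin

text \<open>Let F be the dilation of E by some r < 1 close to 1; it factors as X' Y' over the
  algebra because E is tame. The matrix U = E F + (1 - E) (1 - F) = 1 + V satisfies E U = U F
  and is close to 1, so it is invertible and X = U X', Y = Y' U^(-1) factor E. Here X = E X',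
  and Y is the Neumann series of Y' (- V)^m, so that neither the unit matrix nor U^(-1) has to
  be formed.\<close>

theorem idempotent_factorization:
  assumes E: "mmul n E E = E" and E0: "\<And>i j. \<not> (i < n \<and> j < n) \<Longrightarrow> E i j = 0"
    and bdE: "\<And>i j. i < n \<Longrightarrow> j < n \<Longrightarrow> \<exists>C. bd (E i j) C"
  shows "\<exists>k X Y. (\<forall>i<n. \<forall>j<n. mmul k X Y i j = E i j)
      \<and> (\<forall>i<k. \<forall>j<k. mmul n Y X i j = (if i = j then 1 else 0))
      \<and> (\<forall>i<n. \<forall>j<k. \<exists>C. bd (X i j) C) \<and> (\<forall>j<k. \<forall>i<n. \<exists>C. bd (Y j i) C)"
proof -
  have E2: "mmul n E (mmul n E Z) = mmul n E Z" for Z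
    using E by (simp add: mmul_assoc[symmetric])
  have "\<exists>C\<ge>0. \<forall>i j. bd (E i j) C"
    by (rule bd_uniform2[of n n]) (use bdE E0 in auto)
  then obtain C where C0: "C \<ge> 0" and C: "\<And>i j. bd (E i j) C" by blast
  \<comment> \<open>Chosen so that right multiplication by V at least halves the bound for the
    entries of a matrix.\<close>
  define \<delta> where "\<delta> = 1 / (2 * (real n + 1) * (2 * real n * C + 1))"
  have \<delta>: "\<delta> > 0" "real n * (2 * (real n * (C * \<delta>)) + \<delta>) \<le> 1 / 2"
  proof -
    have P: "2 * real n * C + 1 > 0" using C0 by (simp add: add_nonneg_pos)
    then show "\<delta> > 0" by (simp add: \<delta>_def)
    have "real n * (2 * (real n * (C * \<delta>)) + \<delta>) = real n * ((2 * real n * C + 1) * \<delta>)"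
      by (simp add: algebra_simps)
    also have "(2 * real n * C + 1) * \<delta> = 1 / (2 * (real n + 1))"
      using P by (simp add: \<delta>_def)
    also have "real n * (1 / (2 * (real n + 1))) \<le> 1 / 2"
      by (simp add: field_simps)
    finally show "real n * (2 * (real n * (C * \<delta>)) + \<delta>) \<le> 1 / 2" .
  qed
  have "\<exists>r0<1. \<forall>r. r0 < r \<and> r < 1 \<longrightarrow> bd (dilate r (E i j) - E i j) \<delta>" for i j
    using dilate_tendsto[OF C \<delta>(1)] .
  then obtain r0 where r0: "\<And>i j. r0 i j < 1"
    "\<And>i j r. r0 i j < r \<Longrightarrow> r < 1 \<Longrightarrow> bd (dilate r (E i j) - E i j) \<delta>" by metis
  define r1 where "r1 = Max (insert 0 ((\<lambda>(i,j). r0 i j) ` ({..<n} \<times> {..<n})))"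
  have r1: "0 \<le> r1" "r1 < 1" "\<And>i j. i < n \<Longrightarrow> j < n \<Longrightarrow> r0 i j \<le> r1"
    unfolding r1_def using r0(1) by (auto intro!: Max_ge)
  define r where "r = (r1 + 1) / 2"
  have r: "0 < r" "r < 1" "r1 < r" using r1 by (auto simp: r_def)
  define F where "F i j = dilate r (E i j)" for i j
  have FE: "bd ((F - E) i j) \<delta>" for i j
  proof (cases "i < n \<and> j < n")
    case True
    then have "r0 i j < r" using r1(3)[of i j] r(3) by simp
    then show ?thesis using r0(2)[of i j r] r(2) by (simp add: F_def)
  next
    case False
    then have "(F - E) i j = 0" using E0 by (intro fds_eqI) (simp add: F_def)
    then show ?thesis using bd_mono[OF bd_zero, of \<delta>] \<delta> by simp
  qed
  obtain k X0 Y0 where XY0: "\<forall>i<n. \<forall>j<n. mmul k X0 Y0 i j = E i j"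
      and YX0: "\<forall>i<k. \<forall>j<k. mmul n Y0 X0 i j = (if i = j then 1 else 0)"
      and X0t: "\<forall>i<n. \<forall>j<k. tame (X0 i j)" and Y0t: "\<forall>j<k. \<forall>i<n. tame (Y0 j i)"
  proof -
    have "tame (E i j)" for i j using tame_bd[OF C] .
    from tame_idempotent_factorization[OF E this] show thesis
      by (elim exE conjE) (rule that)
  qed
  define X' where "X' i j = (if i < n \<and> j < k then dilate r (X0 i j) else 0)" for i j
  define Y' where "Y' i j = (if i < k \<and> j < n then dilate r (Y0 i j) else 0)" for i j
  have XY': "mmul k X' Y' = F"
  proof (intro ext)
    fix i j
    show "mmul k X' Y' i j = F i j"
    proof (cases "i < n \<and> j < n")
      case True
      then have "mmul k X' Y' i j = dilate r (mmul k X0 Y0 i j)"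
        unfolding mmul_def dilate_sum X'_def Y'_def by (intro sum.cong) (auto simp: dilate_mult)
      then show ?thesis using True XY0 by (simp add: F_def)
    next
      case False
      then have "F i j = 0" using E0 by (intro fds_eqI) (simp add: F_def)
      moreover have "mmul k X' Y' i j = 0"
        unfolding mmul_def X'_def Y'_def using False by (intro sum.neutral) auto
      ultimately show ?thesis by simp
    qed
  qed
  have YX': "mmul n Y' X' i j = (if i = j then 1 else 0)" if "i < k" "j < k" for i j
  proof -
    have "mmul n Y' X' i j = dilate r (mmul n Y0 X0 i j)"
      unfolding mmul_def dilate_sum X'_def Y'_def using that
      by (intro sum.cong) (auto simp: dilate_mult)
    also have "\<dots> = (if i = j then 1 else 0)" using YX0 that dilate_fconst[of r 1]
      by (auto intro: fds_eqI)
    finally show ?thesis .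
  qed
  have bdX': "\<exists>C. bd (X' i j) C" for i j
    using bd_dilate_tame[OF _ r(1,2)] X0t bd_zero by (auto simp: X'_def)
  have bdY': "\<exists>C. bd (Y' i j) C" for i j
    using bd_dilate_tame[OF _ r(1,2)] Y0t bd_zero by (auto simp: Y'_def)
  have FX': "mmul n F X' = X'"
  proof -
    have "mmul n F X' = mmul k X' (mmul n Y' X')"
      unfolding XY'[symmetric] mmul_assoc ..
    also have "\<dots> = X'"
    proof (intro ext)
      fix i j
      show "mmul k X' (mmul n Y' X') i j = X' i j"
      proof (cases "j < k")
        case True
        then have "mmul k X' (mmul n Y' X') i j = (\<Sum>l<k. if l = j then X' i l else 0)"
          unfolding mmul_def[of k] by (intro sum.cong) (auto simp: YX')
        then show ?thesis using True by simp
      next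
        case False
        then show ?thesis by (simp add: mmul_def X'_def)
      qed
    qed
    finally show ?thesis .
  qed
  \<comment> \<open>V = U - 1 = (2 E - 1) (F - E).\<close>
  define V where "V = (mmul n E F - E) - (F - mmul n E F)"
  have V: "bd (V i j) (2 * (real n * (C * \<delta>)) + \<delta>)" for i j
  proof -
    define H where "H = mmul n E (F - E)"
    have V: "V i j = H i j + H i j - (F - E) i j"
      by (simp add: V_def H_def mmul_algebra E algebra_simps)
    have "bd (H i j) (real n * (C * \<delta>))"
      unfolding H_def mmul_def by (intro bd_sum_const bd_mult C FE)
    then show ?thesis
      unfolding V mult_2 by (intro bd_diff bd_add FE)
  qed
  have half: "bd (mmul n Z V i j) (D / 2)" if Z: "\<And>i j. bd (Z i j) D" for Z D i j
  proof -
    have D0: "D \<ge> 0" using Z bd_nonneg by blast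
    have "bd (mmul n Z V i j) (real n * (D * (2 * (real n * (C * \<delta>)) + \<delta>)))"
      unfolding mmul_def by (intro bd_sum_const bd_mult Z V)
    moreover have "real n * (D * (2 * (real n * (C * \<delta>)) + \<delta>)) \<le> D / 2"
      using mult_left_mono[OF \<delta>(2) D0] by (simp add: algebra_simps)
    ultimately show ?thesis by (rule bd_mono)
  qed
  \<comment> \<open>Injectivity of right multiplication by 1 + V on matrices with bounded
    entries.\<close>
  have V_inj: "Z = 0" if Z: "Z = - mmul n Z V" and D: "\<And>i j. bd (Z i j) D" for Z D
  proof (intro ext)
    fix i j
    have "\<forall>i j. bd (Z i j) (D / 2 ^ m)" for m
    proof (induction m)
      case (Suc m)
      have "bd (mmul n Z V i j) (D / 2 ^ m / 2)" for i j
        by (rule half) (use Suc in blast)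
      then show ?case
        using bd_uminus by (subst Z) (simp add: field_simps)
    qed (use D in simp)
    moreover have "(\<lambda>m. D / 2 ^ m) \<longlonglongrightarrow> 0"
      by (rule LIMSEQ_divide_realpow_zero) simp
    ultimately have "bd (Z i j) e" if e: "e > 0" for e
    proof -
      obtain m where "D / 2 ^ m < e"
        using order_tendstoD(2)[OF \<open>(\<lambda>m. D / 2 ^ m) \<longlonglongrightarrow> 0\<close> e]
        by (auto dest: eventually_happens)
      then show ?thesis using bd_mono[of "Z i j" "D / 2 ^ m" e]
          \<open>\<And>m. \<forall>i j. bd (Z i j) (D / 2 ^ m)\<close> by auto
    qed
    then show "Z i j = 0 i j" using bd_eq_zero by simp
  qed
  have "\<exists>C\<ge>0. \<forall>i j. bd (Y' i j) C"
    by (intro bd_uniform2[of k n] bdY') (auto simp: Y'_def)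
  then obtain D where D0: "D \<ge> 0" and D: "\<And>i j. bd (Y' i j) D" by blast
  \<comment> \<open>The terms of the Neumann series.\<close>
  define T where "T = (\<lambda>m. ((\<lambda>Z. - mmul n Z V) ^^ m) Y')"
  have T_0: "T 0 = Y'" and T_Suc: "T (Suc m) = - mmul n (T m) V" for m
    by (auto simp: T_def)
  have T: "\<forall>i j. bd (T m i j) (D * (1 / 2) ^ m)" for m
  proof (induction m)
    case (Suc m)
    have "bd (mmul n (T m) V i j) (D * (1 / 2) ^ m / 2)" for i j
      by (rule half) (use Suc in blast)
    then show ?case
      using bd_uminus by (simp add: T_Suc)
  qed (use D in \<open>simp add: T_0\<close>)
  have "\<exists>b. bd b (suminf (\<lambda>m. D * (1 / 2) ^ m)) \<and> (\<forall>p. (\<lambda>m. coeff (T m i j) p) sums coeff b p)" for i j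
    using T by (intro bd_sums) (auto intro!: summable_mult summable_geometric)
  then obtain Y where Y: "\<And>i j. bd (Y i j) (suminf (\<lambda>m. D * (1 / 2) ^ m))"
    "\<And>i j p. (\<lambda>m. coeff (T m i j) p) sums coeff (Y i j) p" by metis
  have YV: "Y + mmul n Y V = Y'"
  proof (intro ext fds_eqI)
    fix i j p :: nat assume p: "p \<ge> 1"
    have "(\<lambda>m. coeff (mmul n (T m) V i j) p) sums coeff (mmul n Y V i j) p"
      using p unfolding mmul_def coeff_sum
      by (simp add: coeff_mult case_prod_unfold) (intro sums_sum sums_mult2 Y)
    then have "(\<lambda>m. - coeff (mmul n (T m) V i j) p) sums - coeff (mmul n Y V i j) p"
      by (rule sums_minus)
    then have "(\<lambda>m. coeff (T (Suc m) i j) p) sums - coeff (mmul n Y V i j) p"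
      by (simp add: T_Suc)
    then have "(\<lambda>m. coeff (T m i j) p) sums (- coeff (mmul n Y V i j) p + coeff (T 0 i j) p)"
      by (rule sums_Suc)
    then have "- coeff (mmul n Y V i j) p + coeff (T 0 i j) p = coeff (Y i j) p"
      using Y(2) sums_unique2 by blast
    then show "coeff ((Y + mmul n Y V) i j) p = coeff (Y' i j) p"
      by (simp add: T_0 algebra_simps)
  qed
  define X where "X = mmul n E X'"
  have VX': "X' + mmul n V X' = X"
    unfolding V_def X_def mmul_diff_left mmul_assoc FX' by simp
  have YX: "mmul n Y X i j = (if i = j then 1 else 0)" if "i < k" "j < k" for i j
  proof -
    have "mmul n Y X = mmul n (Y + mmul n Y V) X'"
      unfolding VX'[symmetric] by (simp add: mmul_algebra)
    then show ?thesis using YX' that by (simp add: YV)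
  qed
  have EV: "E + mmul n E V = mmul n E F"
    unfolding V_def mmul_diff_right E E2 by simp
  have bdX: "\<exists>C. bd (X i j) C" for i j
  proof -
    have "\<exists>Q. \<forall>l. bd (X' l j) (Q l)" using bdX' by (intro choice) blast
    then obtain Q where "\<And>l. bd (X' l j) (Q l)" by blast
    then have "bd (X i j) (\<Sum>l<n. C * Q l)"
      unfolding X_def mmul_def by (intro bd_sum bd_mult C)
    then show ?thesis by blast
  qed
  \<comment> \<open>X Y U = X Y' = E X' Y' = E F = E U, and U can be cancelled.\<close>
  define Z where "Z = mmul k X Y - E"
  have "Z = 0"
  proof -
    have "mmul k X Y + mmul n (mmul k X Y) V = mmul k X (Y + mmul n Y V)"
      by (simp add: mmul_algebra)
    also have "\<dots> = mmul n E F"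
      by (simp add: YV X_def mmul_assoc XY')
    finally have "Z + mmul n Z V = 0"
      using EV by (simp add: Z_def mmul_algebra algebra_simps)
    then have Z: "Z = - mmul n Z V" by (simp add: eq_neg_iff_add_eq_0)
    have "\<exists>C. bd (Z i j) C" for i j
    proof -
      have "\<exists>Q. \<forall>l. bd (X i l) (Q l)" using bdX by (intro choice) blast
      then obtain Q where "\<And>l. bd (X i l) (Q l)" by blast
      then have "bd (mmul k X Y i j) (\<Sum>l<k. Q l * suminf (\<lambda>m. D * (1 / 2) ^ m))"
        unfolding mmul_def by (intro bd_sum bd_mult Y)
      then show ?thesis unfolding Z_def fun_diff_def using bd_diff C by blast
    qed
    moreover have "Z i j = 0" if ij: "\<not> (i < n \<and> j < n)" for i j
    proof (cases "i < n")
      case False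
      then have "X i l = 0" for l using E0 by (simp add: X_def mmul_def)
      then show ?thesis using E0 ij by (simp add: Z_def mmul_def)
    next
      case True
      then have j: "\<not> j < n" using ij by simp
      have "F l j = 0" for l
        using E0[of l j] j by (intro fds_eqI) (simp add: F_def)
      then have "V l j = 0" for l
        using E0 j by (simp add: V_def mmul_def)
      then have "Y l j = 0" for l
        using fun_cong[OF fun_cong[OF YV, of l], of j] j by (simp add: mmul_def Y'_def)
      then show ?thesis using E0 ij by (simp add: Z_def mmul_def)
    qed
    ultimately have "\<exists>C\<ge>0. \<forall>i j. bd (Z i j) C"
      by (intro bd_uniform2[of n n])
    then obtain Q where "\<And>i j. bd (Z i j) Q" by blast
    then show "Z = 0" using V_inj[OF Z] by blast
  qed
  then have XY: "mmul k X Y = E" by (simp add: Z_def)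
  have bdY: "\<exists>C. bd (Y i j) C" for i j using Y(1) by blast
  show ?thesis
    by (rule exI[of _ k], rule exI[of _ X], rule exI[of _ Y], intro conjI allI impI)
      (use XY YX bdX bdY in simp_all)
qed

end

section \<open>Projective modules and idempotent matrices\<close>

abbreviation "RHP \<equiv> right_half_plane"

lemma function_ring_simps [simp]:
  "carrier (function_ring X) = X"
  "f \<otimes>\<^bsub>function_ring X\<^esub> g = (\<lambda>s\<in>RHP. f s * g s)"
  "f \<oplus>\<^bsub>function_ring X\<^esub> g = (\<lambda>s\<in>RHP. f s + g s)"
  "\<one>\<^bsub>function_ring X\<^esub> = (\<lambda>s\<in>RHP. 1)"
  "\<zero>\<^bsub>function_ring X\<^esub> = (\<lambda>s\<in>RHP. 0)"
  by (simp_all add: function_ring_def)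

locale function_algebra =
  fixes X :: "(complex \<Rightarrow> complex) set"
  assumes extensional_mem: "X \<subseteq> extensional RHP"
    and const_mem: "(\<lambda>s\<in>RHP. c) \<in> X"
    and add_mem: "f \<in> X \<Longrightarrow> g \<in> X \<Longrightarrow> (\<lambda>s\<in>RHP. f s + g s) \<in> X"
    and mult_mem: "f \<in> X \<Longrightarrow> g \<in> X \<Longrightarrow> (\<lambda>s\<in>RHP. f s * g s) \<in> X"
begin

lemma outside: "f \<in> X \<Longrightarrow> z \<notin> RHP \<Longrightarrow> f z = undefined"
  using extensional_mem by (meson extensional_arb subsetD)

lemma fun_eqI: "f \<in> X \<Longrightarrow> g \<in> X \<Longrightarrow> (\<And>z. z \<in> RHP \<Longrightarrow> f z = g z) \<Longrightarrow> f = g"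
  using extensional_mem by (meson extensionalityI subsetD)

lemma sum_mem:
  assumes "\<And>i. i \<in> F \<Longrightarrow> f i \<in> X" "\<And>i. i \<in> F \<Longrightarrow> g i \<in> X"
  shows "(\<lambda>z\<in>RHP. \<Sum>i\<in>F. f i z * g i z) \<in> X"
  using assms
proof (induction F rule: infinite_finite_induct)
  case (insert j F)
  have "(\<lambda>z\<in>RHP. (\<lambda>z\<in>RHP. f j z * g j z) z + (\<lambda>z\<in>RHP. \<Sum>i\<in>F. f i z * g i z) z) \<in> X"
    using insert by (intro add_mem mult_mem) auto
  also have "(\<lambda>z\<in>RHP. (\<lambda>z\<in>RHP. f j z * g j z) z + (\<lambda>z\<in>RHP. \<Sum>i\<in>F. f i z * g i z) z)
      = (\<lambda>z\<in>RHP. \<Sum>i\<in>insert j F. f i z * g i z)"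
    using insert by (intro restrict_ext) simp
  finally show ?case .
qed (use const_mem[of 0] in simp_all)

lemma cring_function_ring: "cring (function_ring X)"
proof (rule cringI)
  show "abelian_group (function_ring X)"
  proof (rule abelian_groupI)
    fix f assume f: "f \<in> carrier (function_ring X)"
    then have "(\<lambda>s\<in>RHP. (\<lambda>s\<in>RHP. - 1) s * f s) \<in> X"
      using mult_mem[OF const_mem[of "- 1"], of f] by simp
    moreover have "(\<lambda>s\<in>RHP. (\<lambda>s\<in>RHP. - 1) s * f s) \<oplus>\<^bsub>function_ring X\<^esub> f = \<zero>\<^bsub>function_ring X\<^esub>"
      by (auto simp: fun_eq_iff)
    ultimately show "\<exists>g\<in>carrier (function_ring X). g \<oplus>\<^bsub>function_ring X\<^esub> f = \<zero>\<^bsub>function_ring X\<^esub>"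
      unfolding function_ring_simps(1) by blast
  qed (auto simp: add_mem const_mem fun_eq_iff algebra_simps outside)
  show "comm_monoid (function_ring X)"
    by (rule comm_monoidI) (auto simp: mult_mem const_mem fun_eq_iff algebra_simps outside)
qed (auto simp: fun_eq_iff algebra_simps)

definition combination :: "'j set \<Rightarrow> ('j \<Rightarrow> complex \<Rightarrow> complex) \<Rightarrow> ('j \<Rightarrow> 'i \<Rightarrow> complex \<Rightarrow> complex)
    \<Rightarrow> 'i \<Rightarrow> complex \<Rightarrow> complex" where
  "combination F a u = (\<lambda>t. \<lambda>z\<in>RHP. \<Sum>j\<in>F. a j z * u j t z)"

lemma combination_mem_submodule:
  assumes P: "submodule P (function_ring X) (free_module (function_ring X) I)"
    and "\<And>j. j \<in> F \<Longrightarrow> a j \<in> X" "\<And>j. j \<in> F \<Longrightarrow> u j \<in> P"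
  shows "combination F a u \<in> P"
proof -
  interpret P: submodule P "function_ring X" "free_module (function_ring X) I" by fact
  have zero: "(\<lambda>t. \<lambda>z\<in>RHP. 0) \<in> P"
    using P.one_closed by (simp add: free_module_def)
  have add: "(\<lambda>t. \<lambda>z\<in>RHP. v t z + w t z) \<in> P" if "v \<in> P" "w \<in> P" for v w
    using P.m_closed[of v w] that by (simp add: free_module_def)
  show ?thesis
    using assms(2,3)
  proof (induction F rule: infinite_finite_induct)
    case (insert j F)
    have "(\<lambda>t. \<lambda>z\<in>RHP. a j z * u j t z) \<in> P"
      using P.smult_closed[of "a j" "u j"] insert.prems by (simp add: free_module_def)
    moreover have "combination F a u \<in> P" using insert by simp
    ultimately have "(\<lambda>t. \<lambda>z\<in>RHP. (\<lambda>z\<in>RHP. a j z * u j t z) z + combination F a u t z) \<in> P"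
      by (rule add)
    also have "(\<lambda>t. \<lambda>z\<in>RHP. (\<lambda>z\<in>RHP. a j z * u j t z) z + combination F a u t z) = combination (insert j F) a u"
      using insert.hyps by (auto simp: combination_def fun_eq_iff)
    finally show ?case .
  qed (simp_all add: combination_def zero)
qed

text \<open>A homomorphism into a free module over a ring of functions turns sums of the
  module into sums of complex numbers at each point; all later computations take place
  there.\<close>

lemma hom_finsum:
  fixes M :: "(complex \<Rightarrow> complex, 'm) module"
  assumes M: "Module.module (function_ring X) M"
    and hP: "\<And>x. x \<in> carrier M \<Longrightarrow> h x \<in> carrier (free_module (function_ring X) I)"
    and h_add: "\<And>x y. x \<in> carrier M \<Longrightarrow> y \<in> carrier M \<Longrightarrow>
        h (x \<oplus>\<^bsub>M\<^esub> y) = h x \<oplus>\<^bsub>free_module (function_ring X) I\<^esub> h y"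
    and h_smult: "\<And>a x. a \<in> X \<Longrightarrow> x \<in> carrier M \<Longrightarrow>
        h (a \<odot>\<^bsub>M\<^esub> x) = a \<odot>\<^bsub>free_module (function_ring X) I\<^esub> h x"
    and S: "finite S" "S \<subseteq> carrier M" "c \<in> S \<rightarrow> X" and z: "z \<in> RHP"
  shows "h (\<Oplus>\<^bsub>M\<^esub>s\<in>S. c s \<odot>\<^bsub>M\<^esub> s) t z = (\<Sum>s\<in>S. c s z * h s t z)"
proof -
  interpret M: Module.module "function_ring X" M by fact
  show ?thesis using S
  proof (induction S rule: finite_induct)
    case empty
    have "h (\<zero>\<^bsub>M\<^esub> \<oplus>\<^bsub>M\<^esub> \<zero>\<^bsub>M\<^esub>) t z = h \<zero>\<^bsub>M\<^esub> t z + h \<zero>\<^bsub>M\<^esub> t z"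
      using z by (subst h_add) (auto simp: free_module_def)
    then show ?case by simp
  next
    case (insert x S)
    have c: "(\<lambda>s. c s \<odot>\<^bsub>M\<^esub> s) \<in> S \<rightarrow> carrier M" "c x \<odot>\<^bsub>M\<^esub> x \<in> carrier M"
      using insert.prems by (auto intro!: M.smult_closed simp: Pi_iff)
    then have "(\<Oplus>\<^bsub>M\<^esub>s\<in>insert x S. c s \<odot>\<^bsub>M\<^esub> s) = c x \<odot>\<^bsub>M\<^esub> x \<oplus>\<^bsub>M\<^esub> (\<Oplus>\<^bsub>M\<^esub>s\<in>S. c s \<odot>\<^bsub>M\<^esub> s)"
      using insert.hyps by (intro M.finsum_insert) auto
    also have "h \<dots> t z = h (c x \<odot>\<^bsub>M\<^esub> x) t z + h (\<Oplus>\<^bsub>M\<^esub>s\<in>S. c s \<odot>\<^bsub>M\<^esub> s) t z"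
      using c z by (subst h_add) (auto simp: free_module_def)
    also have "h (c x \<odot>\<^bsub>M\<^esub> x) t z = c x z * h x t z"
      using insert.prems z by (subst h_smult) (auto simp: free_module_def)
    also have "h (\<Oplus>\<^bsub>M\<^esub>s\<in>S. c s \<odot>\<^bsub>M\<^esub> s) t z = (\<Sum>s\<in>S. c s z * h s t z)"
      using insert by auto
    finally show ?case using insert.hyps by simp
  qed
qed

text \<open>Let M be isomorphic to P, where P and Q are complementary in a free module, and
  let p_1, \<dots>, p_n be the images in P of generators of M. Projecting the standard basis
  vectors to P and expanding the projections in the generators gives coordinates \<phi> on P
  with v = \<phi>_1(v) p_1 + \<dots> + \<phi>_n(v) p_n. The coordinates E of the generators
  form an idempotent matrix, and if E = x y with y x = 1 of size k, then v \<mapsto> \<phi>(v)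
  x is an isomorphism from P onto the free module of rank k, with inverse f \<mapsto> f y
  p.\<close>

theorem projective_free_if_idempotents_factor:
  assumes factor: "\<And>(n::nat) e. (\<And>i j. i < n \<Longrightarrow> j < n \<Longrightarrow> e i j \<in> X) \<Longrightarrow>
      (\<And>i j z. i < n \<Longrightarrow> j < n \<Longrightarrow> z \<in> RHP \<Longrightarrow> (\<Sum>l<n. e i l z * e l j z) = e i j z) \<Longrightarrow>
      \<exists>(k::nat) x y. (\<forall>i<n. \<forall>a<k. x i a \<in> X \<and> y a i \<in> X) \<and>
        (\<forall>z\<in>RHP. \<forall>i<n. \<forall>j<n. (\<Sum>a<k. x i a z * y a j z) = e i j z) \<and>
        (\<forall>z\<in>RHP. \<forall>a<k. \<forall>b<k. (\<Sum>i<n. y a i z * x i b z) = (if a = b then 1 else 0))"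
  shows "projective_free TYPE('m) (function_ring X)"
  unfolding projective_free_def
proof (intro conjI allI impI cring_function_ring)
  fix M :: "(complex \<Rightarrow> complex, 'm) module"
  assume "finitely_generated_module (function_ring X) M \<and> projective_module (function_ring X) M"
  then have fg: "finitely_generated_module (function_ring X) M"
    and proj: "projective_module (function_ring X) M" by auto
  define R where "R = function_ring X"
  have carR [simp]: "carrier R = X" by (simp add: R_def)
  have M: "Module.module R M" using proj by (simp add: projective_module_def R_def)
  interpret M: Module.module R M by fact
  obtain S where S: "finite S" "S \<subseteq> carrier M"
    and gen: "\<And>x. x \<in> carrier M \<Longrightarrow> \<exists>c. c \<in> S \<rightarrow> X \<and> x = (\<Oplus>\<^bsub>M\<^esub>s\<in>S. c s \<odot>\<^bsub>M\<^esub> s)"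
    using fg unfolding finitely_generated_module_def by auto
  obtain I :: "'m set" and P Q where P: "submodule P R (free_module R I)"
    and Q: "submodule Q R (free_module R I)"
    and PQ0: "P \<inter> Q = {\<zero>\<^bsub>free_module R I\<^esub>}"
    and PQ: "set_add (free_module R I) P Q = carrier (free_module R I)"
    and iso: "module_isomorphic R M ((free_module R I)\<lparr>carrier := P\<rparr>)"
    using proj unfolding projective_module_def R_def by auto
  interpret P: submodule P R "free_module R I" by fact
  interpret Q: submodule Q R "free_module R I" by fact
  obtain h where h: "bij_betw h (carrier M) P"
    and h_add: "\<And>x y. x \<in> carrier M \<Longrightarrow> y \<in> carrier M \<Longrightarrow> h (x \<oplus>\<^bsub>M\<^esub> y) = h x \<oplus>\<^bsub>free_module R I\<^esub> h y"
    and h_smult: "\<And>a x. a \<in> X \<Longrightarrow> x \<in> carrier M \<Longrightarrow> h (a \<odot>\<^bsub>M\<^esub> x) = a \<odot>\<^bsub>free_module R I\<^esub> h x"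
    using iso unfolding module_isomorphic_def by (auto simp: R_def free_module_def)
  have P_free: "v t \<in> X" "t \<notin> I \<Longrightarrow> v t = (\<lambda>z\<in>RHP. 0)" "finite {t. v t \<noteq> (\<lambda>z\<in>RHP. 0)}"
    if "v \<in> carrier (free_module R I)" for v t
    using that by (auto simp: free_module_def R_def)
  have PF: "P \<subseteq> carrier (free_module R I)" "Q \<subseteq> carrier (free_module R I)"
    using P.subset Q.subset by auto
  have hP: "h x \<in> P" if "x \<in> carrier M" for x using h that by (auto simp: bij_betw_def)
  define n where "n = card S"
  obtain sg where sg: "bij_betw sg {..<n} S"
    using ex_bij_betw_nat_finite[OF S(1)] by (auto simp: atLeast0LessThan n_def)
  define p where "p i = h (sg i)" for i
  have pP: "p i \<in> P" if "i < n" for i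
    using sg S(2) that hP by (auto simp: p_def bij_betw_def)
  have genP: "\<exists>c. (\<forall>i<n. c i \<in> X) \<and> (\<forall>t. \<forall>z\<in>RHP. v t z = (\<Sum>i<n. c i z * p i t z))" if "v \<in> P" for v
  proof -
    have "v \<in> h ` carrier M" using h that by (simp add: bij_betw_def)
    then obtain x where x: "x \<in> carrier M" "v = h x" by auto
    obtain c where c: "c \<in> S \<rightarrow> X" "x = (\<Oplus>\<^bsub>M\<^esub>s\<in>S. c s \<odot>\<^bsub>M\<^esub> s)" using gen[OF x(1)] by blast
    have "v t z = (\<Sum>i<n. c (sg i) z * p i t z)" if "z \<in> RHP" for t z
    proof -
      have "h (\<Oplus>\<^bsub>M\<^esub>s\<in>S. c s \<odot>\<^bsub>M\<^esub> s) t z = (\<Sum>s\<in>S. c s z * h s t z)"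
        by (rule hom_finsum[where I=I])
          (use M h_add h_smult S c that hP PF in \<open>auto simp: R_def\<close>)
      then show ?thesis
        using sum.reindex_bij_betw[OF sg, of "\<lambda>s. c s z * h s t z"] x(2) c(2) by (simp add: p_def)
    qed
    moreover have "\<forall>i<n. c (sg i) \<in> X" using c(1) sg by (auto simp: bij_betw_def)
    ultimately show ?thesis by (intro exI[of _ "\<lambda>i. c (sg i)"]) auto
  qed
  \<comment> \<open>The standard basis of the free module, and its components u in P and w in
    Q.\<close>
  define e where "e t = (\<lambda>t'. if t' = t then (\<lambda>z\<in>RHP. 1) else (\<lambda>z\<in>RHP. (0::complex)))" for t :: 'm
  have "\<exists>u w. u \<in> P \<and> w \<in> Q \<and> (\<forall>t'. \<forall>z\<in>RHP. e t t' z = u t' z + w t' z)" if t: "t \<in> I" for t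
  proof -
    have "finite {t'. e t t' \<noteq> (\<lambda>z\<in>RHP. 0)}"
      by (rule finite_subset[of _ "{t}"]) (auto simp: e_def)
    then have "e t \<in> carrier (free_module R I)"
      using t const_mem by (auto simp: free_module_def R_def e_def)
    then obtain u w where "u \<in> P" "w \<in> Q" "e t = u \<oplus>\<^bsub>free_module R I\<^esub> w"
      unfolding PQ[symmetric] set_add_def' by auto
    then show ?thesis by (intro exI[of _ u] exI[of _ w]) (auto simp: free_module_def R_def)
  qed
  then obtain u w where u: "\<And>t. t \<in> I \<Longrightarrow> u t \<in> P" and w: "\<And>t. t \<in> I \<Longrightarrow> w t \<in> Q"
    and uw: "\<And>t t' z. t \<in> I \<Longrightarrow> z \<in> RHP \<Longrightarrow> e t t' z = u t t' z + w t t' z" by metis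
  have "\<exists>c. (\<forall>i<n. c i \<in> X) \<and> (\<forall>t'. \<forall>z\<in>RHP. u t t' z = (\<Sum>i<n. c i z * p i t' z))" if "t \<in> I" for t
    using genP[OF u[OF that]] .
  then obtain c where c: "\<And>t i. t \<in> I \<Longrightarrow> i < n \<Longrightarrow> c t i \<in> X"
    and uc: "\<And>t t' z. t \<in> I \<Longrightarrow> z \<in> RHP \<Longrightarrow> u t t' z = (\<Sum>i<n. c t i z * p i t' z)" by metis
  \<comment> \<open>The free module may have infinite rank, but all of P is supported on the
    finite set F.\<close>
  define F where "F = (\<Union>i<n. {t. p i t \<noteq> (\<lambda>z\<in>RHP. 0)})"
  have F: "finite F" "F \<subseteq> I"
  proof -
    have p_free: "p i \<in> carrier (free_module R I)" if "i < n" for i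
      using pP[OF that] PF by blast
    show "finite F" unfolding F_def using P_free(3)[OF p_free] by (intro finite_UN_I) auto
    show "F \<subseteq> I" unfolding F_def using P_free(2)[OF p_free] by blast
  qed
  have offF: "v t z = 0" if v: "v \<in> P" and t: "t \<notin> F" and z: "z \<in> RHP" for v t z
  proof -
    obtain c where "\<forall>t. \<forall>z\<in>RHP. v t z = (\<Sum>i<n. c i z * p i t z)" using genP[OF v] by blast
    moreover have "p i t z = 0" if "i < n" for i
    proof -
      have "p i t = (\<lambda>z\<in>RHP. 0)" using t that by (auto simp: F_def)
      then show ?thesis using z by simp
    qed
    ultimately show ?thesis using z by simp
  qed
  define \<phi> where "\<phi> v i = (\<lambda>z\<in>RHP. \<Sum>t\<in>F. v t z * c t i z)" for v i
  have \<phi>X: "\<phi> v i \<in> X" if "v \<in> P" "i < n" for v i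
    unfolding \<phi>_def using that P_free PF F c by (intro sum_mem) auto
  have \<phi>p: "v t z = (\<Sum>i<n. \<phi> v i z * p i t z)" if v: "v \<in> P" and z: "z \<in> RHP" for v t z
  proof -
    have vX: "v t \<in> X" for t using v PF P_free by blast
    have P1: "combination F v u \<in> P"
      by (rule combination_mem_submodule[OF P[unfolded R_def]]) (use vX u F in auto)
    have Q1: "combination F v w \<in> Q"
      by (rule combination_mem_submodule[OF Q[unfolded R_def]]) (use vX w F in auto)
    have split: "v t z = combination F v u t z + combination F v w t z" if "z \<in> RHP" for t z
    proof -
      have "combination F v u t z + combination F v w t z = (\<Sum>j\<in>F. v j z * e j t z)"
        using that F by (auto simp: combination_def sum.distrib[symmetric] distrib_left uw subsetD
            intro!: sum.cong)
      also have "\<dots> = (\<Sum>j\<in>F. if j = t then v t z else 0)"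
        using that by (intro sum.cong) (auto simp: e_def)
      also have "\<dots> = v t z" using F offF[OF v _ that] by simp
      finally show ?thesis ..
    qed
    \<comment> \<open>d = v - combination F v u lies in P and equals the component combination
      F v w of v in Q, so it vanishes.\<close>
    define d where "d = combination {True, False} (\<lambda>b. \<lambda>z\<in>RHP. if b then 1 else - 1)
        (\<lambda>b. if b then v else combination F v u)"
    have "d t z = v t z - combination F v u t z" if "z \<in> RHP" for t z
      using that by (simp add: d_def combination_def[of "{True, False}"])
    moreover have "d t z = undefined" "combination F v w t z = undefined" if "z \<notin> RHP" for t z
      using that by (simp_all add: d_def combination_def)
    ultimately have "combination F v w t z = d t z" for t z
      using split[of z t] by (cases "z \<in> RHP") auto
    then have "combination F v w = d" by blast
    moreover have "d \<in> P" unfolding d_def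
      by (rule combination_mem_submodule[OF P[unfolded R_def]]) (use v P1 const_mem in auto)
    ultimately have "combination F v w \<in> P \<inter> Q" using Q1 by simp
    then have "combination F v w = (\<lambda>t. \<lambda>z\<in>RHP. 0)" by (simp add: PQ0) (simp add: free_module_def R_def)
    then have "v t z = combination F v u t z" using split[OF z] z by (auto simp: fun_eq_iff)
    also have "\<dots> = (\<Sum>j\<in>F. \<Sum>i<n. v j z * c j i z * p i t z)"
      using z F by (auto simp: combination_def uc sum_distrib_left mult.assoc subsetD intro!: sum.cong)
    also have "\<dots> = (\<Sum>i<n. \<phi> v i z * p i t z)"
      using z by (subst sum.swap) (simp add: \<phi>_def sum_distrib_right)
    finally show ?thesis .
  qed
  define E where "E i l = \<phi> (p i) l" for i l
  \<comment> \<open>The coordinates of a combination of the generators are the combination of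
    the rows of E, so idempotence of E is the special case of the generators
    themselves.\<close>
  have \<phi>_lin: "\<phi> v m z = (\<Sum>l<n. a l z * E l m z)"
    if "\<And>t. v t z = (\<Sum>l<n. a l z * p l t z)" "z \<in> RHP" for v a m z
  proof -
    have "\<phi> v m z = (\<Sum>t\<in>F. \<Sum>l<n. a l z * p l t z * c t m z)"
      using that by (simp add: \<phi>_def sum_distrib_right)
    also have "\<dots> = (\<Sum>l<n. a l z * E l m z)"
      using that by (subst sum.swap) (simp add: E_def \<phi>_def sum_distrib_left mult.assoc)
    finally show ?thesis .
  qed
  have "\<exists>(k::nat) x y. (\<forall>i<n. \<forall>a<k. x i a \<in> X \<and> y a i \<in> X) \<and>
        (\<forall>z\<in>RHP. \<forall>i<n. \<forall>j<n. (\<Sum>a<k. x i a z * y a j z) = E i j z) \<and>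
        (\<forall>z\<in>RHP. \<forall>a<k. \<forall>b<k. (\<Sum>i<n. y a i z * x i b z) = (if a = b then 1 else 0))"
  proof (rule factor)
    show "E i j \<in> X" if "i < n" "j < n" for i j using \<phi>X pP that by (simp add: E_def)
    show "(\<Sum>l<n. E i l z * E l j z) = E i j z" if "i < n" "j < n" "z \<in> RHP" for i j z
    proof -
      have "p i t z = (\<Sum>l<n. E i l z * p l t z)" for t
        using \<phi>p[OF pP[OF that(1)] that(3)] by (simp add: E_def)
      from \<phi>_lin[of "p i" z "E i" j, OF this that(3)] show ?thesis
        unfolding E_def[of i j] by (rule sym)
    qed
  qed
  then obtain k :: nat and x y where
      XY: "\<forall>i<n. \<forall>a<k. x i a \<in> X \<and> y a i \<in> X"
        "\<forall>z\<in>RHP. \<forall>i<n. \<forall>j<n. (\<Sum>a<k. x i a z * y a j z) = E i j z"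
        "\<forall>z\<in>RHP. \<forall>a<k. \<forall>b<k. (\<Sum>i<n. y a i z * x i b z) = (if a = b then 1 else 0)"
    by (elim exE conjE) (rule that)
  have xX: "x i a \<in> X" and yX: "y a i \<in> X" if "i < n" "a < k" for i a
    using XY(1) that by blast+
  have xy: "(\<Sum>a<k. x i a z * y a j z) = E i j z" if "z \<in> RHP" "i < n" "j < n" for i j z
    using XY(2) that by blast
  have yx: "(\<Sum>i<n. y a i z * x i b z) = (if a = b then 1 else 0)" if "z \<in> RHP" "a < k" "b < k" for a b z
    using XY(3) that by blast
  define g where "g v a = (if a < k then (\<lambda>z\<in>RHP. \<Sum>i<n. \<phi> v i z * x i a z) else (\<lambda>z\<in>RHP. 0))" for v a
  have gX: "g v \<in> carrier (free_module R {..<k})" if "v \<in> P" for v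
  proof -
    have "g v a \<in> X" for a
      using that by (auto simp: g_def const_mem intro!: sum_mem \<phi>X xX)
    moreover have "finite {a. g v a \<noteq> (\<lambda>z\<in>RHP. 0)}"
      by (rule finite_subset[of _ "{..<k}"]) (auto simp: g_def)
    moreover have "g v a = (\<lambda>z\<in>RHP. 0)" if "\<not> a < k" for a using that by (simp add: g_def)
    ultimately show ?thesis by (simp add: free_module_def R_def)
  qed
  have recover: "v t z = (\<Sum>a<k. g v a z * (\<Sum>l<n. y a l z * p l t z))"
    if v: "v \<in> P" and z: "z \<in> RHP" for v t z
  proof -
    have "(\<Sum>a<k. g v a z * (\<Sum>l<n. y a l z * p l t z))
        = (\<Sum>a<k. \<Sum>i<n. \<Sum>l<n. \<phi> v i z * (x i a z * y a l z) * p l t z)"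
      using z by (simp add: g_def sum_product mult_ac)
    also have "\<dots> = (\<Sum>i<n. \<Sum>a<k. \<Sum>l<n. \<phi> v i z * (x i a z * y a l z) * p l t z)"
      by (rule sum.swap)
    also have "\<dots> = (\<Sum>i<n. \<Sum>l<n. \<Sum>a<k. \<phi> v i z * (x i a z * y a l z) * p l t z)"
      by (rule sum.cong[OF refl], rule sum.swap)
    also have "\<dots> = (\<Sum>i<n. \<Sum>l<n. \<phi> v i z * E i l z * p l t z)"
      using xy[OF z] by (simp add: sum_distrib_left[symmetric] sum_distrib_right[symmetric])
    also have "\<dots> = (\<Sum>i<n. \<phi> v i z * p i t z)"
    proof (intro sum.cong refl)
      fix i assume "i \<in> {..<n}"
      then have "p i t z = (\<Sum>l<n. E i l z * p l t z)"
        unfolding E_def by (intro \<phi>p[OF pP z]) simp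
      then show "(\<Sum>l<n. \<phi> v i z * E i l z * p l t z) = \<phi> v i z * p i t z"
        by (simp add: sum_distrib_left mult.assoc)
    qed
    also have "\<dots> = v t z" using \<phi>p[OF v z] by simp
    finally show ?thesis ..
  qed
  have inj: "inj_on g P"
  proof (rule inj_onI, rule ext, rule fun_eqI)
    fix v v' t z assume v: "v \<in> P" "v' \<in> P" "g v = g v'"
    show "v t \<in> X" "v' t \<in> X" using v PF P_free by blast+
    show "z \<in> RHP \<Longrightarrow> v t z = v' t z" using recover[of v z t] recover[of v' z t] v by simp
  qed
  have surj: "\<exists>v\<in>P. g v = f" if f: "f \<in> carrier (free_module R {..<k})" for f
  proof -
    have fX: "f a \<in> X" for a using f by (simp add: free_module_def R_def)
    have f0: "f a = (\<lambda>z\<in>RHP. 0)" if "\<not> a < k" for a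
      using f that by (simp add: free_module_def R_def)
    define v where "v = combination {..<k} f (\<lambda>a. combination {..<n} (y a) p)"
    have vP: "v \<in> P" unfolding v_def
      by (intro combination_mem_submodule[OF P[unfolded R_def]] fX yX pP) auto
    have "g v b z = f b z" if z: "z \<in> RHP" and b: "b < k" for b z
    proof -
      have "v t z = (\<Sum>l<n. (\<Sum>a<k. f a z * y a l z) * p l t z)" for t
      proof -
        have "v t z = (\<Sum>a<k. \<Sum>l<n. f a z * y a l z * p l t z)"
          using z by (simp add: v_def combination_def sum_distrib_left mult.assoc)
        also have "\<dots> = (\<Sum>l<n. (\<Sum>a<k. f a z * y a l z) * p l t z)"
          by (subst sum.swap) (simp add: sum_distrib_right)
        finally show ?thesis .
      qed
      from \<phi>_lin[of v z "\<lambda>l z. \<Sum>a<k. f a z * y a l z", OF this z]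
      have "g v b z = (\<Sum>i<n. (\<Sum>l<n. (\<Sum>a<k. f a z * y a l z) * E l i z) * x i b z)"
        using z b by (simp add: g_def)
      also have "\<dots> = (\<Sum>l<n. (\<Sum>a<k. f a z * y a l z) * (\<Sum>i<n. E l i z * x i b z))"
        unfolding sum_distrib_left sum_distrib_right[of _ _ "x _ b z"]
        by (subst sum.swap) (simp add: mult.assoc)
      also have "\<dots> = (\<Sum>l<n. (\<Sum>a<k. f a z * y a l z) * x l b z)"
      proof (intro sum.cong refl arg_cong2[of _ _ _ _ "(*)"])
        fix l assume "l \<in> {..<n}"
        then have "(\<Sum>i<n. E l i z * x i b z) = (\<Sum>i<n. \<Sum>a<k. x l a z * y a i z * x i b z)"
          using xy[OF z] by (intro sum.cong) (auto simp: sum_distrib_right[symmetric])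
        also have "\<dots> = (\<Sum>a<k. x l a z * (\<Sum>i<n. y a i z * x i b z))"
          by (subst sum.swap) (simp add: sum_distrib_left mult.assoc)
        also have "\<dots> = (\<Sum>a<k. if a = b then x l b z else 0)"
          using yx[OF z _ b] by (intro sum.cong) auto
        also have "\<dots> = x l b z" using b by simp
        finally show "(\<Sum>i<n. E l i z * x i b z) = x l b z" .
      qed
      also have "\<dots> = (\<Sum>a<k. f a z * (\<Sum>l<n. y a l z * x l b z))"
        unfolding sum_distrib_left sum_distrib_right
        by (subst sum.swap) (simp add: mult.assoc)
      also have "\<dots> = (\<Sum>a<k. if a = b then f b z else 0)"
        using yx[OF z _ b] by (intro sum.cong) auto
      finally show ?thesis using b by simp
    qed
    moreover have "g v b \<in> X" for b
      using gX[OF vP] by (simp add: free_module_def R_def)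
    moreover have "g v b = (\<lambda>z\<in>RHP. 0)" if "\<not> b < k" for b using that by (simp add: g_def)
    ultimately have "g v b = f b" for b
      using f0 fX by (cases "b < k") (auto intro!: fun_eqI)
    then show ?thesis using vP by auto
  qed
  have "bij_betw (\<lambda>m. g (h m)) (carrier M) (carrier (free_module R {..<k}))"
    unfolding bij_betw_def
  proof
    show "inj_on (\<lambda>m. g (h m)) (carrier M)"
      using h inj comp_inj_on[of h "carrier M" g] by (simp add: bij_betw_def comp_def)
    have "carrier (free_module R {..<k}) \<subseteq> g ` P" using surj by blast
    then show "(\<lambda>m. g (h m)) ` carrier M = carrier (free_module R {..<k})"
      using h gX by (auto simp: bij_betw_def)
  qed
  moreover have "g (h (m \<oplus>\<^bsub>M\<^esub> m')) = g (h m) \<oplus>\<^bsub>free_module R {..<k}\<^esub> g (h m')"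
    if "m \<in> carrier M" "m' \<in> carrier M" for m m'
    unfolding h_add[OF that]
    by (auto simp: free_module_def R_def g_def \<phi>_def fun_eq_iff algebra_simps sum.distrib)
  moreover have "g (h (a \<odot>\<^bsub>M\<^esub> m)) = a \<odot>\<^bsub>free_module R {..<k}\<^esub> g (h m)"
    if "a \<in> carrier R" "m \<in> carrier M" for a m
    using that by (subst h_smult)
      (auto simp: free_module_def R_def g_def \<phi>_def fun_eq_iff algebra_simps sum_distrib_left)
  ultimately show "\<exists>k::nat. module_isomorphic (function_ring X) M (free_module (function_ring X) {..<k})"
    unfolding module_isomorphic_def R_def[symmetric]
    by (intro exI[of _ k] exI[of _ "\<lambda>m. g (h m)"]) blast
qed

end

section \<open>Partial sums of Dirichlet polynomials\<close>

text \<open>An integrable majorant for the kernels below; the exponent - 1 - \<delta> costs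
  only a factor of order N^\<delta> in the final estimate.\<close>

definition tail_weight :: "real \<Rightarrow> real \<Rightarrow> real" where
  "tail_weight \<delta> u = min 1 (\<bar>u\<bar> powr (- 1 - \<delta>))"

lemma integrable_powr_tail:
  fixes \<delta> :: real
  assumes "\<delta> > 0"
  shows "integrable lborel (\<lambda>u. u powr (- 1 - \<delta>) * indicator {1..} u)"
proof (rule integrableI_nn_integral_finite[where x="1 / \<delta>"])
  have "((\<lambda>x. x powr - \<delta>) \<longlongrightarrow> 0) at_top"
    by (intro tendsto_neg_powr filterlim_ident) (use assms in auto)
  then have lim: "((\<lambda>x. - (x powr (- \<delta>)) / \<delta>) \<longlongrightarrow> 0) at_top"
    using tendsto_divide[OF tendsto_minus tendsto_const, of "\<lambda>x. x powr - \<delta>" 0 at_top \<delta>] assms by simp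
  have "(\<integral>\<^sup>+ u. ennreal (u powr (- 1 - \<delta>)) * indicator {1..} u \<partial>lborel) = ennreal (0 - (- (1 powr (- \<delta>)) / \<delta>))"
  proof (rule nn_integral_FTC_atLeast)
    fix x :: real assume "1 \<le> x"
    then show "((\<lambda>x. - (x powr (- \<delta>)) / \<delta>) has_real_derivative x powr (- 1 - \<delta>)) (at x)"
      using assms by (auto intro!: derivative_eq_intros simp: minus_diff_commute[of \<delta>])
  qed (use lim in auto)
  then show "(\<integral>\<^sup>+ u. ennreal (u powr (- 1 - \<delta>) * indicator {1..} u) \<partial>lborel) = ennreal (1 / \<delta>)"
    by (auto simp: ennreal_mult' indicator_def split: if_splits intro!: nn_integral_cong elim!: trans[rotated])
qed (use assms in auto)

lemma integrable_tail_weight: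
  assumes "\<delta> > 0" shows "integrable lborel (tail_weight \<delta>)"
proof (rule Bochner_Integration.integrable_bound)
  let ?f = "\<lambda>u::real. u powr (- 1 - \<delta>) * indicator {1..} u"
  have "integrable lborel (\<lambda>u. ?f (0 + (-1) * u))"
    by (rule lborel_integrable_real_affine[OF integrable_powr_tail[OF assms]]) simp
  moreover have "integrable lborel (indicator {-1..1} :: real \<Rightarrow> real)" by simp
  ultimately show "integrable lborel (\<lambda>u. indicator {-1..1} u + (?f u + ?f (0 + (-1) * u)))"
    by (intro Bochner_Integration.integrable_add integrable_powr_tail assms)
  show "AE u in lborel. norm (tail_weight \<delta> u) \<le> norm (indicator {-1..1} u + (?f u + ?f (0 + (-1) * u)))"
    by (auto simp: tail_weight_def indicator_def)
  show "tail_weight \<delta> \<in> borel_measurable lborel"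
    unfolding tail_weight_def[abs_def] by measurable
qed

definition cos_integral :: real where
  "cos_integral = (\<integral>u. (1 - cos u) / u\<^sup>2 \<partial>lborel)"

lemma one_minus_cos_le: "1 - cos u \<le> u\<^sup>2 / 2" for u :: real
proof -
  have "1 - cos u = 2 * (sin (u / 2))\<^sup>2"
    using cos_double_sin[of "u / 2"] by simp
  also have "(sin (u / 2))\<^sup>2 \<le> (u / 2)\<^sup>2"
    using abs_sin_x_le_abs_x[of "u / 2"] by (simp only: abs_le_square_iff)
  finally show ?thesis by (simp add: power_divide)
qed

lemma integrable_one_minus_cos: "integrable lborel (\<lambda>u::real. (1 - cos (a * u)) / u\<^sup>2)"
proof (rule Bochner_Integration.integrable_bound)
  show "integrable lborel (\<lambda>u. (a\<^sup>2 / 2 + 2) * tail_weight 1 u)"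
    using integrable_tail_weight[of 1] by simp
  show "AE u in lborel. norm ((1 - cos (a * u)) / u\<^sup>2) \<le> norm ((a\<^sup>2 / 2 + 2) * tail_weight 1 u)"
  proof (intro AE_I2)
    fix u :: real
    show "norm ((1 - cos (a * u)) / u\<^sup>2) \<le> norm ((a\<^sup>2 / 2 + 2) * tail_weight 1 u)"
    proof (cases "u = 0")
      case False
      have 1: "(1 - cos (a * u)) / u\<^sup>2 \<le> a\<^sup>2 / 2"
        using one_minus_cos_le[of "a * u"] False by (simp add: divide_simps power_mult_distrib)
      have 2: "(1 - cos (a * u)) / u\<^sup>2 \<le> 2 / u\<^sup>2"
        using cos_ge_minus_one[of "a * u"] by (intro divide_right_mono) auto
      have 3: "\<bar>u\<bar> powr (- 2) = 1 / u\<^sup>2"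
        using False by (simp add: powr_minus_divide)
      have 4: "0 \<le> (1 - cos (a * u)) / u\<^sup>2" by simp
      have "(1 - cos (a * u)) / u\<^sup>2 \<le> (a\<^sup>2 / 2 + 2) * tail_weight 1 u"
      proof (cases "1 \<le> 1 / u\<^sup>2")
        case True
        then have "(a\<^sup>2 / 2 + 2) * tail_weight 1 u = a\<^sup>2 / 2 + 2" by (simp add: tail_weight_def 3)
        then show ?thesis using 1 by linarith
      next
        case False
        then have "tail_weight 1 u = 1 / u\<^sup>2" by (simp add: tail_weight_def 3)
        moreover have "2 / u\<^sup>2 \<le> (a\<^sup>2 / 2 + 2) * (1 / u\<^sup>2)"
          using divide_right_mono[of 2 "a\<^sup>2 / 2 + 2" "u\<^sup>2"] by simp
        ultimately show ?thesis using 2 by simp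
      qed
      then show ?thesis using 4 by (simp only: real_norm_def)
    qed simp
  qed
qed simp

text \<open>Substitution u \<mapsto> u / a.\<close>

lemma integral_one_minus_cos: "(\<integral>u. (1 - cos (a * u)) / u\<^sup>2 \<partial>lborel) = \<bar>a\<bar> * cos_integral"
proof (cases "a = 0")
  case False
  have "cos_integral = \<bar>a\<bar> * (\<integral>u. (1 - cos (a * u)) / (a * u)\<^sup>2 \<partial>lborel)"
    unfolding cos_integral_def
    using lborel_integral_real_affine[OF False, of "\<lambda>u. (1 - cos u) / u\<^sup>2" 0] by simp
  also have "(\<integral>u. (1 - cos (a * u)) / (a * u)\<^sup>2 \<partial>lborel) = (\<integral>u. (1 / a\<^sup>2) * ((1 - cos (a * u)) / u\<^sup>2) \<partial>lborel)"
    by (simp add: power_mult_distrib)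
  also have "\<dots> = (1 / a\<^sup>2) * (\<integral>u. (1 - cos (a * u)) / u\<^sup>2 \<partial>lborel)"
    by (rule integral_mult_right_zero)
  finally have *: "cos_integral = \<bar>a\<bar> * (1 / a\<^sup>2 * (\<integral>u. (1 - cos (a * u)) / u\<^sup>2 \<partial>lborel))" .
  have "\<bar>a\<bar> * cos_integral = (\<bar>a\<bar> * \<bar>a\<bar> * (1 / a\<^sup>2)) * (\<integral>u. (1 - cos (a * u)) / u\<^sup>2 \<partial>lborel)"
    by (subst *) (simp only: mult.assoc)
  also have "\<bar>a\<bar> * \<bar>a\<bar> * (1 / a\<^sup>2) = 1" using False by (simp add: power2_eq_square)
  finally show ?thesis by simp
qed simp

lemma cos_integral_pos: "cos_integral > 0"
proof -
  have "2 \<le> pi" using pi_ge_two .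
  then have "cos 1 < cos (0::real)" by (intro cos_monotone_0_pi) auto
  then have pos: "(1 - cos 1) / 4 > (0::real)" by simp
  have "(\<integral>u. indicator {1..2::real} u * ((1 - cos 1) / 4) \<partial>lborel) \<le> cos_integral"
    unfolding cos_integral_def
  proof (rule integral_mono)
    show "integrable lborel (\<lambda>u. (1 - cos u) / u\<^sup>2 :: real)"
      using integrable_one_minus_cos[of 1] by simp
    fix u :: real
    show "indicator {1..2} u * ((1 - cos 1) / 4) \<le> (1 - cos u) / u\<^sup>2"
    proof (cases "u \<in> {1..2}")
      case True
      then have "cos u \<le> cos 1" using \<open>2 \<le> pi\<close> by (intro cos_monotone_0_pi_le) auto
      moreover have "u\<^sup>2 \<le> 2\<^sup>2" using True by (intro power_mono) auto
      moreover have "0 < u\<^sup>2" using True by simp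
      ultimately have "(1 - cos 1) / 4 \<le> (1 - cos u) / u\<^sup>2"
        by (intro frac_le) auto
      then show ?thesis using True by simp
    qed simp
  qed simp
  also have "(\<integral>u. indicator {1..2::real} u * ((1 - cos 1) / 4) \<partial>lborel) = (1 - cos 1) / (4::real)"
    by simp
  finally show ?thesis using pos by simp
qed

text \<open>Up to a constant factor the inverse Fourier transform of the trapezoid function
  that is 1 on [- (L - h), L - h], vanishes off [- (L + h), L + h] and is linear in
  between.\<close>

definition trapezoid_kernel :: "real \<Rightarrow> real \<Rightarrow> real \<Rightarrow> real" where
  "trapezoid_kernel L h u = sin (L * u) * sin (h * u) / u\<^sup>2"

text \<open>The product of the two sines and the cosine is a combination of four cosines, each
  of which integrates to an absolute value.\<close>

lemma trapezoid_kernel_cos: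
  "integrable lborel (\<lambda>u. trapezoid_kernel L h u * cos (x * u))" (is ?I)
  "(\<integral>u. trapezoid_kernel L h u * cos (x * u) \<partial>lborel)
     = cos_integral / 4 * (\<bar>L + h + x\<bar> + \<bar>L + h - x\<bar> - \<bar>L - h + x\<bar> - \<bar>L - h - x\<bar>)" (is ?V)
proof -
  let ?g = "\<lambda>a u::real. (1 - cos (a * u)) / u\<^sup>2"
  have eq: "trapezoid_kernel L h u * cos (x * u) =
      1 / 4 * (?g (L + h + x) u + ?g (L + h - x) u - ?g (L - h + x) u - ?g (L - h - x) u)" for u
  proof -
    have "sin (L * u) * sin (h * u) * cos (x * u) =
       1 / 4 * ((1 - cos ((L + h + x) * u)) + (1 - cos ((L + h - x) * u))
             - (1 - cos ((L - h + x) * u)) - (1 - cos ((L - h - x) * u)))"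
      by (simp add: distrib_right left_diff_distrib cos_add cos_diff sin_add sin_diff)
    then have "trapezoid_kernel L h u * cos (x * u) = 
        1 / 4 * ((1 - cos ((L + h + x) * u)) + (1 - cos ((L + h - x) * u))
             - (1 - cos ((L - h + x) * u)) - (1 - cos ((L - h - x) * u))) / u\<^sup>2"
      by (simp only: trapezoid_kernel_def times_divide_eq_left)
    then show ?thesis
      by (simp only: add_divide_distrib diff_divide_distrib times_divide_eq_right[symmetric])
  qed
  have i: "integrable lborel (?g a)" for a by (rule integrable_one_minus_cos)
  show ?I unfolding eq by (intro integrable_mult_right Bochner_Integration.integrable_add Bochner_Integration.integrable_diff i)
  show ?V unfolding eq integral_mult_right_zero
    by (subst Bochner_Integration.integral_diff Bochner_Integration.integral_add,
        (intro Bochner_Integration.integrable_add Bochner_Integration.integrable_diff i)+)+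
       (simp only: integral_one_minus_cos, simp add: algebra_simps)
qed

lemma trapezoid_kernel_transform:
  fixes L h x :: real
  shows "integrable lborel (\<lambda>u. complex_of_real (trapezoid_kernel L h u) * cis (- (x * u)))" (is ?I)
    "(\<integral>u. complex_of_real (trapezoid_kernel L h u) * cis (- (x * u)) \<partial>lborel)
     = of_real (cos_integral / 4 * (\<bar>L + h + x\<bar> + \<bar>L + h - x\<bar> - \<bar>L - h + x\<bar> - \<bar>L - h - x\<bar>))" (is ?V)
proof -
  have k: "integrable lborel (trapezoid_kernel L h)"
    using trapezoid_kernel_cos(1)[of L h 0] by simp
  have s: "integrable lborel (\<lambda>u. trapezoid_kernel L h u * sin (x * u))"
    by (rule Bochner_Integration.integrable_bound[OF k])
       (auto simp: trapezoid_kernel_def abs_mult intro!: mult_left_le divide_right_mono)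
  have "(\<integral>u. trapezoid_kernel L h u * sin (x * u) \<partial>lborel) = (\<integral>u. - (trapezoid_kernel L h u * sin (x * u)) \<partial>lborel)"
    using lborel_integral_real_affine[of "-1" "\<lambda>u. trapezoid_kernel L h u * sin (x * u)" 0]
    by (simp add: trapezoid_kernel_def)
  then have s0: "(\<integral>u. trapezoid_kernel L h u * sin (x * u) \<partial>lborel) = 0"
    by simp
  have eq: "complex_of_real (trapezoid_kernel L h u) * cis (- (x * u)) =
     complex_of_real (trapezoid_kernel L h u * cos (x * u)) - \<i> * complex_of_real (trapezoid_kernel L h u * sin (x * u))" for u
    by (auto simp: complex_eq_iff)
  note c = trapezoid_kernel_cos[of L h x]
  have i1: "integrable lborel (\<lambda>u. complex_of_real (trapezoid_kernel L h u * cos (x * u)))"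
    using c(1) by (rule integrable_of_real)
  have i2: "integrable lborel (\<lambda>u. \<i> * complex_of_real (trapezoid_kernel L h u * sin (x * u)))"
    by (intro integrable_mult_right integrable_of_real s)
  show ?I unfolding eq by (intro Bochner_Integration.integrable_diff i1 i2)
  show ?V unfolding eq
    by (subst Bochner_Integration.integral_diff[OF i1 i2])
       (simp only: integral_mult_right_zero integral_complex_of_real c(2) s0 of_real_0 mult_zero_right diff_zero)
qed

text \<open>For \<bar>u\<bar> \<le> 1 both sines are estimated by their arguments; for
  \<bar>u\<bar> > 1 the bound \<bar>sin (h u)\<bar> \<le> min 1 (h \<bar>u\<bar>) is weakened
  to a power of h \<bar>u\<bar>, which keeps the kernel integrable at infinity.\<close>

lemma abs_trapezoid_kernel_le:
  assumes "0 < \<delta>" "\<delta> < 1" "L \<ge> 0" "h > 0"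
  shows "\<bar>trapezoid_kernel L h u\<bar> \<le> (L * h + h powr (1 - \<delta>)) * tail_weight \<delta> u"
proof (cases "u = 0")
  case False
  have aL: "\<bar>sin (L * u)\<bar> \<le> L * \<bar>u\<bar>" using abs_sin_x_le_abs_x[of "L * u"] assms by (simp add: abs_mult)
  have ah: "\<bar>sin (h * u)\<bar> \<le> h * \<bar>u\<bar>" using abs_sin_x_le_abs_x[of "h * u"] assms by (simp add: abs_mult)
  have k: "\<bar>trapezoid_kernel L h u\<bar> = \<bar>sin (L * u)\<bar> * \<bar>sin (h * u)\<bar> / \<bar>u\<bar>\<^sup>2"
    by (simp add: trapezoid_kernel_def abs_mult)
  show ?thesis
  proof (cases "\<bar>u\<bar> \<le> 1")
    case True
    have "\<bar>u\<bar> powr (-1 - \<delta>) \<ge> \<bar>u\<bar> powr 0"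
      using True False assms by (intro powr_mono') auto
    then have t: "tail_weight \<delta> u = 1" using False by (simp add: tail_weight_def)
    have "\<bar>sin (L * u)\<bar> * \<bar>sin (h * u)\<bar> \<le> (L * \<bar>u\<bar>) * (h * \<bar>u\<bar>)"
      by (intro mult_mono aL ah) (use assms in auto)
    then have "\<bar>trapezoid_kernel L h u\<bar> \<le> (L * \<bar>u\<bar>) * (h * \<bar>u\<bar>) / \<bar>u\<bar>\<^sup>2"
      unfolding k by (intro divide_right_mono) auto
    also have "(L * \<bar>u\<bar>) * (h * \<bar>u\<bar>) = (L * h) * \<bar>u\<bar>\<^sup>2" by (simp only: power2_eq_square mult_ac)
    also have "\<dots> / \<bar>u\<bar>\<^sup>2 = L * h" using False by simp
    finally show ?thesis using t by (simp add: add_increasing2)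
  next
    case u: False
    have "\<bar>u\<bar> powr (-1 - \<delta>) \<le> \<bar>u\<bar> powr 0" using u assms by (intro powr_mono) auto
    then have t: "tail_weight \<delta> u = \<bar>u\<bar> powr (-1 - \<delta>)" using u False by (simp add: tail_weight_def)
    have "\<bar>sin (h * u)\<bar> \<le> (h * \<bar>u\<bar>) powr (1 - \<delta>)"
    proof (cases "h * \<bar>u\<bar> \<le> 1")
      case True
      have "(h * \<bar>u\<bar>) powr 1 \<le> (h * \<bar>u\<bar>) powr (1 - \<delta>)"
        using True assms False by (intro powr_mono') auto
      then show ?thesis using ah assms False by simp
    next
      case False
      then have "1 \<le> (h * \<bar>u\<bar>) powr (1 - \<delta>)" using assms by (intro ge_one_powr_ge_zero) auto
      then show ?thesis using abs_sin_le_one[of "h * u"] by linarith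
    qed
    then have "\<bar>sin (L * u)\<bar> * \<bar>sin (h * u)\<bar> \<le> 1 * (h * \<bar>u\<bar>) powr (1 - \<delta>)"
      by (intro mult_mono) auto
    then have "\<bar>trapezoid_kernel L h u\<bar> \<le> (h * \<bar>u\<bar>) powr (1 - \<delta>) / \<bar>u\<bar>\<^sup>2"
      unfolding k by (intro divide_right_mono) auto
    also have "\<dots> = h powr (1 - \<delta>) * (\<bar>u\<bar> powr (1 - \<delta>) / \<bar>u\<bar> powr 2)"
      using assms False by (simp add: powr_mult)
    also have "\<bar>u\<bar> powr (1 - \<delta>) / \<bar>u\<bar> powr 2 = \<bar>u\<bar> powr (-1 - \<delta>)"
      by (subst powr_diff[symmetric]) simp
    also have "h powr (1 - \<delta>) * \<bar>u\<bar> powr (-1 - \<delta>) \<le> (L * h + h powr (1 - \<delta>)) * \<bar>u\<bar> powr (-1 - \<delta>)"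
      using assms by (intro mult_right_mono) auto
    finally show ?thesis using t by simp
  qed
qed (use assms in \<open>simp add: trapezoid_kernel_def tail_weight_def\<close>)

definition dpoly :: "(nat \<Rightarrow> complex) \<Rightarrow> nat \<Rightarrow> complex \<Rightarrow> complex" where
  "dpoly a N s = (\<Sum>n=1..N. a n * of_nat n powr (- s))"

lemma nat_powr_imaginary:
  assumes "n \<ge> 1"
  shows "of_nat n powr (- (s + \<i> * of_real u)) = of_nat n powr (- s) * cis (- (ln n * u))"
proof -
  have "Ln (of_nat n) = of_real (ln (real n))"
    using assms Ln_of_nat[of n] by simp
  then show ?thesis using assms
    by (simp add: powr_def cis_conv_exp exp_add[symmetric] algebra_simps)
qed

text \<open>The trapezoid is 1 at ln n for n \<le> N and 0 for n > N, because L - h = ln N and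
  L + h = ln (N + 1). Hence averaging the vertical translates of a Dirichlet polynomial
  against its kernel cuts off the polynomial sharply after the N-th term.\<close>

lemma partial_sum_bound_kernel:
  assumes a: "\<And>s. Re s > 0 \<Longrightarrow> norm (dpoly a M s) \<le> C" and N: "N \<ge> 1" and s: "Re s > 0"
    and \<delta>: "0 < \<delta>" "\<delta> < 1"
  defines "h \<equiv> (ln (real N + 1) - ln (real N)) / 2" and "L \<equiv> (ln (real N + 1) + ln (real N)) / 2"
  shows "cos_integral * h * norm (dpoly a (min N M) s)
     \<le> C * (L * h + h powr (1 - \<delta>)) * (\<integral>u. tail_weight \<delta> u \<partial>lborel)"
proof -
  have h: "h > 0" and L: "L \<ge> h" "L \<ge> 0" using N by (auto simp: h_def L_def field_simps)
  have Lh: "L - h = ln (real N)" "L + h = ln (real N + 1)" by (auto simp: h_def L_def field_simps)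
  let ?k = "\<lambda>u. complex_of_real (trapezoid_kernel L h u)"
  have coef: "(\<integral>u. ?k u * cis (- (ln n * u)) \<partial>lborel) = (if n \<le> N then of_real (cos_integral * h) else 0)"
    if n: "n \<ge> 1" for n :: nat
  proof (cases "n \<le> N")
    case True
    then have "0 \<le> ln (real n)" "ln (real n) \<le> L - h" using n N by (auto simp: Lh)
    then show ?thesis using True h L
      unfolding trapezoid_kernel_transform(2) by (simp add: field_simps)
  next
    case False
    then have "ln (real n) \<ge> L + h" using N n by (simp add: Lh)
    then show ?thesis using False h L
      unfolding trapezoid_kernel_transform(2) by simp
  qed
  have int: "integrable lborel (\<lambda>u. a n * of_nat n powr (- s) * (?k u * cis (- (ln n * u))))" for n :: nat
    by (intro integrable_mult_right trapezoid_kernel_transform(1))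
  have expand: "?k u * dpoly a M (s + \<i> * of_real u) =
     (\<Sum>n=1..M. a n * of_nat n powr (- s) * (?k u * cis (- (ln n * u))))" for u
    unfolding dpoly_def sum_distrib_left
    by (intro sum.cong refl) (simp only: nat_powr_imaginary atLeastAtMost_iff mult_ac)
  have "(\<integral>u. ?k u * dpoly a M (s + \<i> * of_real u) \<partial>lborel)
     = (\<Sum>n=1..M. a n * of_nat n powr (- s) * (\<integral>u. ?k u * cis (- (ln n * u)) \<partial>lborel))"
    unfolding expand using int by (simp add: Bochner_Integration.integral_sum)
  also have "\<dots> = (\<Sum>n=1..M. if n \<le> N then of_real (cos_integral * h) * (a n * of_nat n powr (- s)) else 0)"
    by (intro sum.cong refl) (simp add: coef)
  also have "\<dots> = (\<Sum>n=1..min N M. of_real (cos_integral * h) * (a n * of_nat n powr (- s)))"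
    by (intro sum.mono_neutral_cong_right) auto
  also have "\<dots> = of_real (cos_integral * h) * dpoly a (min N M) s"
    by (simp add: dpoly_def sum_distrib_left)
  finally have "cos_integral * h * norm (dpoly a (min N M) s)
      = norm (\<integral>u. ?k u * dpoly a M (s + \<i> * of_real u) \<partial>lborel)"
    using h cos_integral_pos by (simp add: norm_mult)
  also have "\<dots> \<le> (\<integral>u. C * (L * h + h powr (1 - \<delta>)) * tail_weight \<delta> u \<partial>lborel)"
  proof (rule Bochner_Integration.integral_norm_bound_integral)
    show "integrable lborel (\<lambda>u. ?k u * dpoly a M (s + \<i> * of_real u))"
      unfolding expand by (intro Bochner_Integration.integrable_sum int)
    show "integrable lborel (\<lambda>u. C * (L * h + h powr (1 - \<delta>)) * tail_weight \<delta> u)"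
      using integrable_tail_weight[OF \<delta>(1)] by simp
    fix u
    have "norm (?k u * dpoly a M (s + \<i> * of_real u))
        \<le> ((L * h + h powr (1 - \<delta>)) * tail_weight \<delta> u) * C"
      unfolding norm_mult norm_of_real
      using abs_trapezoid_kernel_le[OF \<delta> L(2) h, of u] a[of "s + \<i> * of_real u"] s
      by (intro mult_mono) auto
    then show "norm (?k u * dpoly a M (s + \<i> * of_real u)) \<le> C * (L * h + h powr (1 - \<delta>)) * tail_weight \<delta> u"
      by (simp add: mult_ac)
  qed
  also have "\<dots> = C * (L * h + h powr (1 - \<delta>)) * (\<integral>u. tail_weight \<delta> u \<partial>lborel)"
    by (rule integral_mult_right_zero)
  finally show ?thesis .
qed

text \<open>In the kernel estimate L has order ln N and h has order 1 / N; after division by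
  h, both L and h powr (- \<delta>) are at most of order N^\<delta>.\<close>

lemma partial_sum_bound_powr:
  assumes \<delta>: "0 < \<delta>" "\<delta> < 1"
  shows "\<exists>K\<ge>0. \<forall>a M C. (\<forall>s. Re s > 0 \<longrightarrow> norm (dpoly a M s) \<le> C) \<longrightarrow>
     (\<forall>N\<ge>1. \<forall>s. Re s > 0 \<longrightarrow> norm (dpoly a (min N M) s) \<le> K * real N powr \<delta> * C)"
proof -
  define J where "J = (\<integral>u. tail_weight \<delta> u \<partial>lborel)"
  have J: "J \<ge> 0" unfolding J_def by (intro integral_nonneg_AE) (simp add: tail_weight_def)
  define K where "K = J / cos_integral * (2 / \<delta> + 4)"
  have K: "K \<ge> 0" using J cos_integral_pos \<delta> by (simp add: K_def)
  have "norm (dpoly a (min N M) s) \<le> K * real N powr \<delta> * C"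
    if a: "\<And>s. Re s > 0 \<Longrightarrow> norm (dpoly a M s) \<le> C" and N: "N \<ge> 1" and s: "Re s > 0" for a M C N s
  proof -
    define h where "h = (ln (real N + 1) - ln (real N)) / 2"
    define L where "L = (ln (real N + 1) + ln (real N)) / 2"
    have C: "C \<ge> 0" using a[of 1] norm_ge_zero[of "dpoly a M 1"] by (simp del: norm_ge_zero)
    have Nd: "real N powr \<delta> \<ge> 0" by simp
    have N1: "(real N + 1) powr \<delta> \<le> 2 * real N powr \<delta>"
    proof -
      have "(real N + 1) powr \<delta> \<le> (2 * real N) powr \<delta>" using N \<delta> by (intro powr_mono2) auto
      also have "\<dots> = 2 powr \<delta> * real N powr \<delta>" by (simp add: powr_mult)
      also have "2 powr \<delta> \<le> 2 powr (1::real)" using \<delta> by (intro powr_mono) auto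
      finally show ?thesis using Nd by (simp add: mult_right_mono)
    qed
    have "ln (real N + 1) - ln (real N) = - ln (1 - 1 / (real N + 1))"
    proof -
      have "1 - 1 / (real N + 1) = real N / (real N + 1)" by (simp add: field_simps)
      then show ?thesis using N by (simp add: ln_div)
    qed
    also have "\<dots> \<ge> 1 / (real N + 1)"
      using ln_one_minus_pos_upper_bound[of "1 / (real N + 1)"] N by simp
    finally have h_ge: "h \<ge> 1 / (2 * (real N + 1))" by (simp add: h_def field_simps)
    then have h: "h > 0" by (smt (verit) divide_pos_pos of_nat_0_le_iff)
    have "h powr (- \<delta>) \<le> (1 / (2 * (real N + 1))) powr (- \<delta>)"
      using h_ge \<delta> by (intro powr_mono2') auto
    also have "\<dots> = (2 * (real N + 1)) powr \<delta>"
      by (simp add: powr_minus powr_divide)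
    also have "\<dots> = 2 powr \<delta> * (real N + 1) powr \<delta>" by (rule powr_mult) 
    also have "\<dots> \<le> 2 * (2 * real N powr \<delta>)"
      using powr_mono[of \<delta> 1 2] \<delta> by (intro mult_mono N1) auto
    finally have h_powr: "h powr (- \<delta>) \<le> 4 * real N powr \<delta>" by simp
    have "L \<le> ln (real N + 1)" using N by (simp add: L_def)
    also have "\<dots> \<le> (real N + 1) powr \<delta> / \<delta>"
      using ln_powr_bound[of "real N + 1" \<delta>] \<delta> N by simp
    also have "\<dots> \<le> 2 / \<delta> * real N powr \<delta>" using N1 \<delta> by (simp add: divide_right_mono)
    finally have L: "L \<le> 2 / \<delta> * real N powr \<delta>" .
    have "cos_integral * h * norm (dpoly a (min N M) s) \<le> C * (L * h + h powr (1 - \<delta>)) * J"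
      using partial_sum_bound_kernel[OF a N s \<delta>] unfolding h_def L_def J_def .
    also have "h powr (1 - \<delta>) = h * h powr (- \<delta>)"
      using h by (simp add: powr_diff powr_minus field_simps)
    also have "C * (L * h + h * h powr (- \<delta>)) * J = h * (C * J * (L + h powr (- \<delta>)))"
      by (simp add: algebra_simps)
    also have "\<dots> \<le> h * (C * J * (2 / \<delta> * real N powr \<delta> + 4 * real N powr \<delta>))"
      using h C J by (intro mult_left_mono add_mono L h_powr) auto
    finally have "h * (cos_integral * norm (dpoly a (min N M) s)) \<le> h * (C * J * (2 / \<delta> * real N powr \<delta> + 4 * real N powr \<delta>))"
      by (simp add: mult_ac)
    then have "cos_integral * norm (dpoly a (min N M) s) \<le> C * J * (2 / \<delta> * real N powr \<delta> + 4 * real N powr \<delta>)"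
      using h by simp
    then have "norm (dpoly a (min N M) s) \<le> C * J * (2 / \<delta> * real N powr \<delta> + 4 * real N powr \<delta>) / cos_integral"
      using cos_integral_pos by (simp add: pos_le_divide_eq mult.commute)
    also have "\<dots> = K * real N powr \<delta> * C"
      using cos_integral_pos \<delta> by (simp add: K_def field_simps)
    finally show ?thesis .
  qed
  then show ?thesis using K by blast
qed

text \<open>Summation by parts. With x_n = n powr (- \<epsilon> / 2), the square roots of the
  weights, each term is at most K (x_n^2 - x_(n+1)^2) / x_n \<le> 2 K (x_n - x_(n+1)), and
  these bounds telescope.\<close>

lemma abel_summation_bound:
  fixes b :: "nat \<Rightarrow> complex"
  assumes \<epsilon>: "\<epsilon> > 0" and T: "\<And>n. n \<ge> 1 \<Longrightarrow> norm (\<Sum>j=1..n. b j) \<le> K * real n powr (\<epsilon> / 2)" and K: "K \<ge> 0"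
  shows "norm (\<Sum>n=1..N. b n * of_real (real n powr (- \<epsilon>))) \<le> 3 * K"
proof (cases "N = 0")
  case False
  define T' where "T' n = (\<Sum>j=1..n. b j)" for n
  define f where "f n = real n powr (- \<epsilon>)" for n
  define x where "x n = real n powr (- (\<epsilon> / 2))" for n
  have fx: "f n = x n * x n" for n by (simp add: f_def x_def powr_add[symmetric])
  have abel: "(\<Sum>n=1..Suc m. b n * of_real (f n)) = T' (Suc m) * of_real (f (Suc m)) + (\<Sum>n=1..m. T' n * of_real (f n - f (Suc n)))" for m
    by (induction m) (simp_all add: T'_def algebra_simps)
  have T'n: "norm (T' n) * x n \<le> K" if "n \<ge> 1" for n
  proof -
    have "norm (T' n) * x n \<le> (K * real n powr (\<epsilon> / 2)) * x n"
      unfolding T'_def by (rule mult_right_mono[OF T[OF that]]) (simp add: x_def)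
    also have "\<dots> = K" using that by (simp add: x_def powr_minus)
    finally show ?thesis .
  qed
  have x: "0 < x n" "x (Suc n) \<le> x n" "x n \<le> 1" if "n \<ge> 1" for n
  proof -
    show "0 < x n" using that by (simp add: x_def)
    show "x (Suc n) \<le> x n" using that \<epsilon> by (simp add: x_def powr_mono2')
    show "x n \<le> 1" using that \<epsilon> powr_mono2'[of "- (\<epsilon> / 2)" 1 "real n"] by (simp add: x_def)
  qed
  have summand: "norm (T' n * of_real (f n - f (Suc n))) \<le> 2 * K * (x n - x (Suc n))" if "n \<ge> 1" for n
  proof -
    have "norm (T' n * of_real (f n - f (Suc n))) = norm (T' n) * ((x n - x (Suc n)) * (x n + x (Suc n)))"
      using x[OF that] x(1)[of "Suc n"] unfolding norm_mult norm_of_real fx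
      by (simp add: algebra_simps abs_of_nonneg mult_mono)
    also have "\<dots> \<le> norm (T' n) * ((x n - x (Suc n)) * (2 * x n))"
      using x[OF that] by (intro mult_left_mono) auto
    also have "\<dots> = (norm (T' n) * x n) * (2 * (x n - x (Suc n)))" by simp
    also have "\<dots> \<le> K * (2 * (x n - x (Suc n)))"
      using x[OF that] by (intro mult_right_mono T'n that) auto
    finally show ?thesis by (simp only: mult_ac)
  qed
  obtain m where N: "N = Suc m" using False by (cases N) auto
  have "norm (\<Sum>n=1..N. b n * of_real (f n)) \<le> norm (T' (Suc m) * of_real (f (Suc m))) + norm (\<Sum>n=1..m. T' n * of_real (f n - f (Suc n)))"
    unfolding N abel by (rule norm_triangle_ineq)
  also have "norm (\<Sum>n=1..m. T' n * of_real (f n - f (Suc n))) \<le> (\<Sum>n=1..m. 2 * K * (x n - x (Suc n)))"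
    by (rule sum_norm_le) (use summand in auto)
  also have "\<dots> = 2 * K * (x 1 - x (Suc m))"
  proof -
    have "(\<Sum>n=1..m. x n - x (Suc n)) = x 1 - x (Suc m)" by (induction m) auto
    then show ?thesis by (simp only: sum_distrib_left[symmetric])
  qed
  also have "\<dots> \<le> 2 * K * 1" using K x[of "Suc m"] by (intro mult_left_mono) (auto simp: x_def)
  also have "norm (T' (Suc m) * of_real (f (Suc m))) = (norm (T' (Suc m)) * x (Suc m)) * x (Suc m)"
    by (simp add: norm_mult fx abs_mult x_def)
  also have "\<dots> \<le> K * 1" using x[of "Suc m"] T'n[of "Suc m"] K by (intro mult_mono) auto
  finally show ?thesis by (simp add: f_def)
qed (use K in simp)

text \<open>The inequality behind Bohr's theorem that a bounded Dirichlet series converges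
  uniformly on smaller half-planes: the growth N powr (\<epsilon> / 2) of the partial sums is
  absorbed by moving to the right by \<epsilon>.\<close>

theorem partial_sums_uniformly_bounded:
  assumes "\<epsilon> > 0"
  shows "\<exists>K\<ge>0. \<forall>a M C. (\<forall>s. Re s > 0 \<longrightarrow> norm (dpoly a M s) \<le> C) \<longrightarrow>
     (\<forall>N. \<forall>s. Re s > \<epsilon> \<longrightarrow> norm (dpoly a (min N M) s) \<le> K * C)"
proof -
  define e where "e = min \<epsilon> 1"
  have e: "0 < e" "e \<le> \<epsilon>" "e / 2 < 1" "0 < e / 2" using assms by (auto simp: e_def)
  obtain K where K: "K \<ge> 0" and b: "\<And>a M C N s. (\<And>s. Re s > 0 \<Longrightarrow> norm (dpoly a M s) \<le> C) \<Longrightarrow> N \<ge> 1 \<Longrightarrow> Re s > 0 \<Longrightarrow>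
      norm (dpoly a (min N M) s) \<le> K * real N powr (e / 2) * C"
    using partial_sum_bound_powr[OF e(4,3)] by metis
  have "norm (dpoly a (min N M) s) \<le> 3 * K * C"
    if a: "\<And>s. Re s > 0 \<Longrightarrow> norm (dpoly a M s) \<le> C" and s: "Re s > \<epsilon>" for a M C N s
  proof -
    have C: "C \<ge> 0" using a[of 1] norm_ge_zero[of "dpoly a M 1"] by (simp del: norm_ge_zero)
    define w where "w = s - of_real e"
    have w: "Re w > 0" using s e by (simp add: w_def)
    define c where "c j = (if j \<le> M then a j * of_nat j powr (- w) else 0)" for j
    have c: "(\<Sum>j=1..n. c j) = dpoly a (min n M) w" for n
      unfolding dpoly_def by (intro sum.mono_neutral_cong_right) (auto simp: c_def)
    have "norm (\<Sum>n=1..N. c n * of_real (real n powr (- e))) \<le> 3 * (K * C)"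
    proof (rule abel_summation_bound[OF e(1)])
      fix n :: nat assume "n \<ge> 1"
      from b[OF a this w] show "norm (sum c {1..n}) \<le> K * C * real n powr (e / 2)"
        unfolding c by (simp add: mult_ac)
    qed (use K C in auto)
    also have "(\<Sum>n=1..N. c n * of_real (real n powr (- e))) = dpoly a (min N M) s"
    proof -
      have "of_nat n powr (- w) * of_real (real n powr (- e)) = of_nat n powr (- s)" for n
      proof -
        have "of_real (real n powr (- e)) = (of_nat n powr (- of_real e) :: complex)"
          using powr_of_real[of "real n" "- e"] by simp
        then show ?thesis by (simp add: powr_add[symmetric] w_def)
      qed
      then show ?thesis unfolding dpoly_def
        by (intro sum.mono_neutral_cong_right) (auto simp: c_def mult.assoc)
    qed
    finally show ?thesis by (simp add: mult_ac)
  qed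
  then show ?thesis using K by (intro exI[of _ "3 * K"]) auto
qed

section \<open>Twists of Dirichlet polynomials by multiplicative functions\<close>

text \<open>Unique factorization: an integral relation between the logarithms is an equality
  of two products of powers of primes, taken with the positive and with the negative
  coefficients.\<close>

lemma log_primes_independent:
  assumes "finite S" "\<And>p. p \<in> S \<Longrightarrow> prime (p::nat)"
    and sum: "(\<Sum>p\<in>S. of_int (u p) * ln (real p)) = 0" and "q \<in> S"
  shows "u q = 0"
proof -
  define A where "A = (\<Prod>p\<in>S. p ^ nat (u p))"
  define B where "B = (\<Prod>p\<in>S. p ^ nat (- u p))"
  have pos: "p > 0" if "p \<in> S" for p using assms(2)[OF that] prime_gt_0_nat by blast
  have lnprod: "ln (real (\<Prod>p\<in>S. p ^ e p)) = (\<Sum>p\<in>S. real (e p) * ln (real p))" for e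
    using assms(1) pos by (simp add: ln_prod ln_realpow)
  have "ln (real A) - ln (real B) = (\<Sum>p\<in>S. of_int (u p) * ln (real p))"
    unfolding A_def B_def lnprod sum_subtractf[symmetric]
    by (intro sum.cong refl) (auto simp: left_diff_distrib[symmetric])
  then have "ln (real A) = ln (real B)" using sum by simp
  moreover have "A > 0" "B > 0" unfolding A_def B_def using pos by (auto intro!: prod_pos)
  ultimately have "A = B" by simp
  then have "multiplicity q A = multiplicity q B" by simp
  then have "nat (u q) = nat (- u q)"
    unfolding A_def B_def using assms by (simp add: multiplicity_prod_prime_powers)
  then show ?thesis by simp
qed

text \<open>Kronecker's theorem for the frequencies ln p / (2 \<pi>), so that p powr (- \<i>
  t) approximates prescribed unimodular numbers.\<close>

lemma Kronecker_primes:
  fixes \<alpha> :: "nat \<Rightarrow> real"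
  assumes S: "finite S" "\<And>p. p \<in> S \<Longrightarrow> prime (p::nat)" and "\<epsilon> > 0"
  obtains t h where "\<And>p. p \<in> S \<Longrightarrow> \<bar>t * (ln (real p) / (2 * pi)) - of_int (h p) - \<alpha> p\<bar> < \<epsilon>"
proof -
  obtain e where e: "bij_betw e {..<card S} S"
    using ex_bij_betw_nat_finite[OF S(1)] by (auto simp: atLeast0LessThan)
  define l where "l p = ln (real p) / (2 * pi)" for p :: nat
  have inj: "inj_on l S"
  proof (rule inj_onI)
    fix p q assume pq: "p \<in> S" "q \<in> S" "l p = l q"
    then have "ln (real p) = ln (real q)" by (simp add: l_def)
    then show "p = q" using pq S(2) prime_gt_0_nat[of p] prime_gt_0_nat[of q] by simp
  qed
  interpret Modules.module "\<lambda>r. (*) (real_of_int r)"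
    by (simp add: Modules.module.intro distrib_left mult.commute)
  have img: "(\<lambda>i. l (e i)) ` {..<card S} = l ` S"
    using e by (auto simp: bij_betw_def image_image[symmetric])
  have "independent (l ` S)"
  proof (rule ccontr)
    assume "\<not> independent (l ` S)"
    then obtain T u where T: "finite T" "T \<subseteq> l ` S" "(\<Sum>v\<in>T. of_int (u v) * v) = 0" "\<exists>v\<in>T. u v \<noteq> 0"
      unfolding dependent_explicit by auto
    obtain U where U: "U \<subseteq> S" "T = l ` U" using T(2) by (auto simp: subset_image_iff)
    have "(\<Sum>p\<in>U. of_int (u (l p)) * l p) = 0"
      using T(3) sum.reindex[OF inj_on_subset[OF inj U(1)], of "\<lambda>v. of_int (u v) * v"] U(2) by simp
    then have "(\<Sum>p\<in>U. of_int (u (l p)) * ln (real p)) / (2 * pi) = 0"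
      unfolding l_def sum_divide_distrib by simp
    then have *: "(\<Sum>p\<in>U. of_int (u (l p)) * ln (real p)) = 0" by simp
    have "u (l p) = 0" if "p \<in> U" for p
      by (rule log_primes_independent[OF _ _ * that])
         (use U S finite_subset in auto)
    then show False using T(4) U(2) by auto
  qed
  then have ind: "independent ((\<lambda>i. l (e i)) ` {..<card S})" by (simp add: img)
  have "inj_on (\<lambda>i. l (e i)) {..<card S}"
    using e inj comp_inj_on[of e _ l] by (simp add: bij_betw_def comp_def)
  then obtain t h where th: "\<And>i. i < card S \<Longrightarrow> \<bar>t * l (e i) - of_int (h i) - \<alpha> (e i)\<bar> < \<epsilon>"
    using Kronecker_thm_1[OF ind _ \<open>\<epsilon> > 0\<close>, of "\<lambda>i. \<alpha> (e i)"] by metis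
  show thesis
  proof (rule that[of t "\<lambda>p. h (inv_into {..<card S} e p)"])
    fix p assume "p \<in> S"
    then have "inv_into {..<card S} e p < card S" "e (inv_into {..<card S} e p) = p"
      using e inv_into_into[of p e "{..<card S}"] f_inv_into_f[of p e "{..<card S}"]
      by (auto simp: bij_betw_def)
    then show "\<bar>t * (ln (real p) / (2 * pi)) - of_int (h (inv_into {..<card S} e p)) - \<alpha> p\<bar> < \<epsilon>"
      using th[of "inv_into {..<card S} e p"] by (simp add: l_def)
  qed
qed

text \<open>The completely multiplicative function with value x p at the prime p.\<close>

definition cmult :: "(nat \<Rightarrow> complex) \<Rightarrow> nat \<Rightarrow> complex" where
  "cmult x n = (\<Prod>p\<in>prime_factors n. x p ^ multiplicity p n)"

lemma nat_powr_eq_cmult: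
  assumes "n \<ge> 1"
  shows "of_nat n powr s = cmult (\<lambda>p. of_nat p powr s) n"
proof -
  have pos: "p > 0" if "p \<in> prime_factors n" for p using that by (auto intro: prime_gt_0_nat)
  have "ln (real n) = ln (real (\<Prod>p\<in>prime_factors n. p ^ multiplicity p n))"
    using prime_factorization_nat[of n] assms by simp
  also have "\<dots> = (\<Sum>p\<in>prime_factors n. real (multiplicity p n) * ln (real p))"
    using pos by (simp add: ln_prod ln_realpow)
  finally have ln: "ln (real n) = (\<Sum>p\<in>prime_factors n. real (multiplicity p n) * ln (real p))" .
  have powr: "of_nat m powr s = exp (s * of_real (ln (real m)))" if "m > 0" for m
    using that by (simp add: powr_def Ln_of_nat)
  have "of_nat n powr s = exp (\<Sum>p\<in>prime_factors n. of_nat (multiplicity p n) * (s * of_real (ln (real p))))"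
    using assms by (simp add: powr ln sum_distrib_left mult_ac)
  also have "\<dots> = cmult (\<lambda>p. of_nat p powr s) n"
    unfolding cmult_def
    by (simp add: exp_sum exp_of_nat_mult powr pos cong: prod.cong_simp)
  finally show ?thesis .
qed

lemma cmult_const: "cmult (\<lambda>_. z) n = z ^ big_omega n"
proof -
  have "big_omega n = (\<Sum>p\<in>prime_factors n. multiplicity p n)"
    unfolding big_omega_def size_multiset_overloaded_eq
    by (intro sum.cong refl) (auto intro!: count_prime_factorization_prime)
  then show ?thesis by (simp add: cmult_def power_sum)
qed

definition contractive :: "(nat \<Rightarrow> complex) \<Rightarrow> bool" where
  "contractive w \<longleftrightarrow> (\<forall>a N C. (\<forall>s. Re s > 0 \<longrightarrow> norm (dpoly a N s) \<le> C) \<longrightarrow>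
      (\<forall>s. Re s > 0 \<longrightarrow> norm (dpoly (\<lambda>n. w n * a n) N s) \<le> C))"

lemma contractiveD:
  "contractive w \<Longrightarrow> (\<And>s. Re s > 0 \<Longrightarrow> norm (dpoly a N s) \<le> C) \<Longrightarrow> Re s > 0 \<Longrightarrow>
     norm (dpoly (\<lambda>n. w n * a n) N s) \<le> C"
  by (auto simp: contractive_def)

text \<open>By Kronecker's theorem the twisted polynomial is a limit of vertical translates of
  the given one, and these have the same supremum.\<close>

lemma cmult_unimodular:
  assumes a: "\<And>s. Re s > 0 \<Longrightarrow> norm (dpoly a N s) \<le> C" and s: "Re s > 0"
    and x: "\<And>p. prime p \<Longrightarrow> p \<le> N \<Longrightarrow> norm (x p) = 1"
  shows "norm (dpoly (\<lambda>n. cmult x n * a n) N s) \<le> C"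
proof -
  define S where "S = {p. prime p \<and> p \<le> N}"
  have S: "finite S" "\<And>p. p \<in> S \<Longrightarrow> prime p" by (auto simp: S_def)
  \<comment> \<open>If t ln p / (2 \<pi>) is close to \<alpha> p modulo 1, then p powr (- \<i>
    t) is close to x p.\<close>
  define \<alpha> where "\<alpha> p = - Arg (x p) / (2 * pi)" for p
  have "\<exists>t h. \<forall>p\<in>S. \<bar>t * (ln (real p) / (2 * pi)) - of_int (h p) - \<alpha> p\<bar> < 1 / real (Suc k)" for k
  proof -
    have "1 / real (Suc k) > 0" by simp
    from Kronecker_primes[OF S this, of \<alpha>] show ?thesis by metis
  qed
  then obtain t h where th: "\<And>k p. p \<in> S \<Longrightarrow>
      \<bar>t k * (ln (real p) / (2 * pi)) - of_int (h k p) - \<alpha> p\<bar> < 1 / real (Suc k)" by metis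
  have lim: "(\<lambda>k. of_nat p powr (- (\<i> * of_real (t k)))) \<longlonglongrightarrow> x p" if p: "p \<in> S" for p
  proof -
    define d where "d k = t k * (ln (real p) / (2 * pi)) - of_int (h k p) - \<alpha> p" for k
    have "d \<longlonglongrightarrow> 0"
    proof (rule Lim_null_comparison)
      show "\<forall>\<^sub>F k in sequentially. norm (d k) \<le> 1 / real (Suc k)"
        using th[OF p] by (auto simp: d_def intro!: always_eventually less_imp_le)
    qed (rule LIMSEQ_inverse_real_of_nat[unfolded inverse_eq_divide])
    then have "(\<lambda>k. cis (- (2 * pi * d k)) * x p) \<longlonglongrightarrow> cis (- (2 * pi * 0)) * x p"
      by (intro tendsto_intros)
    moreover have "of_nat p powr (- (\<i> * of_real (t k))) = cis (- (2 * pi * d k)) * x p" for k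
    proof -
      have "x p = cis (Arg (x p))"
        using x[of p] p rcis_cmod_Arg[of "x p"] by (simp add: S_def rcis_def)
      then have "cis (- (2 * pi * d k)) * x p = cis (- (2 * pi * d k) + Arg (x p))"
        by (metis cis_mult)
      also have "- (2 * pi * d k) + Arg (x p) = - (ln (real p) * t k) + 2 * pi * of_int (h k p)"
        by (simp add: d_def \<alpha>_def field_simps)
      also have "cis \<dots> = cis (- (ln (real p) * t k))"
        by (simp only: cis_mult[symmetric] cis_multiple_2pi[OF Ints_of_int] mult_1_right)
      also have "\<dots> = of_nat p powr (- (\<i> * of_real (t k)))"
        using nat_powr_imaginary[of p 0 "t k"] S(2)[OF p] prime_gt_0_nat[of p] by (simp add: Suc_le_eq)
      finally show ?thesis ..
    qed
    ultimately show ?thesis by simp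
  qed
  have pS: "p \<in> S" if "n \<in> {1..N}" "p \<in> prime_factors n" for p n
    using that dvd_imp_le[of p n] by (auto simp: S_def in_prime_factors_iff)
  have "(\<lambda>k. dpoly a N (s + \<i> * of_real (t k))) \<longlonglongrightarrow> dpoly (\<lambda>n. cmult x n * a n) N s"
  proof -
    have "(\<lambda>k. \<Sum>n=1..N. a n * (of_nat n powr (- s) * cmult (\<lambda>p. of_nat p powr (- (\<i> * of_real (t k)))) n))
        \<longlonglongrightarrow> (\<Sum>n=1..N. a n * (of_nat n powr (- s) * cmult x n))"
      unfolding cmult_def
      by (intro tendsto_intros lim pS)
    moreover have "of_nat n powr (- s) * cmult (\<lambda>p. of_nat p powr (- (\<i> * of_real (t k)))) n
        = of_nat n powr (- (s + \<i> * of_real (t k)))" if "n \<ge> 1" for n k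
      by (simp only: nat_powr_eq_cmult[OF that, of "- (\<i> * of_real (t k))", symmetric]
          powr_add[symmetric] minus_add_distrib)
    ultimately show ?thesis by (simp add: dpoly_def mult_ac cong: sum.cong_simp)
  qed
  then show ?thesis
    by (rule Lim_norm_ubound[OF trivial_limit_sequentially]) (use a s in auto)
qed

text \<open>As a function of the value at one prime q, the twisted polynomial at a fixed point
  is a polynomial, so by the maximum modulus principle that value may be assumed to be
  unimodular. Induction over the primes reduces to the unimodular case.\<close>

theorem contractive_cmult:
  assumes "\<And>p. prime p \<Longrightarrow> norm (x p) \<le> 1"
  shows "contractive (cmult x)"
  unfolding contractive_def
proof (intro allI impI)
  fix a N C s
  assume a: "\<forall>s. Re s > 0 \<longrightarrow> norm (dpoly a N s) \<le> C" and s: "Re s > 0"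
  have "norm (dpoly (\<lambda>n. cmult x n * a n) N s) \<le> C"
    if "finite Q" "\<And>p. prime p \<Longrightarrow> norm (x p) \<le> 1" "\<And>p. prime p \<Longrightarrow> p \<le> N \<Longrightarrow> p \<notin> Q \<Longrightarrow> norm (x p) = 1" for Q x
    using that
  proof (induction Q arbitrary: x rule: finite_induct)
    case empty
    then show ?case using a s by (intro cmult_unimodular) auto
  next
    case (insert q Q)
    define f where "f z = dpoly (\<lambda>n. cmult (x(q := z)) n * a n) N s" for z
    have hol: "f holomorphic_on A" for A
    proof -
      have "(\<lambda>z. (x(q := z)) p) holomorphic_on A" for p
        by (cases "p = q") (auto intro!: holomorphic_intros)
      then show ?thesis unfolding f_def dpoly_def cmult_def
        by (intro holomorphic_intros)
    qed
    show ?case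
    proof (cases "prime q")
      case True
      have "norm (f (x q)) \<le> C"
      proof (rule maximum_modulus_frontier[where f = f and S = "cball 0 1" and \<xi> = "x q" and B = C])
        fix z :: complex assume "z \<in> frontier (cball 0 1)"
        then have "norm z = 1" by (simp add: frontier_cball)
        then show "norm (f z) \<le> C" unfolding f_def
          using insert.prems by (intro insert.IH) auto
      qed (use hol holomorphic_on_imp_continuous_on insert.prems True in auto)
      then show ?thesis by (simp add: f_def)
    next
      case False
      then show ?thesis using insert.prems by (intro insert.IH) auto
    qed
  qed
  from this[of "{p. p \<le> N}" x] show "norm (dpoly (\<lambda>n. cmult x n * a n) N s) \<le> C"
    using assms by auto
qed

lemma roots_of_unity_orthogonal:
  fixes j m M :: nat
  assumes "j < M" "m < M"
  shows "(\<Sum>k<M. cis (2 * pi * real k / real M) ^ j * cnj (cis (2 * pi * real k / real M) ^ m))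
      = (if j = m then of_nat M else 0)"
proof -
  define w where "w = cis (2 * pi * (real j - real m) / real M)"
  have eq: "cis (2 * pi * real k / real M) ^ j * cnj (cis (2 * pi * real k / real M) ^ m) = w ^ k" for k
    unfolding w_def cis_cnj complex_cnj_power Complex.DeMoivre cis_mult
    by (rule arg_cong[of _ _ cis]) (simp add: algebra_simps diff_divide_distrib)
  show ?thesis
  proof (cases "j = m")
    case True
    then show ?thesis unfolding eq by (simp add: w_def)
  next
    case False
    have "w \<noteq> 1"
    proof
      assume "w = 1"
      then have "cos (2 * pi * (real j - real m) / real M) = 1" by (simp add: w_def complex_eq_iff)
      then obtain i :: int where "2 * pi * (real j - real m) / real M = of_int i * 2 * pi"
        using cos_one_2pi_int by blast
      then have "(2 * pi) * (real j - real m) = (2 * pi) * (of_int i * real M)"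
        using assms by (simp add: field_simps)
      then have "real j - real m = of_int i * real M"
        by (simp only: mult_cancel_left) simp
      then have i: "int j - int m = i * int M" by (metis of_int_eq_iff of_int_diff of_int_mult of_int_of_nat_eq)
      then have "i \<noteq> 0" using False by auto
      then have "int M \<le> \<bar>i * int M\<bar>" using assms by (simp add: abs_mult)
      then show False using assms i by linarith
    qed
    moreover have "w ^ M = 1"
    proof -
      have "real M * (2 * pi * (real j - real m) / real M) = 2 * pi * of_int (int j - int m)"
        using assms by simp
      then have "w ^ M = cis (2 * pi * of_int (int j - int m))"
        by (simp only: w_def Complex.DeMoivre)
      then show ?thesis using cis_multiple_2pi[of "of_int (int j - int m)"] by simp
    qed
    ultimately show ?thesis unfolding eq using False geometric_sum[of w M] by simp
  qed
qed

text \<open>The homogeneous part of degree m is the m-th coefficient in z of the twist by the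
  constant z. It is computed as an average over roots of unity of an order that exceeds all
  degrees involved.\<close>

theorem contractive_hom_part: "contractive (\<lambda>n. if big_omega n = m then 1 else 0)"
  unfolding contractive_def
proof (intro allI impI)
  fix a N C s
  assume a: "\<forall>s. Re s > 0 \<longrightarrow> norm (dpoly a N s) \<le> C" and s: "Re s > 0"
  \<comment> \<open>Larger than m and than all degrees \<Omega>(n) with n \<le> N.\<close>
  define M where "M = Suc (m + (\<Sum>n=1..N. big_omega n))"
  have M: "m < M" "\<And>n. n \<in> {1..N} \<Longrightarrow> big_omega n < M"
  proof -
    fix n assume "n \<in> {1..N}"
    then have "big_omega n \<le> (\<Sum>n=1..N. big_omega n)" by (intro member_le_sum) auto
    then show "big_omega n < M" by (simp add: M_def)
  qed (simp add: M_def)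
  define z where "z k = cis (2 * pi * real k / real M)" for k
  have "of_nat M * dpoly (\<lambda>n. (if big_omega n = m then 1 else 0) * a n) N s
     = (\<Sum>n=1..N. (\<Sum>k<M. z k ^ big_omega n * cnj (z k ^ m)) * (a n * of_nat n powr (- s)))"
    unfolding dpoly_def sum_distrib_left z_def
    using M by (intro sum.cong refl) (subst roots_of_unity_orthogonal, auto)
  also have "\<dots> = (\<Sum>k<M. cnj (z k ^ m) * dpoly (\<lambda>n. cmult (\<lambda>_. z k) n * a n) N s)"
    unfolding dpoly_def sum_distrib_left sum_distrib_right
    by (subst sum.swap) (simp add: cmult_const mult_ac)
  finally have "norm (of_nat M * dpoly (\<lambda>n. (if big_omega n = m then 1 else 0) * a n) N s)
      \<le> (\<Sum>k<M. C)"
  proof (simp only:, intro sum_norm_le)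
    fix k
    have "norm (dpoly (\<lambda>n. cmult (\<lambda>_. z k) n * a n) N s) \<le> C"
      using a s by (intro cmult_unimodular) (auto simp: z_def)
    then show "norm (cnj (z k ^ m) * dpoly (\<lambda>n. cmult (\<lambda>_. z k) n * a n) N s) \<le> C"
      by (simp add: norm_mult norm_power z_def)
  qed
  then have "real M * norm (dpoly (\<lambda>n. (if big_omega n = m then 1 else 0) * a n) N s) \<le> real M * C"
    by (simp add: norm_mult)
  then show "norm (dpoly (\<lambda>n. (if big_omega n = m then 1 else 0) * a n) N s) \<le> C"
    using M(1) by simp
qed

section \<open>Uniform limits of Dirichlet series\<close>

lemma dirichlet_limit_iff:
  "dirichlet_limit a f \<longleftrightarrow> f \<in> extensional RHP \<and>
     (\<forall>\<epsilon>>0. uniform_limit {s. Re s > \<epsilon>} (dpoly a) f sequentially)"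
  unfolding dirichlet_limit_def dpoly_def[abs_def] ..

lemma dpoly_cong: "(\<And>n. n \<ge> 1 \<Longrightarrow> n \<le> N \<Longrightarrow> a n = b n) \<Longrightarrow> dpoly a N s = dpoly b N s"
  unfolding dpoly_def by (intro sum.cong) auto

lemma dpoly_add: "dpoly (\<lambda>n. a n + b n) N s = dpoly a N s + dpoly b N s"
  and dpoly_diff: "dpoly (\<lambda>n. a n - b n) N s = dpoly a N s - dpoly b N s"
  and dpoly_scale: "dpoly (\<lambda>n. c * a n) N s = c * dpoly a N s"
  by (simp_all add: dpoly_def algebra_simps sum.distrib sum_subtractf sum_distrib_left)

lemma norm_nat_powr_le_1:
  assumes "Re s \<ge> 0" "n \<ge> 1" shows "norm (of_nat n powr (- s)) \<le> 1"
proof -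
  have "norm (of_nat n powr (- s)) = real n powr (- Re s)"
    using norm_powr_real_powr[of "of_nat n" "- s"] by simp
  also have "\<dots> \<le> real n powr 0" using assms by (intro powr_mono) auto
  finally show ?thesis using assms by simp
qed

lemma norm_dpoly_le: "Re s \<ge> 0 \<Longrightarrow> norm (dpoly a N s) \<le> (\<Sum>n=1..N. norm (a n))"
  unfolding dpoly_def
  by (intro sum_norm_le) (auto simp: norm_mult intro!: mult_left_le norm_nat_powr_le_1)

text \<open>The coefficients of the function translated by \<epsilon>, which turns estimates
  on Re s > 0 into estimates on Re s > \<epsilon>.\<close>

definition shift :: "real \<Rightarrow> (nat \<Rightarrow> complex) \<Rightarrow> nat \<Rightarrow> complex" where
  "shift \<epsilon> a n = a n * of_nat n powr (- of_real \<epsilon>)"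

lemma dpoly_shift: "dpoly (shift \<epsilon> a) N s = dpoly a N (s + of_real \<epsilon>)"
  unfolding dpoly_def shift_def
  by (simp add: powr_add[symmetric] mult.assoc minus_diff_commute[of "of_real \<epsilon>" s])

lemma dirichlet_limit_tendsto:
  assumes "dirichlet_limit a f" "Re s > 0" shows "(\<lambda>N. dpoly a N s) \<longlonglongrightarrow> f s"
proof -
  have "uniform_limit {z. Re z > Re s / 2} (dpoly a) f sequentially"
    using assms unfolding dirichlet_limit_iff by (meson half_gt_zero)
  then show ?thesis by (rule tendsto_uniform_limitI) (use assms in simp)
qed

lemma dirichlet_limit_unique_fun:
  assumes "dirichlet_limit a f" "dirichlet_limit a g" shows "f = g"
proof (rule extensionalityI)
  show "f \<in> extensional RHP" "g \<in> extensional RHP"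
    using assms by (auto simp: dirichlet_limit_iff)
  show "f s = g s" if "s \<in> RHP" for s
    using that assms dirichlet_limit_tendsto LIMSEQ_unique unfolding right_half_plane_def by blast
qed

lemma dirichlet_limit_cong:
  assumes "\<And>n. n \<ge> 1 \<Longrightarrow> a n = b n" shows "dirichlet_limit a f = dirichlet_limit b f"
proof -
  have "dpoly a = dpoly b" using assms by (intro ext dpoly_cong) auto
  then show ?thesis by (simp add: dirichlet_limit_iff)
qed

lemma dirichlet_limit_add:
  assumes "dirichlet_limit a f" "dirichlet_limit b g"
  shows "dirichlet_limit (\<lambda>n. a n + b n) (\<lambda>s\<in>RHP. f s + g s)"
  unfolding dirichlet_limit_iff
proof (intro conjI allI impI)
  fix \<epsilon> :: real assume \<epsilon>: "\<epsilon> > 0"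
  have "uniform_limit {s. Re s > \<epsilon>} (\<lambda>N s. dpoly a N s + dpoly b N s) (\<lambda>s. f s + g s) sequentially"
    using assms \<epsilon> by (intro uniform_limit_intros) (auto simp: dirichlet_limit_iff)
  then show "uniform_limit {s. Re s > \<epsilon>} (dpoly (\<lambda>n. a n + b n)) (\<lambda>s\<in>RHP. f s + g s) sequentially"
    by (rule uniform_limit_cong'[THEN iffD1, rotated -1]) (use \<epsilon> in \<open>auto simp: dpoly_add right_half_plane_def\<close>)
qed simp

lemma dirichlet_limit_scale:
  assumes "dirichlet_limit a f"
  shows "dirichlet_limit (\<lambda>n. c * a n) (\<lambda>s\<in>RHP. c * f s)"
  unfolding dirichlet_limit_iff
proof (intro conjI allI impI)
  fix \<epsilon> :: real assume \<epsilon>: "\<epsilon> > 0"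
  have "uniform_limit {s. Re s > \<epsilon>} (\<lambda>N s. c * dpoly a N s) (\<lambda>s. c * f s) sequentially"
    using assms \<epsilon> by (intro bounded_linear.uniform_limit[OF bounded_linear_mult_right]) (auto simp: dirichlet_limit_iff)
  then show "uniform_limit {s. Re s > \<epsilon>} (dpoly (\<lambda>n. c * a n)) (\<lambda>s\<in>RHP. c * f s) sequentially"
    by (rule uniform_limit_cong'[THEN iffD1, rotated -1]) (use \<epsilon> in \<open>auto simp: dpoly_scale right_half_plane_def\<close>)
qed simp

lemma dirichlet_limit_diff:
  assumes "dirichlet_limit a f" "dirichlet_limit b g"
  shows "dirichlet_limit (\<lambda>n. a n - b n) (\<lambda>s\<in>RHP. f s - g s)"
proof -
  have "dirichlet_limit (\<lambda>n. a n + (- 1) * b n)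
      (\<lambda>s\<in>RHP. f s + (\<lambda>s\<in>RHP. (- 1) * g s) s)"
    by (intro dirichlet_limit_add dirichlet_limit_scale assms)
  also have "(\<lambda>s\<in>RHP. f s + (\<lambda>s\<in>RHP. (- 1) * g s) s) = (\<lambda>s\<in>RHP. f s - g s)"
    by (intro restrict_ext) simp
  finally show ?thesis by (simp only: mult_minus1 add_uminus_conv_diff)
qed

lemma dirichlet_limit_finite:
  assumes "\<And>n. n > M \<Longrightarrow> a n = 0"
  shows "dirichlet_limit a (\<lambda>s\<in>RHP. dpoly a M s)"
proof -
  have *: "dpoly a N s = dpoly a M s" if "N \<ge> M" for N s
    unfolding dpoly_def using that assms by (intro sum.mono_neutral_right) auto
  show ?thesis
    unfolding dirichlet_limit_iff uniform_limit_sequentially_iff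
  proof (intro conjI allI impI exI ballI)
    fix \<epsilon> e :: real and N s assume "\<epsilon> > 0" "e > 0" and N: "N \<ge> M" and "s \<in> {s. Re s > \<epsilon>}"
    then show "dist (dpoly a N s) ((\<lambda>s\<in>RHP. dpoly a M s) s) < e"
      unfolding *[OF N] by (simp add: right_half_plane_def)
  qed simp
qed

lemma dirichlet_limit_bounded:
  assumes "dirichlet_limit a f" "\<epsilon> > 0" shows "bounded (f ` {s. Re s > \<epsilon>})"
proof -
  obtain N where N: "\<And>s. Re s > \<epsilon> \<Longrightarrow> dist (dpoly a N s) (f s) < 1"
    using assms unfolding dirichlet_limit_iff uniform_limit_sequentially_iff
    by (metis mem_Collect_eq order_refl zero_less_one)
  have "norm (f s) \<le> 1 + (\<Sum>n=1..N. norm (a n))" if "Re s > \<epsilon>" for s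
    using N[OF that] norm_dpoly_le[of s a N] that assms(2) norm_triangle_sub[of "f s" "dpoly a N s"]
    by (simp add: dist_norm norm_minus_commute)
  then show ?thesis by (auto simp: bounded_iff)
qed

lemma dpoly_eventually_bounded:
  assumes "dirichlet_limit a f" "\<epsilon> > 0" "\<eta> > 0" "\<And>s. Re s > \<epsilon> \<Longrightarrow> norm (f s) \<le> C"
  shows "\<exists>N0. \<forall>N\<ge>N0. \<forall>s. Re s > 0 \<longrightarrow> norm (dpoly (shift \<epsilon> a) N s) \<le> C + \<eta>"
proof -
  obtain N0 where N0: "\<And>N s. N \<ge> N0 \<Longrightarrow> Re s > \<epsilon> \<Longrightarrow> dist (dpoly a N s) (f s) < \<eta>"
    using assms unfolding dirichlet_limit_iff uniform_limit_sequentially_iff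
    by (metis mem_Collect_eq)
  have "norm (dpoly (shift \<epsilon> a) N s) \<le> C + \<eta>" if "N \<ge> N0" "Re s > 0" for N s
    using N0[OF that(1), of "s + of_real \<epsilon>"] assms(4)[of "s + of_real \<epsilon>"] that
      norm_triangle_sub[of "dpoly a N (s + of_real \<epsilon>)" "f (s + of_real \<epsilon>)"]
    by (simp add: dist_norm dpoly_shift)
  then show ?thesis by blast
qed

text \<open>Bohr's inequality passes from Dirichlet polynomials to their uniform limits, since
  a partial sum of order N is also a partial sum of every longer one.\<close>

theorem partial_sums_bounded:
  assumes "\<epsilon> > 0"
  shows "\<exists>K\<ge>0. \<forall>a f C. dirichlet_limit a f \<longrightarrow> (\<forall>s. Re s > \<epsilon> \<longrightarrow> norm (f s) \<le> C) \<longrightarrow>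
     (\<forall>N. \<forall>s. Re s > 2 * \<epsilon> \<longrightarrow> norm (dpoly a N s) \<le> K * C)"
proof -
  obtain K where K: "K \<ge> 0" "\<And>a M C N s. (\<And>s. Re s > 0 \<Longrightarrow> norm (dpoly a M s) \<le> C) \<Longrightarrow>
     Re s > \<epsilon> \<Longrightarrow> norm (dpoly a (min N M) s) \<le> K * C"
    using partial_sums_uniformly_bounded[OF assms] by metis
  have "norm (dpoly a N s) \<le> K * C"
    if f: "dirichlet_limit a f" "\<And>s. Re s > \<epsilon> \<Longrightarrow> norm (f s) \<le> C" and s: "Re s > 2 * \<epsilon>" for a f C N s
  proof (rule field_le_epsilon)
    fix e :: real assume "e > 0"
    then have "e / (K + 1) > 0" using K(1) by simp
    then obtain N0 where N0: "\<And>N s. N \<ge> N0 \<Longrightarrow> Re s > 0 \<Longrightarrow> norm (dpoly (shift \<epsilon> a) N s) \<le> C + e / (K + 1)"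
      using dpoly_eventually_bounded[OF f(1) assms _ f(2)] by blast
    have "norm (dpoly (shift \<epsilon> a) (min N (max N N0)) (s - of_real \<epsilon>)) \<le> K * (C + e / (K + 1))"
      by (rule K(2)) (use s N0 in auto)
    also have "\<dots> = K * C + e * (K / (K + 1))" by (simp add: distrib_left)
    also have "e * (K / (K + 1)) \<le> e * 1" using K(1) \<open>e > 0\<close> by (intro mult_left_mono) auto
    finally show "norm (dpoly a N s) \<le> K * C + e" by (simp add: dpoly_shift)
  qed
  then show ?thesis using K(1) by blast
qed

text \<open>A term of the series is the difference of two consecutive partial sums.\<close>

lemma dirichlet_coeff_bound:
  assumes "n \<ge> 1"
  shows "\<exists>K\<ge>0. \<forall>a f C. dirichlet_limit a f \<longrightarrow> (\<forall>s. Re s > 0 \<longrightarrow> norm (f s) \<le> C) \<longrightarrow> norm (a n) \<le> K * C"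
proof -
  obtain K where K: "K \<ge> 0" "\<And>a f C N s. dirichlet_limit a f \<Longrightarrow> (\<And>s. Re s > 1 \<Longrightarrow> norm (f s) \<le> C) \<Longrightarrow>
     Re s > 2 \<Longrightarrow> norm (dpoly a N s) \<le> K * C"
    using partial_sums_bounded[of 1] by (metis mult_2 one_add_one zero_less_one)
  have "norm (a n) \<le> 2 * K * real n ^ 3 * C"
    if f: "dirichlet_limit a f" "\<And>s. Re s > 0 \<Longrightarrow> norm (f s) \<le> C" for a f C
  proof -
    have n0: "of_nat n \<noteq> (0::complex)" using assms by simp
    have p: "of_nat n powr (- 3) = (1 / of_nat n ^ 3 :: complex)"
      using powr_minus[of "of_nat n :: complex" 3] powr_nat'[of "of_nat n :: complex" 3] n0
      by (simp add: field_simps)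
    have b: "norm (dpoly a N 3) \<le> K * C" for N
      by (rule K(2)[OF f(1)]) (use f(2) in auto)
    have "dpoly a n 3 = dpoly a (n - 1) 3 + a n * of_nat n powr (- 3)"
      unfolding dpoly_def using assms by (cases n) auto
    then have "a n = (dpoly a n 3 - dpoly a (n - 1) 3) * of_nat n ^ 3"
      using n0 by (simp add: p)
    then have "norm (a n) = norm (dpoly a n 3 - dpoly a (n - 1) 3) * real n ^ 3"
      by (metis norm_mult norm_of_nat norm_power)
    also have "\<dots> \<le> (K * C + K * C) * real n ^ 3"
      by (intro mult_right_mono order_trans[OF norm_triangle_ineq4] add_mono b) auto
    finally show ?thesis by (simp add: algebra_simps)
  qed
  then show ?thesis using K(1) by (intro exI[of _ "2 * K * real n ^ 3"]) auto
qed

theorem dirichlet_limit_unique_coeff: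
  assumes "dirichlet_limit a f" "dirichlet_limit b f" "n \<ge> 1"
  shows "a n = b n"
proof -
  obtain K where "\<And>a f C. dirichlet_limit a f \<Longrightarrow> (\<And>s. Re s > 0 \<Longrightarrow> norm (f s) \<le> C) \<Longrightarrow> norm (a n) \<le> K * C"
    using dirichlet_coeff_bound[OF assms(3)] by metis
  from this[OF dirichlet_limit_diff[OF assms(1,2)], of 0] show ?thesis
    by (simp add: right_half_plane_def)
qed

text \<open>By Bohr's inequality the partial sums of f_k converge as k tends to infinity
  uniformly in their order, so the limits in k and in the order may be interchanged.\<close>

theorem dirichlet_limit_closed:
  assumes f: "\<And>k. dirichlet_limit (a k) (f k)"
    and lim: "\<And>\<epsilon>. \<epsilon> > 0 \<Longrightarrow> uniform_limit {s. Re s > \<epsilon>} f g sequentially"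
    and coeffs: "\<And>n. n \<ge> 1 \<Longrightarrow> (\<lambda>k. a k n) \<longlonglongrightarrow> b n"
  shows "dirichlet_limit b (restrict g RHP)"
  unfolding dirichlet_limit_iff
proof (intro conjI allI impI)
  fix \<epsilon> :: real assume \<epsilon>: "\<epsilon> > 0"
  obtain K where K: "K \<ge> 0" "\<And>a f C N s. dirichlet_limit a f \<Longrightarrow> (\<And>s. Re s > \<epsilon> / 2 \<Longrightarrow> norm (f s) \<le> C) \<Longrightarrow>
     Re s > \<epsilon> \<Longrightarrow> norm (dpoly a N s) \<le> K * C"
    using partial_sums_bounded[of "\<epsilon> / 2"] \<epsilon> by auto
  have "uniform_limit {s. Re s > \<epsilon>} (dpoly b) g sequentially"
    unfolding uniform_limit_sequentially_iff
  proof (intro allI impI)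
    fix e :: real assume e: "e > 0"
    define \<eta> where "\<eta> = e / (2 * K + 3)"
    have \<eta>: "\<eta> > 0" "(2 * K + 3) * \<eta> = e" using e K(1) by (auto simp: \<eta>_def)
    obtain k where k: "\<And>l s. l \<ge> k \<Longrightarrow> Re s > \<epsilon> / 2 \<Longrightarrow> dist (f l s) (g s) < \<eta>"
      using lim[of "\<epsilon> / 2"] \<epsilon> \<eta>(1) unfolding uniform_limit_sequentially_iff by (metis half_gt_zero mem_Collect_eq)
    have ab: "norm (dpoly (a k) N s - dpoly b N s) \<le> K * (2 * \<eta>)" if s: "Re s > \<epsilon>" for N s
    proof (rule Lim_norm_ubound[OF trivial_limit_sequentially])
      show "(\<lambda>l. dpoly (a k) N s - dpoly (a l) N s) \<longlonglongrightarrow> dpoly (a k) N s - dpoly b N s"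
        unfolding dpoly_def by (intro tendsto_intros coeffs) auto
      have "norm (dpoly (a k) N s - dpoly (a l) N s) \<le> K * (2 * \<eta>)" if l: "l \<ge> k" for l
        unfolding dpoly_diff[symmetric]
      proof (rule K(2)[OF dirichlet_limit_diff[OF f f] _ s])
        fix s assume s: "Re s > \<epsilon> / 2"
        have "norm (f k s - f l s) \<le> dist (f k s) (g s) + dist (f l s) (g s)"
          using dist_triangle2[of "f k s" "f l s" "g s"] by (simp add: dist_norm)
        also have "\<dots> \<le> 2 * \<eta>" using k[OF _ s] l by (smt (verit) order_refl)
        finally show "norm ((\<lambda>s\<in>RHP. f k s - f l s) s) \<le> 2 * \<eta>"
          using s \<epsilon> by (simp add: right_half_plane_def)
      qed
      then show "\<forall>\<^sub>F l in sequentially. norm (dpoly (a k) N s - dpoly (a l) N s) \<le> K * (2 * \<eta>)"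
        by (auto simp: eventually_sequentially)
    qed
    obtain N0 where N0: "\<And>N s. N \<ge> N0 \<Longrightarrow> Re s > \<epsilon> \<Longrightarrow> dist (dpoly (a k) N s) (f k s) < \<eta>"
      using f[of k] \<epsilon> \<eta>(1) unfolding dirichlet_limit_iff uniform_limit_sequentially_iff by (metis mem_Collect_eq)
    have "dist (dpoly b N s) (g s) < e" if "N \<ge> N0" "Re s > \<epsilon>" for N s
    proof -
      have "dist (dpoly b N s) (g s) \<le> dist (dpoly (a k) N s) (dpoly b N s) + dist (dpoly (a k) N s) (f k s) + dist (f k s) (g s)"
        using dist_triangle[of "dpoly b N s" "g s" "f k s"]
          dist_triangle[of "dpoly b N s" "f k s" "dpoly (a k) N s"] by (simp add: dist_commute)
      also have "\<dots> < K * (2 * \<eta>) + \<eta> + \<eta> + \<eta>"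
        using ab[OF that(2), of N] N0[OF that] k[of k s] that \<epsilon> \<eta> by (simp add: dist_norm)
      also have "\<dots> = e" using \<eta>(2) by (simp add: algebra_simps)
      finally show ?thesis .
    qed
    then show "\<exists>N0. \<forall>N\<ge>N0. \<forall>s\<in>{s. Re s > \<epsilon>}. dist (dpoly b N s) (g s) < e" by auto
  qed
  then show "uniform_limit {s. Re s > \<epsilon>} (dpoly b) (restrict g RHP) sequentially"
    by (rule uniform_limit_cong'[THEN iffD1, rotated -1]) (use \<epsilon> in \<open>auto simp: right_half_plane_def\<close>)
qed simp

lemma nat_mult_powr: "of_nat (m * n) powr s = of_nat m powr s * (of_nat n powr s :: complex)"
  by (simp add: powr_times_real)

lemma dpoly_mult_finite:
  assumes "\<And>n. n > k \<Longrightarrow> coeff a n = 0" "\<And>n. n > k \<Longrightarrow> coeff b n = 0"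
  shows "dpoly (coeff (a * b)) (k * k) s = dpoly (coeff a) k s * dpoly (coeff b) k s"
    and "n > k * k \<Longrightarrow> coeff (a * b) n = 0"
proof -
  have van: "coeff a d * coeff b e = 0" if "\<not> (d \<le> k \<and> e \<le> k)" for d e
    using that assms by (auto simp: not_le)
  show "coeff (a * b) n = 0" if n: "n > k * k" for n
  proof -
    have "coeff a d * coeff b e = 0" if "d * e = n" for d e
    proof (rule van)
      show "\<not> (d \<le> k \<and> e \<le> k)" using n that mult_le_mono[of d k e k] by auto
    qed
    then show ?thesis using n by (subst coeff_mult) (auto intro!: sum.neutral)
  qed
  let ?t = "\<lambda>d e. coeff a d * coeff b e * of_nat (d * e) powr (- s)"
  have "dpoly (coeff (a * b)) (k * k) s = (\<Sum>n\<in>{1..k*k}. \<Sum>p\<in>{(d,e). d * e = n}. ?t (fst p) (snd p))"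
    unfolding dpoly_def
    by (intro sum.cong refl) (auto simp: coeff_mult case_prod_unfold sum_distrib_right)
  also have "\<dots> = (\<Sum>(n,p)\<in>Sigma {1..k*k} (\<lambda>n. {(d,e). d * e = n}). ?t (fst p) (snd p))"
    by (rule sum.Sigma) (auto intro: finite_factor_pairs)
  also have "\<dots> = (\<Sum>p\<in>{1..k} \<times> {1..k}. ?t (fst p) (snd p))"
  proof (rule sum.mono_neutral_cong_right[THEN trans, OF _ _ _ refl])
    show "finite (Sigma {1..k*k} (\<lambda>n. {(d::nat,e). d * e = n}))"
      by (intro finite_SigmaI) (auto intro: finite_factor_pairs)
    show "(\<lambda>p. (fst p * snd p, p)) ` ({1..k} \<times> {1..k}) \<subseteq> Sigma {1..k*k} (\<lambda>n. {(d::nat,e). d * e = n})"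
      by (auto intro: mult_le_mono simp: Suc_le_eq)
    show "\<forall>i\<in>Sigma {1..k*k} (\<lambda>n. {(d,e). d * e = n}) - (\<lambda>p. (fst p * snd p, p)) ` ({1..k} \<times> {1..k}).
      (case i of (n, p) \<Rightarrow> ?t (fst p) (snd p)) = 0"
    proof
      fix i assume i: "i \<in> Sigma {1..k*k} (\<lambda>n. {(d::nat,e). d * e = n}) - (\<lambda>p. (fst p * snd p, p)) ` ({1..k} \<times> {1..k})"
      obtain n d e where ie: "i = (n, (d, e))" by (metis prod.collapse)
      then have n: "d * e = n" "n \<ge> 1" using i by auto
      then have "d \<ge> 1" "e \<ge> 1" by (auto simp: Suc_le_eq intro!: gr0I)
      then have "\<not> (d \<le> k \<and> e \<le> k)" using i ie n by (auto simp: image_iff)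
      then show "(case i of (n, p) \<Rightarrow> ?t (fst p) (snd p)) = 0" using van ie by simp
    qed
    show "sum (\<lambda>x. case x of (n, p) \<Rightarrow> ?t (fst p) (snd p)) ((\<lambda>p. (fst p * snd p, p)) ` ({1..k} \<times> {1..k})) = (\<Sum>p\<in>{1..k} \<times> {1..k}. ?t (fst p) (snd p))"
      by (subst sum.reindex) (auto simp: inj_on_def)
  qed
  also have "\<dots> = dpoly (coeff a) k s * dpoly (coeff b) k s"
    unfolding dpoly_def sum_product sum.cartesian_product
    by (intro sum.cong refl) (auto simp: nat_mult_powr[unfolded of_nat_mult] mult_ac)
  finally show "dpoly (coeff (a * b)) (k * k) s = dpoly (coeff a) k s * dpoly (coeff b) k s" .
qed

text \<open>The product is the uniform limit, on each smaller half-plane, of the products of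
  the partial sums; these are Dirichlet polynomials whose coefficients are eventually those of
  the Dirichlet convolution.\<close>

theorem dirichlet_limit_mult:
  assumes "dirichlet_limit (coeff a) f" "dirichlet_limit (coeff b) g"
  shows "dirichlet_limit (coeff (a * b)) (\<lambda>s\<in>RHP. f s * g s)"
proof -
  define tr where "tr k c = mk_fds (\<lambda>n. if n \<le> k then coeff c n else 0)" for k c
  have tr: "coeff (tr k c) n = (if n \<le> k then coeff c n else 0)" for k c n
    by (simp add: tr_def coeff_mk_fds)
  have dp: "dpoly (coeff (tr k c)) k s = dpoly (coeff c) k s" for k c s
    by (rule dpoly_cong) (simp add: tr)
  have trz: "n > k \<Longrightarrow> coeff (tr k c) n = 0" for k c n by (simp add: tr)
  show ?thesis
  proof (rule dirichlet_limit_closed)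
    show "dirichlet_limit (coeff (tr k a * tr k b))
        (\<lambda>s\<in>RHP. dpoly (coeff (tr k a * tr k b)) (k * k) s)" for k
      by (rule dirichlet_limit_finite) (rule dpoly_mult_finite(2)[OF trz trz])
    show "(\<lambda>k. coeff (tr k a * tr k b) n) \<longlonglongrightarrow> coeff (a * b) n" if n: "n \<ge> 1" for n
    proof (rule tendsto_eventually)
      have "coeff (tr k a * tr k b) n = coeff (a * b) n" if k: "k \<ge> n" for k
      proof -
        have "coeff (tr k a) d * coeff (tr k b) e = coeff a d * coeff b e" if "d * e = n" for d e
        proof -
          have "d dvd n" "e dvd n" using that by auto
          then have "d \<le> k" "e \<le> k" using n k by (auto dest!: dvd_imp_le)
          then show ?thesis by (simp add: tr)
        qed
        then show ?thesis using n by (auto simp: coeff_mult intro!: sum.cong)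
      qed
      then show "\<forall>\<^sub>F k in sequentially. coeff (tr k a * tr k b) n = coeff (a * b) n"
        by (auto simp: eventually_sequentially)
    qed
    fix \<epsilon> :: real assume \<epsilon>: "\<epsilon> > 0"
    have "uniform_limit {s. Re s > \<epsilon>} (\<lambda>k s. dpoly (coeff a) k s * dpoly (coeff b) k s) (\<lambda>s. f s * g s) sequentially"
      using assms \<epsilon> dirichlet_limit_bounded[OF assms(1) \<epsilon>] dirichlet_limit_bounded[OF assms(2) \<epsilon>]
      by (intro uniform_lim_mult) (auto simp: dirichlet_limit_iff)
    then show "uniform_limit {s. Re s > \<epsilon>} (\<lambda>k. \<lambda>s\<in>RHP. dpoly (coeff (tr k a * tr k b)) (k * k) s)
        (\<lambda>s. f s * g s) sequentially"
      by (rule uniform_limit_cong'[THEN iffD1, rotated -1])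
         (use \<epsilon> in \<open>auto simp: right_half_plane_def dpoly_mult_finite(1)[OF trz trz] dp\<close>)
  qed
qed

lemma dirichlet_limit_exists:
  assumes "\<And>\<epsilon>. \<epsilon> > 0 \<Longrightarrow> uniformly_convergent_on {s. Re s > \<epsilon>} (dpoly a)"
  shows "\<exists>f. dirichlet_limit a f"
proof
  show "dirichlet_limit a (\<lambda>s\<in>RHP. lim (\<lambda>N. dpoly a N s))"
    unfolding dirichlet_limit_iff
  proof (intro conjI allI impI)
    fix \<epsilon> :: real assume \<epsilon>: "\<epsilon> > 0"
    have "uniform_limit {s. Re s > \<epsilon>} (dpoly a) (\<lambda>s. lim (\<lambda>N. dpoly a N s)) sequentially"
      using assms[OF \<epsilon>] by (simp add: uniformly_convergent_uniform_limit_iff)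
    then show "uniform_limit {s. Re s > \<epsilon>} (dpoly a) (\<lambda>s\<in>RHP. lim (\<lambda>N. dpoly a N s)) sequentially"
      by (rule uniform_limit_cong'[THEN iffD1, rotated -1]) (use \<epsilon> in \<open>auto simp: right_half_plane_def\<close>)
  qed simp
qed

text \<open>A contractive multiplier maps uniformly Cauchy partial sums to uniformly Cauchy
  partial sums.\<close>

theorem dirichlet_limit_contractive:
  assumes w: "contractive w" and f: "dirichlet_limit a f"
  obtains g where "dirichlet_limit (\<lambda>n. w n * a n) g"
    "\<And>C. (\<And>s. Re s > 0 \<Longrightarrow> norm (f s) \<le> C) \<Longrightarrow> (\<And>s. Re s > 0 \<Longrightarrow> norm (g s) \<le> C)"
proof -
  define b where "b n = w n * a n" for n
  have unif: "uniformly_convergent_on {s. Re s > \<epsilon>} (dpoly b)" if \<epsilon>: "\<epsilon> > 0" for \<epsilon>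
    unfolding uniformly_convergent_eq_Cauchy
  proof (rule uniformly_Cauchy_onI')
    fix e :: real assume e: "e > 0"
    have "uniformly_Cauchy_on {s. Re s > \<epsilon>} (dpoly a)"
      using f \<epsilon> unfolding dirichlet_limit_iff uniformly_convergent_eq_Cauchy[symmetric] uniformly_convergent_on_def
      by blast
    then obtain M where M: "\<And>s m n. Re s > \<epsilon> \<Longrightarrow> m \<ge> M \<Longrightarrow> n \<ge> M \<Longrightarrow> dist (dpoly a m s) (dpoly a n s) < e / 2"
      unfolding uniformly_Cauchy_on_def using e by (metis half_gt_zero mem_Collect_eq)
    have "dist (dpoly b m s) (dpoly b n s) < e" if s: "Re s > \<epsilon>" and mn: "m \<ge> M" "n > m" for s m n
    proof -
      define c where "c j = (if j > m then a j else 0)" for j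
      have diff: "dpoly (\<lambda>j. v j * c j) n s = dpoly (\<lambda>j. v j * a j) n s - dpoly (\<lambda>j. v j * a j) m s" for v s
      proof -
        have "dpoly (\<lambda>j. v j * a j) n s - dpoly (\<lambda>j. v j * a j) m s =
          (\<Sum>j\<in>{1..n} - {1..m}. v j * a j * of_nat j powr (- s))"
          unfolding dpoly_def using mn by (intro sum_diff[symmetric]) auto
        also have "\<dots> = dpoly (\<lambda>j. v j * c j) n s"
          unfolding dpoly_def by (intro sum.mono_neutral_cong_left) (auto simp: c_def)
        finally show ?thesis ..
      qed
      have "norm (dpoly (\<lambda>j. w j * shift \<epsilon> c j) n (s - of_real \<epsilon>)) \<le> e / 2"
      proof (rule contractiveD[OF w])
        fix z assume z: "Re z > 0"
        have "norm (dpoly c n (z + of_real \<epsilon>)) \<le> e / 2"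
          using diff[of "\<lambda>_. 1" "z + of_real \<epsilon>"] M[of "z + of_real \<epsilon>" m n] z mn
          by (simp add: dist_norm norm_minus_commute)
        then show "norm (dpoly (shift \<epsilon> c) n z) \<le> e / 2" by (simp add: dpoly_shift)
      qed (use s in auto)
      also have "(\<lambda>j. w j * shift \<epsilon> c j) = shift \<epsilon> (\<lambda>j. w j * c j)"
        by (simp add: shift_def fun_eq_iff)
      finally show ?thesis
        using diff[of w s] e by (simp add: dpoly_shift b_def[abs_def] dist_norm norm_minus_commute)
    qed
    then show "\<exists>M. \<forall>s\<in>{s. Re s > \<epsilon>}. \<forall>m\<ge>M. \<forall>n>m. dist (dpoly b m s) (dpoly b n s) < e" by auto
  qed
  obtain g where g: "dirichlet_limit b g"
    using dirichlet_limit_exists[OF unif] by blast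
  show thesis
  proof (rule that[OF g[unfolded b_def]])
    fix C s assume C: "\<And>s. Re s > 0 \<Longrightarrow> norm (f s) \<le> C" and s: "Re s > 0"
    show "norm (g s) \<le> C"
    proof (rule field_le_epsilon)
      fix e :: real assume e: "e > 0"
      define \<epsilon> where "\<epsilon> = Re s / 2"
      have \<epsilon>: "\<epsilon> > 0" using s by (simp add: \<epsilon>_def)
      obtain N0 where N0: "\<And>N s. N \<ge> N0 \<Longrightarrow> Re s > 0 \<Longrightarrow> norm (dpoly (shift \<epsilon> a) N s) \<le> C + e"
        using dpoly_eventually_bounded[OF f \<epsilon> e, of C] C \<epsilon> by fastforce
      have "norm (dpoly b N s) \<le> C + e" if "N \<ge> N0" for N
      proof -
        have "norm (dpoly (\<lambda>j. w j * shift \<epsilon> a j) N (s - of_real \<epsilon>)) \<le> C + e"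
          by (rule contractiveD[OF w]) (use N0[OF that] s in \<open>auto simp: \<epsilon>_def\<close>)
        also have "(\<lambda>j. w j * shift \<epsilon> a j) = shift \<epsilon> b"
          by (simp add: shift_def b_def fun_eq_iff)
        finally show ?thesis by (simp add: dpoly_shift)
      qed
      then show "norm (g s) \<le> C + e"
        by (intro Lim_norm_ubound[OF trivial_limit_sequentially dirichlet_limit_tendsto[OF g s]])
           (auto simp: eventually_sequentially)
    qed
  qed
qed

lemma dirichlet_limit_absolutely_summable:
  assumes "\<And>N. (\<Sum>n=1..N. norm (a n)) \<le> C"
  obtains f where "dirichlet_limit a f" "\<And>s. Re s > 0 \<Longrightarrow> norm (f s) \<le> C"
proof -
  have sum: "summable (\<lambda>n. norm (a (Suc n)))"
  proof (rule summableI_nonneg_bounded)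
    show "(\<Sum>n<N. norm (a (Suc n))) \<le> C" for N
      using assms[of N] by (simp add: sum.atLeast1_atMost_eq)
  qed simp
  have dp: "dpoly a N s = (\<Sum>n<N. a (Suc n) * of_nat (Suc n) powr (- s))" for N s
    unfolding dpoly_def One_nat_def sum.atLeast1_atMost_eq ..
  define f where "f = (\<lambda>s\<in>RHP. \<Sum>n. a (Suc n) * of_nat (Suc n) powr (- s))"
  have f: "dirichlet_limit a f"
    unfolding dirichlet_limit_iff
  proof (intro conjI allI impI)
    fix \<epsilon> :: real assume \<epsilon>: "\<epsilon> > 0"
    have "uniform_limit {s. Re s > \<epsilon>} (\<lambda>N s. \<Sum>n<N. a (Suc n) * of_nat (Suc n) powr (- s))
       (\<lambda>s. \<Sum>n. a (Suc n) * of_nat (Suc n) powr (- s)) sequentially"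
      by (rule Weierstrass_m_test[OF _ sum])
         (use \<epsilon> in \<open>auto simp: norm_mult simp del: of_nat_Suc intro!: mult_left_le norm_nat_powr_le_1\<close>)
    then show "uniform_limit {s. Re s > \<epsilon>} (dpoly a) f sequentially"
      by (rule uniform_limit_cong'[THEN iffD1, rotated -1])
         (use \<epsilon> in \<open>auto simp: right_half_plane_def f_def dp\<close>)
  qed (simp add: f_def)
  show thesis
  proof (rule that[OF f])
    fix s assume s: "Re s > 0"
    show "norm (f s) \<le> C"
    proof (rule Lim_norm_ubound[OF trivial_limit_sequentially dirichlet_limit_tendsto[OF f s]])
      show "\<forall>\<^sub>F N in sequentially. norm (dpoly a N s) \<le> C"
        using s norm_dpoly_le[of s a] assms by (auto intro!: always_eventually intro: order_trans)
    qed
  qed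
qed

lemma dirichlet_limit_holomorphic:
  assumes "dirichlet_limit a f" shows "f holomorphic_on RHP"
proof (rule holomorphic_uniform_sequence)
  show "open RHP"
    unfolding right_half_plane_def by (rule open_halfspace_Re_gt)
  show "dpoly a N holomorphic_on RHP" for N
    unfolding dpoly_def[abs_def] by (intro holomorphic_intros) auto
  fix s assume "s \<in> RHP"
  then have s: "Re s > 0" by (simp add: right_half_plane_def)
  have sub: "Re z > Re s / 3" if "z \<in> cball s (Re s / 2)" for z
    using abs_Re_le_cmod[of "s - z"] that s by (simp add: dist_norm)
  show "\<exists>d>0. cball s d \<subseteq> RHP \<and> uniform_limit (cball s d) (dpoly a) f sequentially"
  proof (intro exI[of _ "Re s / 2"] conjI)
    show "cball s (Re s / 2) \<subseteq> RHP"
      using sub s unfolding right_half_plane_def by force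
    show "uniform_limit (cball s (Re s / 2)) (dpoly a) f sequentially"
    proof (rule uniform_limit_on_subset)
      show "uniform_limit {z. Re z > Re s / 3} (dpoly a) f sequentially"
        using assms s unfolding dirichlet_limit_iff by (meson divide_pos_pos zero_less_numeral)
    qed (use sub in auto)
  qed (use s in simp)
qed

lemma O_u_iff: "f \<in> O_u \<longleftrightarrow> (\<exists>a. dirichlet_limit a f)"
  using dirichlet_limit_holomorphic by (auto simp: O_u_def)

section \<open>Permutations of the primes\<close>

lemma bij_betw_nth_prime: "bij_betw nth_prime {1..} {p. prime p}"
proof -
  have "bij_betw (enumerate {p::nat. prime p}) UNIV {p. prime p}"
    by (rule bij_enumerate) (rule primes_infinite)
  moreover have "bij_betw (\<lambda>i. i - 1) {1::nat..} UNIV"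
    by (rule bij_betw_byWitness[where f'=Suc]) auto
  ultimately have "bij_betw (enumerate {p::nat. prime p} \<circ> (\<lambda>i. i - 1)) {1..} {p. prime p}"
    by (rule bij_betw_trans[rotated])
  moreover have "enumerate {p::nat. prime p} \<circ> (\<lambda>i. i - 1) = nth_prime"
    by (simp add: fun_eq_iff nth_prime_def)
  ultimately show ?thesis by simp
qed

text \<open>The action of \<sigma> on the primes themselves instead of their indices.\<close>

definition permute_prime :: "(nat \<Rightarrow> nat) \<Rightarrow> nat \<Rightarrow> nat" where
  "permute_prime \<sigma> p = nth_prime (\<sigma> (inv_into {1..} nth_prime p))"

lemma permute_prime_nth_prime: "i \<ge> 1 \<Longrightarrow> permute_prime \<sigma> (nth_prime i) = nth_prime (\<sigma> i)"
  using bij_betw_inv_into_left[OF bij_betw_nth_prime, of i] by (simp add: permute_prime_def)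

lemma bij_betw_permute_prime:
  assumes "bij_betw \<sigma> {1..} {1..}" shows "bij_betw (permute_prime \<sigma>) {p. prime p} {p. prime p}"
proof -
  have "bij_betw (nth_prime \<circ> (\<sigma> \<circ> inv_into {1..} nth_prime)) {p. prime p} {p. prime p}"
    by (rule bij_betw_trans[OF bij_betw_trans[OF bij_betw_inv_into[OF bij_betw_nth_prime] assms]
          bij_betw_nth_prime])
  then show ?thesis by (simp add: permute_prime_def[abs_def] comp_def)
qed

text \<open>In terms of multisets of prime factors, prime_perm \<sigma> is an image map, which
  makes multiplicativity, invariance of \<Omega> and bijectivity evident.\<close>

lemma prime_perm_eq_prod_mset:
  assumes "n \<ge> 1"
  shows "prime_perm \<sigma> n = prod_mset (image_mset (permute_prime \<sigma>) (prime_factorization n))"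
proof -
  have bij: "bij_betw nth_prime {i. 1 \<le> i \<and> nth_prime i dvd n} (prime_factors n)"
    using bij_betw_nth_prime assms
    by (auto simp: bij_betw_def inj_on_def prime_factors_dvd image_iff set_eq_iff) (metis atLeast_iff One_nat_def)+
  have "prod_mset (image_mset (permute_prime \<sigma>) (prime_factorization n))
     = (\<Prod>p\<in>prime_factors n. permute_prime \<sigma> p ^ multiplicity p n)"
    by (subst image_prod_mset_multiplicity)
       (intro prod.cong refl, simp add: count_prime_factorization_prime in_prime_factors_imp_prime)
  also have "\<dots> = (\<Prod>i | 1 \<le> i \<and> nth_prime i dvd n. permute_prime \<sigma> (nth_prime i) ^ multiplicity (nth_prime i) n)"
    by (rule prod.reindex_bij_betw[OF bij, symmetric])
  also have "\<dots> = prime_perm \<sigma> n"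
    unfolding prime_perm_def by (intro prod.cong) (auto simp: permute_prime_nth_prime)
  finally show ?thesis ..
qed

context
  fixes \<sigma> :: "nat \<Rightarrow> nat"
  assumes \<sigma>: "bij_betw \<sigma> {1..} {1..}"
begin

lemma prime_factorization_prime_perm:
  assumes "n \<ge> 1"
  shows "prime_factorization (prime_perm \<sigma> n) = image_mset (permute_prime \<sigma>) (prime_factorization n)"
  unfolding prime_perm_eq_prod_mset[OF assms]
  using bij_betwE[OF bij_betw_permute_prime[OF \<sigma>]]
  by (intro prime_factorization_prod_mset_primes) auto

lemma prime_perm_pos: "n \<ge> 1 \<Longrightarrow> prime_perm \<sigma> n \<ge> 1"
  using bij_betw_permute_prime[OF \<sigma>] unfolding prime_perm_eq_prod_mset
  by (auto simp: Suc_le_eq prod_mset_zero_iff bij_betw_def intro!: gr0I)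
     (metis imageI in_prime_factors_imp_prime mem_Collect_eq not_prime_0)

lemma big_omega_prime_perm: "n \<ge> 1 \<Longrightarrow> big_omega (prime_perm \<sigma> n) = big_omega n"
  by (simp add: big_omega_def prime_factorization_prime_perm)

lemma prime_perm_mult: "m \<ge> 1 \<Longrightarrow> n \<ge> 1 \<Longrightarrow> prime_perm \<sigma> (m * n) = prime_perm \<sigma> m * prime_perm \<sigma> n"
  by (simp add: prime_perm_eq_prod_mset prime_factorization_mult)

lemma bij_betw_prime_perm: "bij_betw (prime_perm \<sigma>) {1..} {1..}"
proof (rule bij_betw_byWitness)
  define \<rho> where "\<rho> = inv_into {p. prime p} (permute_prime \<sigma>)"
  define \<tau> where "\<tau> n = prod_mset (image_mset \<rho> (prime_factorization n))" for n :: nat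
  note b = bij_betw_permute_prime[OF \<sigma>]
  have \<rho>: "bij_betw \<rho> {p. prime p} {p. prime p}" unfolding \<rho>_def by (rule bij_betw_inv_into[OF b])
  have pf: "prime_factorization (\<tau> n) = image_mset \<rho> (prime_factorization n)" for n
    unfolding \<tau>_def using bij_betwE[OF \<rho>] by (intro prime_factorization_prod_mset_primes) auto
  have \<tau>1: "\<tau> n \<ge> 1" for n
    using \<rho> unfolding \<tau>_def
    by (auto simp: Suc_le_eq prod_mset_zero_iff bij_betw_def intro!: gr0I)
      (metis imageI in_prime_factors_imp_prime mem_Collect_eq not_prime_0)
  show "\<forall>n\<in>{1..}. \<tau> (prime_perm \<sigma> n) = n"
  proof
    fix n :: nat assume "n \<in> {1..}"
    then have n: "n \<ge> 1" by simp
    have "image_mset \<rho> (prime_factorization (prime_perm \<sigma> n)) = image_mset (\<lambda>p. p) (prime_factorization n)"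
      unfolding prime_factorization_prime_perm[OF n] multiset.map_comp
      by (intro image_mset_cong)
         (simp add: \<rho>_def bij_betw_inv_into_left[OF b] in_prime_factors_imp_prime)
    then show "\<tau> (prime_perm \<sigma> n) = n"
      using n by (simp add: \<tau>_def prod_mset_prime_factorization_nat)
  qed
  show "\<forall>n\<in>{1..}. prime_perm \<sigma> (\<tau> n) = n"
  proof
    fix n :: nat assume "n \<in> {1..}"
    then have n: "n \<ge> 1" by simp
    have "image_mset (permute_prime \<sigma>) (prime_factorization (\<tau> n)) = image_mset (\<lambda>p. p) (prime_factorization n)"
      unfolding pf multiset.map_comp
      by (intro image_mset_cong)
         (simp add: \<rho>_def bij_betw_inv_into_right[OF b] in_prime_factors_imp_prime)
    then show "prime_perm \<sigma> (\<tau> n) = n"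
      using n \<tau>1 by (simp add: prime_perm_eq_prod_mset prod_mset_prime_factorization_nat)
  qed
  show "prime_perm \<sigma> ` {1..} \<subseteq> {1..}" using prime_perm_pos by auto
  show "\<tau> ` {1..} \<subseteq> {1..}" using \<tau>1 by auto
qed

text \<open>A multiplicative bijection of the positive integers permutes the factorizations d
  e = n.\<close>

lemma coeff_mult_prime_perm:
  assumes a: "\<And>n. n \<ge> 1 \<Longrightarrow> coeff a (prime_perm \<sigma> n) = coeff a n"
    and b: "\<And>n. n \<ge> 1 \<Longrightarrow> coeff b (prime_perm \<sigma> n) = coeff b n" and n: "n \<ge> 1"
  shows "coeff (a * b) (prime_perm \<sigma> n) = coeff (a * b) n"
proof -
  define \<tau> where "\<tau> = inv_into {1..} (prime_perm \<sigma>)"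
  have \<tau>: "\<tau> (prime_perm \<sigma> m) = m" "prime_perm \<sigma> (\<tau> m) = m" "\<tau> m \<ge> 1" if "m \<ge> 1" for m
    using that bij_betw_inv_into_left[OF bij_betw_prime_perm, of m]
      bij_betw_inv_into_right[OF bij_betw_prime_perm, of m]
      bij_betw_inv_into[OF bij_betw_prime_perm]
    by (auto simp: \<tau>_def bij_betw_def)
  have "(\<Sum>(d,e)\<in>{(d,e). d * e = n}. coeff a d * coeff b e)
     = (\<Sum>(d,e)\<in>{(d,e). d * e = prime_perm \<sigma> n}. coeff a d * coeff b e)"
  proof (rule sum.reindex_bij_witness[where i="\<lambda>(d,e). (\<tau> d, \<tau> e)" and j="\<lambda>(d,e). (prime_perm \<sigma> d, prime_perm \<sigma> e)"])
    fix p assume "p \<in> {(d,e). d * e = n}"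
    then obtain d e where p: "p = (d, e)" "d * e = n" "d \<ge> 1" "e \<ge> 1" using n
      by (cases p) (auto simp: Suc_le_eq intro!: gr0I)
    show "(case case p of (d, e) \<Rightarrow> (prime_perm \<sigma> d, prime_perm \<sigma> e) of (d, e) \<Rightarrow> (\<tau> d, \<tau> e)) = p"
      "(case p of (d, e) \<Rightarrow> (prime_perm \<sigma> d, prime_perm \<sigma> e)) \<in> {(d,e). d * e = prime_perm \<sigma> n}"
      "(case case p of (d, e) \<Rightarrow> (prime_perm \<sigma> d, prime_perm \<sigma> e) of (d, e) \<Rightarrow> coeff a d * coeff b e) = (case p of (d, e) \<Rightarrow> coeff a d * coeff b e)"
      using p \<tau> a b by (auto simp: prime_perm_mult)
  next
    fix p assume "p \<in> {(d,e). d * e = prime_perm \<sigma> n}"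
    then obtain d e where de: "p = (d, e)" "d * e = prime_perm \<sigma> n" by (cases p) auto
    have "d \<ge> 1" "e \<ge> 1" using de(2) prime_perm_pos[OF n] by (cases d; cases e; simp)+
    note p = de this
    have "prime_perm \<sigma> (\<tau> d * \<tau> e) = prime_perm \<sigma> n" using p \<tau> by (simp add: prime_perm_mult)
    then have "\<tau> d * \<tau> e = n"
      using inj_onD[OF bij_betw_imp_inj_on[OF bij_betw_prime_perm], of "\<tau> d * \<tau> e" n] \<tau>(3)[OF p(3)] \<tau>(3)[OF p(4)] n
      by (auto simp: Suc_le_eq)
    then show "(case case p of (d, e) \<Rightarrow> (\<tau> d, \<tau> e) of (d, e) \<Rightarrow> (prime_perm \<sigma> d, prime_perm \<sigma> e)) = p"
      "(case p of (d, e) \<Rightarrow> (\<tau> d, \<tau> e)) \<in> {(d,e). d * e = n}"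
      using p \<tau> by auto
  qed
  then show ?thesis using n prime_perm_pos[OF n] by (simp add: coeff_mult)
qed

lemma prime_perm_eq_1_iff: "n \<ge> 1 \<Longrightarrow> prime_perm \<sigma> n = 1 \<longleftrightarrow> n = 1"
  using big_omega_prime_perm[of n] prime_perm_pos[of n] big_omega_eq_0_iff[of n]
    big_omega_eq_0_iff[of "prime_perm \<sigma> n"] by simp

end

definition symmetric :: "(nat \<Rightarrow> nat) set \<Rightarrow> fds \<Rightarrow> bool" where
  "symmetric G a \<longleftrightarrow> (\<forall>\<sigma>\<in>G. \<forall>n\<ge>1. coeff a (prime_perm \<sigma> n) = coeff a n)"

lemma symmetric_add: "symmetric G a \<Longrightarrow> symmetric G b \<Longrightarrow> symmetric G (a + b)"
  and symmetric_diff: "symmetric G a \<Longrightarrow> symmetric G b \<Longrightarrow> symmetric G (a - b)"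
  and symmetric_scale: "symmetric G a \<Longrightarrow> symmetric G (fconst c * a)"
  and symmetric_zero: "symmetric G 0"
  by (simp_all add: symmetric_def)

lemma symmetric_sums:
  assumes "\<And>k. symmetric G (f k)" "\<And>n. (\<lambda>k. coeff (f k) n) sums coeff b n"
  shows "symmetric G b"
  unfolding symmetric_def
proof (intro ballI allI impI)
  fix \<sigma> and n :: nat assume "\<sigma> \<in> G" "n \<ge> 1"
  then have "(\<lambda>k. coeff (f k) n) sums coeff b (prime_perm \<sigma> n)"
    using assms(1) assms(2)[of "prime_perm \<sigma> n"] by (simp add: symmetric_def)
  then show "coeff b (prime_perm \<sigma> n) = coeff b n" using assms(2) sums_unique2 by blast
qed

context
  fixes G :: "(nat \<Rightarrow> nat) set"
  assumes G: "\<And>\<sigma>. \<sigma> \<in> G \<Longrightarrow> bij_betw \<sigma> {1..} {1..}"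
begin

lemma symmetric_one: "symmetric G 1"
  using G prime_perm_eq_1_iff by (simp add: symmetric_def coeff_one)

lemma symmetric_mult: "symmetric G a \<Longrightarrow> symmetric G b \<Longrightarrow> symmetric G (a * b)"
  using G coeff_mult_prime_perm unfolding symmetric_def by blast

lemma symmetric_hom_part: "symmetric G a \<Longrightarrow> symmetric G (hom_part m a)"
  using G big_omega_prime_perm by (simp add: symmetric_def coeff_hom_part)

lemma symmetric_dilate: "symmetric G a \<Longrightarrow> symmetric G (dilate r a)"
  using G big_omega_prime_perm by (simp add: symmetric_def)

lemma graded_algebra_symmetric:
  assumes "graded_algebra bd" shows "graded_algebra (\<lambda>a C. bd a C \<and> symmetric G a)"
proof -
  interpret graded_algebra bd by fact
  show ?thesis
  proof
    fix n
    show "\<exists>K. \<forall>a C. bd a C \<and> symmetric G a \<longrightarrow> norm (coeff a n) \<le> K * C"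
      using bd_coeff by blast
  next
    fix f B assume "\<And>k. bd (f k) (B k) \<and> symmetric G (f k)" "summable B"
    then obtain b where "bd b (suminf B)" "\<forall>n. (\<lambda>k. coeff (f k) n) sums coeff b n"
      using bd_sums[of f B] by blast
    then show "\<exists>b. (bd b (suminf B) \<and> symmetric G b) \<and> (\<forall>n. (\<lambda>k. coeff (f k) n) sums coeff b n)"
      using symmetric_sums[of G f b] \<open>\<And>k. bd (f k) (B k) \<and> symmetric G (f k)\<close> by blast
  qed (auto intro: bd_zero bd_one bd_nonneg bd_mono bd_add bd_scale bd_mult bd_hom_part
        symmetric_zero symmetric_one symmetric_add symmetric_scale symmetric_mult symmetric_hom_part)
qed

lemma dilation_continuous_algebra_symmetric:
  assumes "dilation_continuous_algebra bd"
  shows "dilation_continuous_algebra (\<lambda>a C. bd a C \<and> symmetric G a)"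
proof -
  interpret dilation_continuous_algebra bd by fact
  interpret s: graded_algebra "\<lambda>a C. bd a C \<and> symmetric G a"
    by (rule graded_algebra_symmetric) unfold_locales
  show ?thesis
  proof
    fix a C and \<delta> :: real assume "bd a C \<and> symmetric G a" "\<delta> > 0"
    then show "\<exists>r0<1. \<forall>r. r0 < r \<and> r < 1 \<longrightarrow> bd (dilate r a - a) \<delta> \<and> symmetric G (dilate r a - a)"
      using dilate_tendsto[of a C \<delta>] symmetric_diff symmetric_dilate by blast
  qed
qed

end

section \<open>The norms of the three algebras\<close>

text \<open>Norm bounds in the sense of graded_algebra: bd_W for absolutely convergent series,
  bd_H for bounded functions in O_u, and bd_A for the closure of the former in the
  latter.\<close>

definition bd_W :: "fds \<Rightarrow> real \<Rightarrow> bool" where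
  "bd_W a C \<longleftrightarrow> (\<forall>N. (\<Sum>n=1..N. norm (coeff a n)) \<le> C)"

definition bd_H :: "fds \<Rightarrow> real \<Rightarrow> bool" where
  "bd_H a C \<longleftrightarrow> (\<exists>f. dirichlet_limit (coeff a) f \<and> (\<forall>s. Re s > 0 \<longrightarrow> norm (f s) \<le> C))"

definition bd_A :: "fds \<Rightarrow> real \<Rightarrow> bool" where
  "bd_A a C \<longleftrightarrow> bd_H a C \<and> (\<forall>\<epsilon>>0. \<exists>b D. bd_W b D \<and> bd_H (a - b) \<epsilon>)"

lemma bd_W_coeff: "bd_W a C \<Longrightarrow> n \<ge> 1 \<Longrightarrow> norm (coeff a n) \<le> C"
  using member_le_sum[of n "{1..n}" "\<lambda>n. norm (coeff a n)"] unfolding bd_W_def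
  by (fastforce intro: order_trans)

lemma bd_W_nonneg: "bd_W a C \<Longrightarrow> 0 \<le> C"
  unfolding bd_W_def by (drule spec[of _ 0]) simp

lemma bd_W_mult:
  assumes "bd_W a C" "bd_W b D" shows "bd_W (a * b) (C * D)"
  unfolding bd_W_def
proof
  fix N
  let ?g = "\<lambda>p. norm (coeff a (fst p)) * norm (coeff b (snd p))"
  have "(\<Sum>n=1..N. norm (coeff (a * b) n)) \<le> (\<Sum>n=1..N. \<Sum>p\<in>{(d,e). d * e = n}. ?g p)"
  proof (rule sum_mono)
    fix n assume "n \<in> {1..N}"
    then show "norm (coeff (a * b) n) \<le> (\<Sum>p\<in>{(d,e). d * e = n}. ?g p)"
      by (auto simp: coeff_mult case_prod_unfold norm_mult intro!: sum_norm_le)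
  qed
  also have "\<dots> = (\<Sum>p\<in>(\<Union>n\<in>{1..N}. {(d,e). d * e = n}). ?g p)"
    by (rule sum.UNION_disjoint[symmetric]) (auto intro: finite_factor_pairs)
  also have "\<dots> \<le> (\<Sum>p\<in>{1..N} \<times> {1..N}. ?g p)"
  proof (rule sum_mono2)
    show "(\<Union>n\<in>{1..N}. {(d,e). d * e = n}) \<subseteq> {1..N} \<times> {1..N}"
    proof
      fix p assume "p \<in> (\<Union>n\<in>{1..N}. {(d,e). d * e = n})"
      then obtain d e where p: "p = (d, e)" "1 \<le> d * e" "d * e \<le> N" by auto
      then have de: "d \<noteq> 0" "e \<noteq> 0" by auto
      then have "d \<le> d * e" "e \<le> d * e" by simp_all
      then have "d \<le> N" "e \<le> N" using p(3) by linarith+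
      then show "p \<in> {1..N} \<times> {1..N}" using p(1) de by auto
    qed
  qed auto
  also have "\<dots> = (\<Sum>n=1..N. norm (coeff a n)) * (\<Sum>n=1..N. norm (coeff b n))"
    by (simp add: sum_product sum.cartesian_product case_prod_unfold)
  also have "\<dots> \<le> C * D"
    using assms bd_W_nonneg[OF assms(1)] unfolding bd_W_def by (intro mult_mono) (auto intro: sum_nonneg)
  finally show "(\<Sum>n=1..N. norm (coeff (a * b) n)) \<le> C * D" .
qed

lemma bd_W_sums:
  assumes f: "\<And>k. bd_W (f k) (B k)" and B: "summable B"
  shows "\<exists>b. bd_W b (suminf B) \<and> (\<forall>n. (\<lambda>k. coeff (f k) n) sums coeff b n)"
proof -
  define b where "b = mk_fds (\<lambda>n. \<Sum>k. coeff (f k) n)"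
  have B0: "B k \<ge> 0" for k using bd_W_nonneg[OF f] .
  have sums: "(\<lambda>k. coeff (f k) n) sums coeff b n" for n
  proof (cases "n = 0")
    case False
    then have "summable (\<lambda>k. coeff (f k) n)"
      using bd_W_coeff[OF f, of n] by (intro summable_comparison_test'[OF B]) auto
    then show ?thesis using False by (simp add: b_def coeff_mk_fds summable_sums)
  qed simp
  have "bd_W b (suminf B)"
    unfolding bd_W_def
  proof
    fix N
    have "(\<lambda>K. \<Sum>n=1..N. norm (\<Sum>k<K. coeff (f k) n)) \<longlonglongrightarrow> (\<Sum>n=1..N. norm (coeff b n))"
      using sums unfolding sums_def by (intro tendsto_intros)
    then show "(\<Sum>n=1..N. norm (coeff b n)) \<le> suminf B"
    proof (rule LIMSEQ_le_const2, intro exI allI impI)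
      fix K
      have "(\<Sum>n=1..N. norm (\<Sum>k<K. coeff (f k) n)) \<le> (\<Sum>n=1..N. \<Sum>k<K. norm (coeff (f k) n))"
        by (intro sum_mono norm_sum)
      also have "\<dots> = (\<Sum>k<K. \<Sum>n=1..N. norm (coeff (f k) n))" by (rule sum.swap)
      also have "\<dots> \<le> (\<Sum>k<K. B k)" using f by (intro sum_mono) (auto simp: bd_W_def)
      also have "\<dots> \<le> suminf B" using B B0 by (intro sum_le_suminf) auto
      finally show "(\<Sum>n=1..N. norm (\<Sum>k<K. coeff (f k) n)) \<le> suminf B" .
    qed
  qed
  then show ?thesis using sums by blast
qed

interpretation W: graded_algebra bd_W
proof
  show "bd_W 0 0" by (simp add: bd_W_def)
  show "bd_W 1 1" by (simp add: bd_W_def coeff_one if_distrib[of norm] cong: if_cong)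
  show "0 \<le> C" if "bd_W a C" for a C using bd_W_nonneg[OF that] .
  show "bd_W a D" if "bd_W a C" "C \<le> D" for a C D
    using that unfolding bd_W_def by (blast intro: order_trans)
  show "bd_W (a + b) (C + D)" if "bd_W a C" "bd_W b D" for a b C D
    unfolding bd_W_def
  proof
    fix N
    have "(\<Sum>n=1..N. norm (coeff (a + b) n)) \<le> (\<Sum>n=1..N. norm (coeff a n)) + (\<Sum>n=1..N. norm (coeff b n))"
      unfolding sum.distrib[symmetric] by (intro sum_mono) (simp add: norm_triangle_ineq)
    also have "\<dots> \<le> C + D" using that by (intro add_mono) (auto simp: bd_W_def)
    finally show "(\<Sum>n=1..N. norm (coeff (a + b) n)) \<le> C + D" .
  qed
  show "bd_W (fconst c * a) (norm c * C)" if "bd_W a C" for a C c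
    using that by (auto simp: bd_W_def norm_mult sum_distrib_left[symmetric] intro: mult_left_mono)
  show "bd_W (a * b) (C * D)" if "bd_W a C" "bd_W b D" for a b C D using bd_W_mult[OF that] .
  show "bd_W (hom_part m a) C" if "bd_W a C" for a C m
    unfolding bd_W_def
  proof
    fix N
    have "(\<Sum>n=1..N. norm (coeff (hom_part m a) n)) \<le> (\<Sum>n=1..N. norm (coeff a n))"
      by (intro sum_mono) (simp add: coeff_hom_part)
    also have "\<dots> \<le> C" using that by (simp add: bd_W_def)
    finally show "(\<Sum>n=1..N. norm (coeff (hom_part m a) n)) \<le> C" .
  qed
  show "\<exists>K. \<forall>a C. bd_W a C \<longrightarrow> norm (coeff a n) \<le> K * C" for n
  proof (intro exI[of _ 1] allI impI)
    fix a C assume "bd_W a C"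
    then show "norm (coeff a n) \<le> 1 * C"
      using bd_W_coeff[of a C n] bd_W_nonneg[of a C] by (cases "n = 0") auto
  qed
  show "\<exists>b. bd_W b (suminf B) \<and> (\<forall>n. (\<lambda>k. coeff (f k) n) sums coeff b n)"
    if "\<And>k. bd_W (f k) (B k)" "summable B" for f B
    using bd_W_sums[OF that] .
qed

text \<open>Dominated convergence: the tail of the series is small uniformly in r, and the
  remaining finite sum is continuous in r.\<close>

interpretation W: dilation_continuous_algebra bd_W
proof
  fix a C and \<delta> :: real assume a: "bd_W a C" and \<delta>: "\<delta> > 0"
  have "summable (\<lambda>n. norm (coeff a n))"
  proof (rule summableI_nonneg_bounded)
    show "(\<Sum>n<N. norm (coeff a n)) \<le> C" for N
    proof -
      have "(\<Sum>n<N. norm (coeff a n)) \<le> (\<Sum>n=1..N. norm (coeff a n))"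
      proof (cases N)
        case (Suc M)
        have "(\<Sum>n<N. norm (coeff a n)) = (\<Sum>n=1..<N. norm (coeff a n))"
          by (rule sum.mono_neutral_right) (auto simp: not_le)
        also have "\<dots> \<le> (\<Sum>n=1..N. norm (coeff a n))" by (intro sum_mono2) auto
        finally show ?thesis .
      qed simp
      also have "\<dots> \<le> C" using a by (simp add: bd_W_def)
      finally show ?thesis .
    qed
  qed simp
  then obtain N where N: "\<And>m n. m \<ge> N \<Longrightarrow> norm (\<Sum>k=m..<n. norm (coeff a k)) < \<delta> / 2"
    unfolding summable_Cauchy using \<delta> by (metis half_gt_zero)
  have "((\<lambda>r. \<Sum>n<N. (1 - r ^ big_omega n) * norm (coeff a n)) \<longlongrightarrow> (\<Sum>n<N. (1 - 1 ^ big_omega n) * norm (coeff a n))) (at_left 1)"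
    by (intro tendsto_intros)
  then have "\<forall>\<^sub>F r in at_left (1::real). (\<Sum>n<N. (1 - r ^ big_omega n) * norm (coeff a n)) < \<delta> / 2"
    using \<delta> by (intro order_tendstoD(2)) auto
  then obtain r1 where r1: "r1 < 1" "\<And>r. r1 < r \<Longrightarrow> r < 1 \<Longrightarrow> (\<Sum>n<N. (1 - r ^ big_omega n) * norm (coeff a n)) < \<delta> / 2"
    unfolding eventually_at_left_field by blast
  show "\<exists>r0<1. \<forall>r. r0 < r \<and> r < 1 \<longrightarrow> bd_W (dilate r a - a) \<delta>"
  proof (intro exI[of _ "max 0 r1"] conjI allI impI)
    fix r assume r: "max 0 r1 < r \<and> r < 1"
    have le: "norm (coeff (dilate r a - a) n) = (1 - r ^ big_omega n) * norm (coeff a n)" for n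
    proof -
      have "coeff (dilate r a - a) n = of_real (r ^ big_omega n - 1) * coeff a n"
        by (simp add: algebra_simps)
      then have "norm (coeff (dilate r a - a) n) = \<bar>r ^ big_omega n - 1\<bar> * norm (coeff a n)"
        by (simp only: norm_mult norm_of_real)
      moreover have "r ^ big_omega n \<le> 1" using r by (intro power_le_one) auto
      ultimately show ?thesis by simp
    qed
    show "bd_W (dilate r a - a) \<delta>"
      unfolding bd_W_def
    proof
      fix M
      have "(\<Sum>n=1..M. norm (coeff (dilate r a - a) n)) \<le> (\<Sum>n\<in>{..<N} \<union> {N..<Suc M}. norm (coeff (dilate r a - a) n))"
        by (intro sum_mono2) auto
      also have "\<dots> = (\<Sum>n<N. norm (coeff (dilate r a - a) n)) + (\<Sum>n=N..<Suc M. norm (coeff (dilate r a - a) n))"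
        by (intro sum.union_disjoint) auto
      also have "(\<Sum>n<N. norm (coeff (dilate r a - a) n)) \<le> \<delta> / 2"
        unfolding le using r1(2)[of r] r by simp
      also have "(\<Sum>n=N..<Suc M. norm (coeff (dilate r a - a) n)) \<le> (\<Sum>n=N..<Suc M. norm (coeff a n))"
        unfolding le using r by (intro sum_mono mult_left_le_one_le) (auto intro: power_le_one)
      also have "\<dots> \<le> \<delta> / 2" using N[of N "Suc M"] by simp
      finally show "(\<Sum>n=1..M. norm (coeff (dilate r a - a) n)) \<le> \<delta>" by simp
    qed
  qed (use r1 in auto)
qed

lemma bd_W_imp_bd_H: "bd_W a C \<Longrightarrow> bd_H a C"
  unfolding bd_W_def bd_H_def using dirichlet_limit_absolutely_summable[of "coeff a" C] by metis

lemma bd_H_contractive: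
  assumes "contractive w" "bd_H a C" shows "bd_H (mk_fds (\<lambda>n. w n * coeff a n)) C"
proof -
  obtain f where f: "dirichlet_limit (coeff a) f" "\<And>s. Re s > 0 \<Longrightarrow> norm (f s) \<le> C"
    using assms(2) by (auto simp: bd_H_def)
  obtain g where g: "dirichlet_limit (\<lambda>n. w n * coeff a n) g" "\<And>s. Re s > 0 \<Longrightarrow> norm (g s) \<le> C"
    using dirichlet_limit_contractive[OF assms(1) f(1)] f(2) by metis
  have "dirichlet_limit (coeff (mk_fds (\<lambda>n. w n * coeff a n))) g"
    by (rule dirichlet_limit_cong[THEN iffD1, OF _ g(1)]) (simp add: coeff_mk_fds)
  then show ?thesis using g(2) by (auto simp: bd_H_def)
qed

lemma bd_H_hom_part: assumes "bd_H a C" shows "bd_H (hom_part m a) C"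
proof -
  have "hom_part m a = mk_fds (\<lambda>n. (if big_omega n = m then 1 else 0) * coeff a n)"
    by (rule fds_eqI) (simp add: coeff_hom_part coeff_mk_fds)
  then show ?thesis using bd_H_contractive[OF contractive_hom_part assms] by simp
qed

lemma bd_H_dilate: assumes "bd_H a C" "0 \<le> r" "r \<le> 1" shows "bd_H (dilate r a) C"
proof -
  have "dilate r a = mk_fds (\<lambda>n. cmult (\<lambda>_. of_real r) n * coeff a n)"
    by (rule fds_eqI) (simp add: coeff_mk_fds cmult_const)
  then show ?thesis using bd_H_contractive[OF contractive_cmult assms(1), of "\<lambda>_. of_real r"] assms by simp
qed

lemma bd_H_coeff: "\<exists>K. \<forall>a C. bd_H a C \<longrightarrow> norm (coeff a n) \<le> K * C"
proof (cases "n = 0")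
  case False
  then obtain K where "\<forall>a f C. dirichlet_limit a f \<longrightarrow> (\<forall>s. Re s > 0 \<longrightarrow> norm (f s) \<le> C) \<longrightarrow> norm (a n) \<le> K * C"
    using dirichlet_coeff_bound[of n] by auto
  then show ?thesis unfolding bd_H_def by blast
qed (auto intro!: exI[of _ 0])

lemma bd_H_nonneg: "bd_H a C \<Longrightarrow> 0 \<le> C"
  unfolding bd_H_def by (metis norm_ge_zero one_complex.sel(1) order_trans zero_less_one)

text \<open>The partial sums of the functions converge uniformly by the Weierstrass test, and
  the limit is a Dirichlet series by dirichlet_limit_closed.\<close>

lemma bd_H_sums:
  assumes f: "\<And>k. bd_H (f k) (B k)" and B: "summable B"
  shows "\<exists>b. bd_H b (suminf B) \<and> (\<forall>n. (\<lambda>k. coeff (f k) n) sums coeff b n)"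
proof -
  define b where "b = mk_fds (\<lambda>n. \<Sum>k. coeff (f k) n)"
  have sums: "(\<lambda>k. coeff (f k) n) sums coeff b n" for n
  proof (cases "n = 0")
    case False
    obtain K where "\<And>a C. bd_H a C \<Longrightarrow> norm (coeff a n) \<le> K * C" using bd_H_coeff by blast
    then have "summable (\<lambda>k. coeff (f k) n)"
      using f by (intro summable_comparison_test'[OF summable_mult[OF B, of K]]) auto
    then show ?thesis using False by (simp add: b_def coeff_mk_fds summable_sums)
  qed simp
  have "\<exists>F. \<forall>k. dirichlet_limit (coeff (f k)) (F k) \<and> (\<forall>s. Re s > 0 \<longrightarrow> norm (F k s) \<le> B k)"
    using f unfolding bd_H_def by (intro choice) blast
  then obtain F where F: "\<And>k. dirichlet_limit (coeff (f k)) (F k)"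
      "\<And>k s. Re s > 0 \<Longrightarrow> norm (F k s) \<le> B k" by blast
  have part: "dirichlet_limit (coeff (\<Sum>k<m. f k)) (\<lambda>s\<in>RHP. \<Sum>k<m. F k s)" for m
  proof (induction m)
    case 0
    have "dpoly (coeff 0) 0 s = 0" for s by (simp add: dpoly_def)
    then show ?case
      using dirichlet_limit_finite[of 0 "coeff 0", OF coeff_zero] by (simp only: lessThan_0 sum.empty)
  next
    case (Suc m)
    have "dirichlet_limit (\<lambda>n. coeff (\<Sum>k<m. f k) n + coeff (f m) n)
       (\<lambda>s\<in>RHP. (\<lambda>s\<in>RHP. \<Sum>k<m. F k s) s + F m s)"
      by (rule dirichlet_limit_add[OF Suc F(1)])
    also have "(\<lambda>n. coeff (\<Sum>k<m. f k) n + coeff (f m) n) = coeff (\<Sum>k<Suc m. f k)"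
      by (simp add: fun_eq_iff)
    also have "(\<lambda>s\<in>RHP. (\<lambda>s\<in>RHP. \<Sum>k<m. F k s) s + F m s)
       = (\<lambda>s\<in>RHP. \<Sum>k<Suc m. F k s)" by (intro restrict_ext) simp
    finally show ?case .
  qed
  have "dirichlet_limit (coeff b) (\<lambda>s\<in>RHP. \<Sum>k. F k s)"
  proof (rule dirichlet_limit_closed[OF part])
    show "(\<lambda>m. coeff (\<Sum>k<m. f k) n) \<longlonglongrightarrow> coeff b n" for n
      using sums[of n] by (simp add: sums_def)
    fix \<epsilon> :: real assume \<epsilon>: "\<epsilon> > 0"
    have "uniform_limit {s. Re s > \<epsilon>} (\<lambda>m s. \<Sum>k<m. F k s) (\<lambda>s. \<Sum>k. F k s) sequentially"
      by (rule Weierstrass_m_test[OF _ B]) (use F(2) \<epsilon> in auto)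
    then show "uniform_limit {s. Re s > \<epsilon>} (\<lambda>m. \<lambda>s\<in>RHP. \<Sum>k<m. F k s) (\<lambda>s. \<Sum>k. F k s) sequentially"
      by (rule uniform_limit_cong'[THEN iffD1, rotated -1]) (use \<epsilon> in \<open>auto simp: right_half_plane_def\<close>)
  qed
  moreover have "norm ((\<lambda>s\<in>RHP. \<Sum>k. F k s) s) \<le> suminf B" if "Re s > 0" for s
  proof -
    have s: "summable (\<lambda>k. norm (F k s))"
      by (rule summable_comparison_test'[OF B]) (use F(2)[OF that] in auto)
    have "norm (\<Sum>k. F k s) \<le> (\<Sum>k. norm (F k s))" by (rule summable_norm[OF s])
    also have "\<dots> \<le> suminf B" by (rule suminf_le[OF _ s B]) (use F(2)[OF that] in auto)
    finally show ?thesis using that by (simp add: right_half_plane_def)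
  qed
  ultimately have "bd_H b (suminf B)" unfolding bd_H_def by blast
  then show ?thesis using sums by blast
qed

interpretation H: graded_algebra bd_H
proof
  show "bd_H 0 0" by (rule bd_W_imp_bd_H[OF W.bd_zero])
  show "bd_H 1 1" by (rule bd_W_imp_bd_H[OF W.bd_one])
  show "0 \<le> C" if "bd_H a C" for a C using bd_H_nonneg[OF that] .
  show "bd_H a D" if "bd_H a C" "C \<le> D" for a C D
    using that unfolding bd_H_def by (blast intro: order_trans)
  show "bd_H (a + b) (C + D)" if ab: "bd_H a C" "bd_H b D" for a b C D
  proof -
    obtain f g where f: "dirichlet_limit (coeff a) f" "\<And>s. Re s > 0 \<Longrightarrow> norm (f s) \<le> C"
      and g: "dirichlet_limit (coeff b) g" "\<And>s. Re s > 0 \<Longrightarrow> norm (g s) \<le> D"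
      using ab by (auto simp: bd_H_def)
    have "norm (f s + g s) \<le> C + D" if "Re s > 0" for s
      using norm_triangle_ineq[of "f s" "g s"] f(2)[OF that] g(2)[OF that] by linarith
    moreover have "coeff (a + b) = (\<lambda>n. coeff a n + coeff b n)" by (simp add: fun_eq_iff)
    ultimately show ?thesis using dirichlet_limit_add[OF f(1) g(1)]
      unfolding bd_H_def right_half_plane_def by (intro exI conjI) auto
  qed
  show "bd_H (fconst c * a) (norm c * C)" if a: "bd_H a C" for a C c
  proof -
    obtain f where f: "dirichlet_limit (coeff a) f" "\<And>s. Re s > 0 \<Longrightarrow> norm (f s) \<le> C"
      using a by (auto simp: bd_H_def)
    have "norm (c * f s) \<le> norm c * C" if "Re s > 0" for s
      using f(2)[OF that] by (simp add: norm_mult mult_left_mono)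
    moreover have "coeff (fconst c * a) = (\<lambda>n. c * coeff a n)" by (simp add: fun_eq_iff)
    ultimately show ?thesis using dirichlet_limit_scale[OF f(1), of c]
      unfolding bd_H_def right_half_plane_def by (intro exI conjI) auto
  qed
  show "bd_H (a * b) (C * D)" if ab: "bd_H a C" "bd_H b D" for a b C D
  proof -
    obtain f g where f: "dirichlet_limit (coeff a) f" "\<And>s. Re s > 0 \<Longrightarrow> norm (f s) \<le> C"
      and g: "dirichlet_limit (coeff b) g" "\<And>s. Re s > 0 \<Longrightarrow> norm (g s) \<le> D"
      using ab by (auto simp: bd_H_def)
    have "norm (f s * g s) \<le> C * D" if "Re s > 0" for s
      unfolding norm_mult using f(2)[OF that] g(2)[OF that] bd_H_nonneg[OF ab(1)] by (intro mult_mono) auto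
    then show ?thesis using dirichlet_limit_mult[OF f(1) g(1)]
      unfolding bd_H_def right_half_plane_def by (intro exI conjI) auto
  qed
qed (use bd_H_hom_part bd_H_coeff bd_H_sums in blast)+

lemma bd_AI:
  assumes "bd_H a C" "\<And>\<epsilon>. \<epsilon> > 0 \<Longrightarrow> \<exists>b D. bd_W b D \<and> bd_H (a - b) \<epsilon>" shows "bd_A a C"
  using assms by (simp add: bd_A_def)

lemma bd_W_imp_bd_A: assumes "bd_W a C" shows "bd_A a C"
proof (rule bd_AI)
  show "\<exists>b D. bd_W b D \<and> bd_H (a - b) \<epsilon>" if "\<epsilon> > 0" for \<epsilon>
    using assms H.bd_mono[OF H.bd_zero, of \<epsilon>] that by (intro exI[of _ a] exI[of _ C]) simp
qed (rule bd_W_imp_bd_H[OF assms])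

lemma bd_A_add: assumes "bd_A a C" "bd_A b D" shows "bd_A (a + b) (C + D)"
proof (rule bd_AI)
  show "bd_H (a + b) (C + D)" using assms by (auto simp: bd_A_def intro: H.bd_add)
  fix \<epsilon> :: real assume "\<epsilon> > 0"
  then obtain a' C' b' D' where "bd_W a' C'" "bd_H (a - a') (\<epsilon> / 2)" "bd_W b' D'" "bd_H (b - b') (\<epsilon> / 2)"
    using assms unfolding bd_A_def by (meson half_gt_zero)
  moreover have "a + b - (a' + b') = (a - a') + (b - b')" by simp
  ultimately show "\<exists>c D. bd_W c D \<and> bd_H (a + b - c) \<epsilon>"
    using W.bd_add[of a' C' b' D'] H.bd_add[of "a - a'" "\<epsilon> / 2" "b - b'" "\<epsilon> / 2"] by (metis field_sum_of_halves)
qed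

lemma bd_A_mult: assumes "bd_A a C" "bd_A b D" shows "bd_A (a * b) (C * D)"
proof (rule bd_AI)
  have ab: "bd_H a C" "bd_H b D" using assms by (auto simp: bd_A_def)
  show "bd_H (a * b) (C * D)" by (rule H.bd_mult[OF ab])
  fix \<epsilon> :: real assume \<epsilon>: "\<epsilon> > 0"
  have D: "D \<ge> 0" using bd_H_nonneg[OF ab(2)] .
  define \<epsilon>1 where "\<epsilon>1 = \<epsilon> / (2 * (D + 1))"
  have \<epsilon>1: "\<epsilon>1 > 0" "\<epsilon>1 * D \<le> \<epsilon> / 2"
    using \<epsilon> D by (auto simp: \<epsilon>1_def field_simps)
  obtain a' C' where a': "bd_W a' C'" "bd_H (a - a') \<epsilon>1" using assms(1) \<epsilon>1(1) unfolding bd_A_def by blast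
  have C': "C' \<ge> 0" using bd_W_nonneg[OF a'(1)] .
  define \<epsilon>2 where "\<epsilon>2 = \<epsilon> / (2 * (C' + 1))"
  have \<epsilon>2: "\<epsilon>2 > 0" "C' * \<epsilon>2 \<le> \<epsilon> / 2"
    using \<epsilon> C' by (auto simp: \<epsilon>2_def field_simps)
  obtain b' D' where b': "bd_W b' D'" "bd_H (b - b') \<epsilon>2" using assms(2) \<epsilon>2(1) unfolding bd_A_def by blast
  have "a * b - a' * b' = (a - a') * b + a' * (b - b')" by (simp add: algebra_simps)
  moreover have "bd_H ((a - a') * b + a' * (b - b')) (\<epsilon>1 * D + C' * \<epsilon>2)"
    by (intro H.bd_add H.bd_mult a'(2) b'(2) ab(2) bd_W_imp_bd_H[OF a'(1)])
  ultimately have "bd_H (a * b - a' * b') \<epsilon>"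
    using H.bd_mono[of "(a - a') * b + a' * (b - b')" "\<epsilon>1 * D + C' * \<epsilon>2" \<epsilon>] \<epsilon>1 \<epsilon>2 by simp
  then show "\<exists>c D. bd_W c D \<and> bd_H (a * b - c) \<epsilon>" using bd_W_mult[OF a'(1) b'(1)] by blast
qed

lemma bd_A_sum: "(\<And>i. i \<in> I \<Longrightarrow> bd_A (f i) (B i)) \<Longrightarrow> bd_A (sum f I) (sum B I)"
  by (induction I rule: infinite_finite_induct)
     (auto intro: bd_A_add bd_W_imp_bd_A W.bd_zero)

interpretation A: graded_algebra bd_A
proof
  show "bd_A 0 0" by (rule bd_W_imp_bd_A[OF W.bd_zero])
  show "bd_A 1 1" by (rule bd_W_imp_bd_A[OF W.bd_one])
  show "0 \<le> C" if "bd_A a C" for a C using bd_H_nonneg[of a C] that by (simp add: bd_A_def)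
  show "bd_A a D" if "bd_A a C" "C \<le> D" for a C D
    using that H.bd_mono by (auto simp: bd_A_def)
  show "bd_A (a + b) (C + D)" if "bd_A a C" "bd_A b D" for a b C D using bd_A_add[OF that] .
  show "bd_A (a * b) (C * D)" if "bd_A a C" "bd_A b D" for a b C D using bd_A_mult[OF that] .
  show "bd_A (fconst c * a) (norm c * C)" if "bd_A a C" for a C c
    using bd_A_mult[OF bd_W_imp_bd_A[OF W.bd_fconst] that] .
  show "bd_A (hom_part m a) C" if a: "bd_A a C" for a C m
  proof (rule bd_AI)
    show "bd_H (hom_part m a) C" using a by (simp add: bd_A_def bd_H_hom_part)
    fix \<epsilon> :: real assume "\<epsilon> > 0"
    then obtain b D where "bd_W b D" "bd_H (a - b) \<epsilon>" using a by (auto simp: bd_A_def)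
    then show "\<exists>b D. bd_W b D \<and> bd_H (hom_part m a - b) \<epsilon>"
      using W.bd_hom_part[of b D m] bd_H_hom_part[of "a - b" \<epsilon> m] by (auto simp: hom_part_diff)
  qed
  show "\<exists>K. \<forall>a C. bd_A a C \<longrightarrow> norm (coeff a n) \<le> K * C" for n
    using bd_H_coeff unfolding bd_A_def by blast
  show "\<exists>b. bd_A b (suminf B) \<and> (\<forall>n. (\<lambda>k. coeff (f k) n) sums coeff b n)"
    if f: "\<And>k. bd_A (f k) (B k)" and B: "summable B" for f B
  proof -
    have fH: "bd_H (f k) (B k)" for k using f by (simp add: bd_A_def)
    obtain b where b: "bd_H b (suminf B)" "\<And>n. (\<lambda>k. coeff (f k) n) sums coeff b n"
      using bd_H_sums[OF fH B] by blast
    have "bd_A b (suminf B)"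
    proof (rule bd_AI[OF b(1)])
      fix \<epsilon> :: real assume \<epsilon>: "\<epsilon> > 0"
      then have "\<epsilon> / 2 > 0" by simp
      then obtain m where m: "\<bar>\<Sum>k. B (k + m)\<bar> < \<epsilon> / 2"
        using suminf_exist_split[OF _ B, of "\<epsilon> / 2"] by (auto simp: add.commute)
      obtain t where t: "bd_H t (\<Sum>k. B (k + m))" "\<And>n. (\<lambda>k. coeff (f (k + m)) n) sums coeff t n"
        using bd_H_sums[of "\<lambda>k. f (k + m)" "\<lambda>k. B (k + m)"] fH B by auto
      have bt: "b = t + (\<Sum>k<m. f k)"
      proof (rule fds_eqI)
        fix n
        have "(\<lambda>k. coeff (f k) n) sums (coeff t n + (\<Sum>k<m. coeff (f k) n))"
          using t(2)[of n] sums_iff_shift[of "\<lambda>k. coeff (f k) n" m "coeff t n"] by blast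
        then show "coeff b n = coeff (t + (\<Sum>k<m. f k)) n"
          using b(2)[of n] sums_unique2 by fastforce
      qed
      have "bd_A (\<Sum>k<m. f k) (\<Sum>k<m. B k)" by (intro bd_A_sum f)
      then obtain c D where c: "bd_W c D" "bd_H ((\<Sum>k<m. f k) - c) (\<epsilon> / 2)"
        using \<open>\<epsilon> / 2 > 0\<close> unfolding bd_A_def by blast
      have "bd_H t (\<epsilon> / 2)" using H.bd_mono[OF t(1)] m by auto
      from H.bd_add[OF this c(2)] have "bd_H (b - c) \<epsilon>" by (simp add: bt algebra_simps)
      then show "\<exists>c D. bd_W c D \<and> bd_H (b - c) \<epsilon>" using c(1) by blast
    qed
    then show ?thesis using b(2) by blast
  qed
qed

text \<open>Dilations are contractions in the supremum norm and tend strongly to the identity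
  on the dense subalgebra of absolutely convergent series, hence on its closure.\<close>

interpretation A: dilation_continuous_algebra bd_A
proof
  fix a C and \<delta> :: real assume a: "bd_A a C" and \<delta>: "\<delta> > 0"
  have "\<delta> / 4 > 0" using \<delta> by simp
  then obtain b D where b: "bd_W b D" "bd_H (a - b) (\<delta> / 4)" using a unfolding bd_A_def by blast
  obtain r0 where r0: "r0 < 1" "\<And>r. r0 < r \<Longrightarrow> r < 1 \<Longrightarrow> bd_W (dilate r b - b) (\<delta> / 2)"
    using W.dilate_tendsto[OF b(1), of "\<delta> / 2"] \<delta> by auto
  \<comment> \<open>Membership in the algebra for a single r; smallness of the difference is
    shown separately.\<close>
  have dilA: "bd_A (dilate r a) C" if r: "0 < r" "r < 1" for r
  proof (rule bd_AI)
    show "bd_H (dilate r a) C" using a r by (auto simp: bd_A_def intro: bd_H_dilate)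
    fix \<epsilon> :: real assume "\<epsilon> > 0"
    then obtain b D where b: "bd_W b D" "bd_H (a - b) \<epsilon>" using a by (auto simp: bd_A_def)
    obtain D' where "bd_W (dilate r b) D'"
      using W.bd_dilate_tame[OF W.tame_bd[OF b(1)] r] by blast
    moreover have "bd_H (dilate r a - dilate r b) \<epsilon>"
      using bd_H_dilate[OF b(2), of r] r by (simp add: dilate_diff)
    ultimately show "\<exists>b D. bd_W b D \<and> bd_H (dilate r a - b) \<epsilon>" by blast
  qed
  show "\<exists>r0<1. \<forall>r. r0 < r \<and> r < 1 \<longrightarrow> bd_A (dilate r a - a) \<delta>"
  proof (intro exI[of _ "max 0 r0"] conjI allI impI)
    fix r assume r: "max 0 r0 < r \<and> r < 1"
    have eq: "dilate r a - a = dilate r (a - b) + (dilate r b - b) - (a - b)"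
      by (simp add: dilate_diff)
    have "bd_H (dilate r (a - b) + (dilate r b - b) - (a - b)) (\<delta> / 4 + \<delta> / 2 + \<delta> / 4)"
      using r by (intro H.bd_diff H.bd_add bd_H_dilate b(2) bd_W_imp_bd_H[OF r0(2)]) auto
    then have "bd_H (dilate r a - a) \<delta>" unfolding eq by simp
    moreover have "bd_A (dilate r a - a) (C + C)"
      using r by (intro A.bd_diff a dilA) auto
    ultimately show "bd_A (dilate r a - a) \<delta>" unfolding bd_A_def by blast
  qed (use r0 in auto)
qed

section \<open>Projective freeness of the algebras of Dirichlet series\<close>

lemma dirichlet_limit_coeff_inj:
  "dirichlet_limit (coeff a) f \<Longrightarrow> dirichlet_limit (coeff b) f \<Longrightarrow> a = b"
  by (rule fds_eqI) (rule dirichlet_limit_unique_coeff)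

lemma dirichlet_limit_mk_fds: "dirichlet_limit (coeff (mk_fds a)) f = dirichlet_limit a f"
  by (rule dirichlet_limit_cong) (simp add: coeff_mk_fds)

lemma dirichlet_limit_fconst: "dirichlet_limit (coeff (fconst c)) (\<lambda>s\<in>RHP. c)"
  using dirichlet_limit_finite[of 1 "coeff (fconst c)"] by (simp add: coeff_fconst dpoly_def)

lemma dirichlet_limit_add_fds:
  "dirichlet_limit (coeff a) f \<Longrightarrow> dirichlet_limit (coeff b) g \<Longrightarrow>
     dirichlet_limit (coeff (a + b)) (\<lambda>s\<in>RHP. f s + g s)"
  using dirichlet_limit_add[of "coeff a" f "coeff b" g] by (simp add: plus_fds_def dirichlet_limit_mk_fds)

lemma dirichlet_limit_diff_fds:
  "dirichlet_limit (coeff a) f \<Longrightarrow> dirichlet_limit (coeff b) g \<Longrightarrow>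
     dirichlet_limit (coeff (a - b)) (\<lambda>s\<in>RHP. f s - g s)"
  using dirichlet_limit_diff[of "coeff a" f "coeff b" g] by (simp add: minus_fds_def dirichlet_limit_mk_fds)

lemma dirichlet_limit_sum_mult:
  assumes "\<And>l. l < n \<Longrightarrow> dirichlet_limit (coeff (A l)) (f l)"
    and "\<And>l. l < n \<Longrightarrow> dirichlet_limit (coeff (B l)) (g l)"
  shows "dirichlet_limit (coeff (\<Sum>l<(n::nat). A l * B l)) (\<lambda>s\<in>RHP. \<Sum>l<n. f l s * g l s)"
  using assms
proof (induction n)
  case 0
  have "fconst 0 = 0" by (rule fds_eqI) (simp add: coeff_fconst)
  then show ?case using dirichlet_limit_fconst[of 0] by (simp only: lessThan_0 sum.empty)
next
  case (Suc n)
  have "dirichlet_limit (coeff ((\<Sum>l<n. A l * B l) + A n * B n))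
     (\<lambda>s\<in>RHP. (\<lambda>s\<in>RHP. \<Sum>l<n. f l s * g l s) s + (\<lambda>s\<in>RHP. f n s * g n s) s)"
    by (intro dirichlet_limit_add_fds dirichlet_limit_mult Suc.IH Suc.prems) auto
  also have "(\<lambda>s\<in>RHP. (\<lambda>s\<in>RHP. \<Sum>l<n. f l s * g l s) s + (\<lambda>s\<in>RHP. f n s * g n s) s)
     = (\<lambda>s\<in>RHP. \<Sum>l<Suc n. f l s * g l s)" by (intro restrict_ext) simp
  finally show ?case by (simp only: sum.lessThan_Suc)
qed

text \<open>Since a function and its coefficients determine each other and products of
  functions correspond to Dirichlet convolutions, idempotent matrices and their factorizations
  may be transferred between functions and formal series.\<close>

theorem projective_free_coefficient_algebra:
  assumes lim: "\<And>a. B a \<Longrightarrow> \<exists>f. dirichlet_limit (coeff a) f"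
    and const: "\<And>c. B (fconst c)"
    and add: "\<And>a b. B a \<Longrightarrow> B b \<Longrightarrow> B (a + b)"
    and mult: "\<And>a b. B a \<Longrightarrow> B b \<Longrightarrow> B (a * b)"
    and factor: "\<And>n E. mmul n E E = E \<Longrightarrow> (\<And>i j. \<not> (i < n \<and> j < n) \<Longrightarrow> E i j = 0) \<Longrightarrow>
        (\<And>i j. i < n \<Longrightarrow> j < n \<Longrightarrow> B (E i j)) \<Longrightarrow>
        \<exists>k X Y. (\<forall>i<n. \<forall>j<n. mmul k X Y i j = E i j)
          \<and> (\<forall>i<k. \<forall>j<k. mmul n Y X i j = (if i = j then 1 else 0))
          \<and> (\<forall>i<n. \<forall>j<k. B (X i j)) \<and> (\<forall>j<k. \<forall>i<n. B (Y j i))"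
  shows "projective_free TYPE('m) (function_ring {f. \<exists>a. B a \<and> dirichlet_limit (coeff a) f})"
proof -
  define X where "X = {f. \<exists>a. B a \<and> dirichlet_limit (coeff a) f}"
  have X: "f \<in> X \<longleftrightarrow> (\<exists>a. B a \<and> dirichlet_limit (coeff a) f)" for f by (simp add: X_def)
  interpret function_algebra X
  proof
    show "X \<subseteq> extensional RHP" by (auto simp: X dirichlet_limit_iff)
    show "(\<lambda>s\<in>RHP. c) \<in> X" for c using const dirichlet_limit_fconst X by blast
    show "(\<lambda>s\<in>RHP. f s + g s) \<in> X" if "f \<in> X" "g \<in> X" for f g
      using that add dirichlet_limit_add_fds unfolding X by blast
    show "(\<lambda>s\<in>RHP. f s * g s) \<in> X" if "f \<in> X" "g \<in> X" for f g
      using that mult dirichlet_limit_mult unfolding X by blast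
  qed
  have "projective_free TYPE('m) (function_ring X)"
  proof (rule projective_free_if_idempotents_factor)
    fix n :: nat and e :: "nat \<Rightarrow> nat \<Rightarrow> complex \<Rightarrow> complex"
    assume eX: "\<And>i j. i < n \<Longrightarrow> j < n \<Longrightarrow> e i j \<in> X"
      and idem: "\<And>i j z. i < n \<Longrightarrow> j < n \<Longrightarrow> z \<in> RHP \<Longrightarrow> (\<Sum>l<n. e i l z * e l j z) = e i j z"
    have "\<exists>a. i < n \<and> j < n \<longrightarrow> B a \<and> dirichlet_limit (coeff a) (e i j)" for i j
      using eX[of i j] by (auto simp: X)
    then obtain E' where E': "\<And>i j. i < n \<Longrightarrow> j < n \<Longrightarrow> B (E' i j) \<and> dirichlet_limit (coeff (E' i j)) (e i j)"
      by metis
    define E where "E i j = (if i < n \<and> j < n then E' i j else 0)" for i j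
    have E: "B (E i j)" "dirichlet_limit (coeff (E i j)) (e i j)" if "i < n" "j < n" for i j
      using E'[OF that] that by (auto simp: E_def)
    have EE: "mmul n E E = E"
    proof (intro ext)
      fix i j
      show "mmul n E E i j = E i j"
      proof (cases "i < n \<and> j < n")
        case True
        have "dirichlet_limit (coeff (mmul n E E i j)) (\<lambda>s\<in>RHP. \<Sum>l<n. e i l s * e l j s)"
          unfolding mmul_def using True E by (intro dirichlet_limit_sum_mult) auto
        also have "(\<lambda>s\<in>RHP. \<Sum>l<n. e i l s * e l j s) = e i j"
          using idem[of i j] outside[OF eX[of i j]] True by (auto simp: fun_eq_iff)
        finally show ?thesis using E(2)[of i j] True dirichlet_limit_coeff_inj by blast
      next
        case False
        then show ?thesis by (auto simp: mmul_def E_def intro!: sum.neutral)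
      qed
    qed
    have E0: "E i j = 0" if "\<not> (i < n \<and> j < n)" for i j using that by (auto simp: E_def)
    have "\<exists>k P Q. (\<forall>i<n. \<forall>j<n. mmul k P Q i j = E i j)
          \<and> (\<forall>i<k. \<forall>j<k. mmul n Q P i j = (if i = j then 1 else 0))
          \<and> (\<forall>i<n. \<forall>j<k. B (P i j)) \<and> (\<forall>j<k. \<forall>i<n. B (Q j i))"
      by (rule factor[OF EE]) (use E0 E(1) in auto)
    then obtain k P Q where PQ: "\<forall>i<n. \<forall>j<n. mmul k P Q i j = E i j"
        "\<forall>i<k. \<forall>j<k. mmul n Q P i j = (if i = j then 1 else 0)"
        "\<forall>i<n. \<forall>j<k. B (P i j)" "\<forall>j<k. \<forall>i<n. B (Q j i)"
      by (elim exE conjE) (rule that)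
    define x where "x i a = (SOME f. dirichlet_limit (coeff (P i a)) f)" for i a
    define y where "y a i = (SOME f. dirichlet_limit (coeff (Q a i)) f)" for a i
    have x: "dirichlet_limit (coeff (P i a)) (x i a)" if "i < n" "a < k" for i a
      unfolding x_def by (rule someI_ex[OF lim]) (use PQ(3) that in simp)
    have y: "dirichlet_limit (coeff (Q a i)) (y a i)" if "i < n" "a < k" for i a
      unfolding y_def by (rule someI_ex[OF lim]) (use PQ(4) that in simp)
    have xy: "(\<Sum>a<k. x i a z * y a j z) = e i j z" if "z \<in> RHP" "i < n" "j < n" for z i j
    proof -
      have "dirichlet_limit (coeff (mmul k P Q i j)) (\<lambda>s\<in>RHP. \<Sum>a<k. x i a s * y a j s)"
        unfolding mmul_def using that x y by (intro dirichlet_limit_sum_mult) auto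
      then have "dirichlet_limit (coeff (E i j)) (\<lambda>s\<in>RHP. \<Sum>a<k. x i a s * y a j s)"
        using PQ(1) that by simp
      from dirichlet_limit_unique_fun[OF this E(2)[OF that(2,3)]]
      have "(\<lambda>s\<in>RHP. \<Sum>a<k. x i a s * y a j s) z = e i j z" by (rule fun_cong)
      then show ?thesis using that(1) by simp
    qed
    have yx: "(\<Sum>i<n. y a i z * x i b z) = (if a = b then 1 else 0)"
      if "z \<in> RHP" "a < k" "b < k" for z a b
    proof -
      have "dirichlet_limit (coeff (mmul n Q P a b)) (\<lambda>s\<in>RHP. \<Sum>i<n. y a i s * x i b s)"
        unfolding mmul_def using that x y by (intro dirichlet_limit_sum_mult) auto
      moreover have "mmul n Q P a b = fconst (if a = b then 1 else 0)"
        using PQ(2) that by (auto intro!: fds_eqI simp: coeff_fconst)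
      ultimately have "dirichlet_limit (coeff (fconst (if a = b then 1 else 0)))
          (\<lambda>s\<in>RHP. \<Sum>i<n. y a i s * x i b s)" by (simp only:)
      from dirichlet_limit_unique_fun[OF this dirichlet_limit_fconst]
      have "(\<lambda>s\<in>RHP. \<Sum>i<n. y a i s * x i b s) z
          = (\<lambda>s\<in>RHP. if a = b then 1 else 0) z" by (rule fun_cong)
      then show ?thesis using that(1) by simp
    qed
    have xX: "x i a \<in> X" if "i < n" "a < k" for i a
      unfolding X by (rule exI[of _ "P i a"]) (use PQ(3) x that in simp)
    have yX: "y a i \<in> X" if "i < n" "a < k" for i a
      unfolding X by (rule exI[of _ "Q a i"]) (use PQ(4) y that in simp)
    show "\<exists>(k::nat) x y. (\<forall>i<n. \<forall>a<k. x i a \<in> X \<and> y a i \<in> X) \<and>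
        (\<forall>z\<in>RHP. \<forall>i<n. \<forall>j<n. (\<Sum>a<k. x i a z * y a j z) = e i j z) \<and>
        (\<forall>z\<in>RHP. \<forall>a<k. \<forall>b<k. (\<Sum>i<n. y a i z * x i b z) = (if a = b then 1 else 0))"
      by (rule exI[of _ k], rule exI[of _ x], rule exI[of _ y], intro conjI allI impI ballI)
         (use xX yX xy yx in simp_all)
  qed
  then show ?thesis by (simp add: X_def)
qed

text \<open>On the translate by \<epsilon> the part of degree m gains a factor 2 powr (-
  \<epsilon> m), because (2 / p) powr \<epsilon> \<le> 1 at every prime p and so these values
  define a contractive twist. This beats subexponential growth, and the translate is a bounded
  function in O_u.\<close>

lemma tame_dirichlet_limit:
  assumes a: "H.tame a" shows "\<exists>f. dirichlet_limit (coeff a) f"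
proof (rule dirichlet_limit_exists)
  fix \<epsilon>0 :: real assume "\<epsilon>0 > 0"
  define \<epsilon> where "\<epsilon> = \<epsilon>0 / 2"
  have \<epsilon>: "\<epsilon> > 0" using \<open>\<epsilon>0 > 0\<close> by (simp add: \<epsilon>_def)
  define u where "u = (2::real) powr \<epsilon>"
  define q where "q = (2::real) powr (\<epsilon> / 2)"
  have q: "q > 1" "u = q * q" using \<epsilon> by (auto simp: q_def u_def powr_add[symmetric])
  define w where "w = cmult (\<lambda>p. of_real u * of_nat p powr (- of_real \<epsilon>))"
  have w: "w n = of_real u ^ big_omega n * of_nat n powr (- of_real \<epsilon>)" if "n \<ge> 1" for n
  proof -
    have "w n = cmult (\<lambda>_. of_real u) n * cmult (\<lambda>p. of_nat p powr (- of_real \<epsilon>)) n"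
      by (simp add: w_def cmult_def power_mult_distrib prod.distrib)
    then show ?thesis using nat_powr_eq_cmult[OF that, of "- of_real \<epsilon>"] by (simp add: cmult_const)
  qed
  have "contractive w"
    unfolding w_def
  proof (rule contractive_cmult)
    fix p :: nat assume "prime p"
    then have p: "real p \<ge> 2" using prime_ge_2_nat by fastforce
    have "norm (of_real u * of_nat p powr (- of_real \<epsilon>) :: complex) = 2 powr \<epsilon> * real p powr (- \<epsilon>)"
      using norm_powr_real_powr[of "of_nat p" "- of_real \<epsilon>"] by (simp add: norm_mult u_def)
    also have "\<dots> \<le> 2 powr \<epsilon> * 2 powr (- \<epsilon>)"
      using p \<epsilon> by (intro mult_left_mono powr_mono2') auto
    also have "\<dots> = 1" by (simp add: powr_add[symmetric])
    finally show "norm (of_real u * of_nat p powr (- of_real \<epsilon>) :: complex) \<le> 1" .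
  qed
  define b where "b = mk_fds (shift \<epsilon> (coeff a))"
  obtain K where K: "\<And>m. bd_H (hom_part m a) (K * q ^ m)" using H.tameE[OF a q(1)] by metis
  have "bd_H (hom_part m b) (K * (1 / q) ^ m)" for m
  proof -
    have "hom_part m b = fconst (of_real ((1 / u) ^ m)) * mk_fds (\<lambda>n. w n * coeff (hom_part m a) n)"
    proof (rule fds_eqI)
      fix n :: nat assume "n \<ge> 1"
      then show "coeff (hom_part m b) n = coeff (fconst (of_real ((1 / u) ^ m)) * mk_fds (\<lambda>n. w n * coeff (hom_part m a) n)) n"
        using w[of n] q by (auto simp: coeff_hom_part b_def coeff_mk_fds shift_def power_divide)
    qed
    moreover have "bd_H (fconst (of_real ((1 / u) ^ m)) * mk_fds (\<lambda>n. w n * coeff (hom_part m a) n))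
        (norm (of_real ((1 / u) ^ m) :: complex) * (K * q ^ m))"
      by (intro H.bd_scale bd_H_contractive[OF \<open>contractive w\<close>] K)
    moreover have "norm (of_real ((1 / u) ^ m) :: complex) * (K * q ^ m) = K * (1 / q) ^ m"
    proof -
      have "norm (of_real ((1 / u) ^ m) :: complex) = (1 / u) ^ m"
        unfolding norm_of_real using q by (intro abs_of_nonneg) simp
      then show ?thesis using q by (simp add: power_divide power_mult_distrib)
    qed
    ultimately show ?thesis by (simp only:)
  qed
  moreover have "summable (\<lambda>m. K * (1 / q) ^ m)"
    using q(1) by (intro summable_mult summable_geometric) auto
  ultimately obtain c where c: "bd_H c (\<Sum>m. K * (1 / q) ^ m)" "\<And>n. (\<lambda>m. coeff (hom_part m b) n) sums coeff c n"
    using bd_H_sums[of "\<lambda>m. hom_part m b" "\<lambda>m. K * (1 / q) ^ m"] by blast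
  have "c = b"
  proof (rule fds_eqI)
    fix n
    have "(\<lambda>m. coeff (hom_part m b) n) sums coeff b n"
      using sums_single[of "big_omega n" "\<lambda>m. coeff b n"] by (simp add: coeff_hom_part eq_commute[of "big_omega n"])
    then show "coeff c n = coeff b n" using c(2) sums_unique2 by blast
  qed
  then obtain g where "dirichlet_limit (shift \<epsilon> (coeff a)) g"
    using c(1) by (auto simp: bd_H_def b_def dirichlet_limit_mk_fds)
  then have g: "uniform_limit {s. Re s > \<epsilon>} (dpoly (shift \<epsilon> (coeff a))) g sequentially"
    using \<epsilon> by (simp add: dirichlet_limit_iff)
  have "uniform_limit {s. Re s > \<epsilon>0} (dpoly (coeff a)) (\<lambda>s. g (s - of_real \<epsilon>)) sequentially"
    unfolding uniform_limit_sequentially_iff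
  proof (intro allI impI)
    fix e :: real assume "e > 0"
    then obtain N0 where N0: "\<And>N s. N \<ge> N0 \<Longrightarrow> Re s > \<epsilon> \<Longrightarrow> dist (dpoly (shift \<epsilon> (coeff a)) N s) (g s) < e"
      using g unfolding uniform_limit_sequentially_iff by (metis mem_Collect_eq)
    have "dist (dpoly (coeff a) N s) (g (s - of_real \<epsilon>)) < e" if "N \<ge> N0" "Re s > \<epsilon>0" for N s
      using N0[OF that(1), of "s - of_real \<epsilon>"] that(2) by (simp add: dpoly_shift \<epsilon>_def)
    then show "\<exists>N0. \<forall>N\<ge>N0. \<forall>s\<in>{s. Re s > \<epsilon>0}. dist (dpoly (coeff a) N s) (g (s - of_real \<epsilon>)) < e" by auto
  qed
  then show "uniformly_convergent_on {s. Re s > \<epsilon>0} (dpoly (coeff a))"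
    unfolding uniformly_convergent_on_def by blast
qed

lemma summable_iff_bd_W: "summable (\<lambda>n. norm (coeff a n)) \<longleftrightarrow> (\<exists>C. bd_W a C)"
proof
  assume s: "summable (\<lambda>n. norm (coeff a n))"
  have "bd_W a (\<Sum>n. norm (coeff a n))"
    unfolding bd_W_def using sum_le_suminf[OF s] by auto
  then show "\<exists>C. bd_W a C" ..
next
  assume "\<exists>C. bd_W a C"
  then obtain C where C: "bd_W a C" ..
  have "(\<Sum>n<N. norm (coeff a (Suc n))) \<le> C" for N
    using C unfolding bd_W_def One_nat_def sum.atLeast1_atMost_eq by blast
  then have "summable (\<lambda>n. norm (coeff a (Suc n)))" by (intro summableI_nonneg_bounded) auto
  then show "summable (\<lambda>n. norm (coeff a n))" by (rule summable_Suc_iff[THEN iffD1])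
qed

lemma W_alg_iff:
  assumes "dirichlet_limit (coeff a) f" shows "f \<in> W_alg \<longleftrightarrow> (\<exists>C. bd_W a C)"
proof
  assume "f \<in> W_alg"
  then obtain b where b: "dirichlet_limit b f" "summable (\<lambda>n. norm (b n))" by (auto simp: W_alg_def)
  have "coeff a n = b n" if "n \<ge> 1" for n using dirichlet_limit_unique_coeff[OF assms b(1) that] .
  then have "norm (coeff a (Suc n)) = norm (b (Suc n))" for n by simp
  then have "summable (\<lambda>n. norm (coeff a (Suc n)))"
    using b(2) by (simp add: summable_Suc_iff[of "\<lambda>n. norm (b n)"])
  then have "summable (\<lambda>n. norm (coeff a n))" by (rule summable_Suc_iff[THEN iffD1])
  then show "\<exists>C. bd_W a C" by (simp add: summable_iff_bd_W)
next
  assume "\<exists>C. bd_W a C"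
  then show "f \<in> W_alg" using assms unfolding W_alg_def summable_iff_bd_W[symmetric] by blast
qed

lemma A_alg_iff:
  assumes af: "dirichlet_limit (coeff a) f" shows "f \<in> A_alg \<longleftrightarrow> (\<exists>C. bd_A a C)"
proof
  assume f: "f \<in> A_alg"
  then obtain C where C: "\<And>s. s \<in> RHP \<Longrightarrow> norm (f s) \<le> C"
    unfolding A_alg_def bounded_iff by auto
  have "bd_A a C"
  proof (rule bd_AI)
    show "bd_H a C" using af C by (auto simp: bd_H_def right_half_plane_def)
    fix \<epsilon> :: real assume "\<epsilon> > 0"
    then obtain g where g: "g \<in> W_alg" "\<And>s. s \<in> RHP \<Longrightarrow> norm (f s - g s) < \<epsilon>"
      using f by (auto simp: A_alg_def)
    then obtain b where b: "dirichlet_limit b g" by (auto simp: W_alg_def)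
    then have b': "dirichlet_limit (coeff (mk_fds b)) g" by (simp add: dirichlet_limit_mk_fds)
    then obtain D where "bd_W (mk_fds b) D" using g(1) W_alg_iff by blast
    moreover have "bd_H (a - mk_fds b) \<epsilon>"
      unfolding bd_H_def
      by (rule exI, rule conjI, rule dirichlet_limit_diff_fds[OF af b'])
         (use g(2) in \<open>auto simp: right_half_plane_def less_imp_le\<close>)
    ultimately show "\<exists>b D. bd_W b D \<and> bd_H (a - b) \<epsilon>" by blast
  qed
  then show "\<exists>C. bd_A a C" ..
next
  assume "\<exists>C. bd_A a C"
  then obtain C where C: "bd_A a C" ..
  then have "bd_H a C" by (simp add: bd_A_def)
  then have "\<forall>s. Re s > 0 \<longrightarrow> norm (f s) \<le> C"
    using dirichlet_limit_unique_fun[OF af] by (auto simp: bd_H_def)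
  then have "bounded (f ` RHP)" by (auto simp: bounded_iff right_half_plane_def)
  moreover have "f \<in> O_u" using af by (auto simp: O_u_iff)
  moreover have "\<exists>g\<in>W_alg. \<forall>s\<in>RHP. norm (f s - g s) < \<epsilon>" if "\<epsilon> > 0" for \<epsilon>
  proof -
    obtain b D where b: "bd_W b D" "bd_H (a - b) (\<epsilon> / 2)"
      using C \<open>\<epsilon> > 0\<close> unfolding bd_A_def by (meson half_gt_zero)
    obtain g where g: "dirichlet_limit (coeff b) g" using bd_W_imp_bd_H[OF b(1)] by (auto simp: bd_H_def)
    obtain h where h: "dirichlet_limit (coeff (a - b)) h" "\<And>s. Re s > 0 \<Longrightarrow> norm (h s) \<le> \<epsilon> / 2"
      using b(2) by (auto simp: bd_H_def)
    have "h = (\<lambda>s\<in>RHP. f s - g s)"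
      by (rule dirichlet_limit_unique_fun[OF h(1) dirichlet_limit_diff_fds[OF af g]])
    then have "norm (f s - g s) < \<epsilon>" if "s \<in> RHP" for s
      using h(2)[of s] that \<open>\<epsilon> > 0\<close> by (simp add: right_half_plane_def)
    moreover have "g \<in> W_alg" using b(1) W_alg_iff[OF g] by blast
    ultimately show ?thesis by blast
  qed
  ultimately show "f \<in> A_alg" by (simp add: A_alg_def)
qed

text \<open>If f_r is bounded with r = 1 / q, then contractivity bounds the part of degree m
  of f by a constant times q^m. Conversely, the expansion of f_r into homogeneous parts
  converges absolutely.\<close>

lemma O_b_iff:
  assumes af: "dirichlet_limit (coeff a) f" shows "f \<in> O_b \<longleftrightarrow> H.tame a"
proof
  assume "f \<in> O_b"
  then obtain b where b: "dirichlet_limit b f"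
    and bg: "\<And>r. 0 < r \<Longrightarrow> r < 1 \<Longrightarrow> \<exists>g\<in>O_u. dirichlet_limit (\<lambda>n. of_real (r ^ big_omega n) * b n) g
             \<and> bounded (g ` RHP)"
    by (auto simp: O_b_def)
  have ab: "coeff a n = b n" if "n \<ge> 1" for n using dirichlet_limit_unique_coeff[OF af b that] .
  have dil: "\<exists>C. bd_H (dilate r a) C" if r: "0 < r" "r < 1" for r
  proof -
    obtain g C where g: "dirichlet_limit (\<lambda>n. of_real (r ^ big_omega n) * b n) g"
        "\<And>s. s \<in> RHP \<Longrightarrow> norm (g s) \<le> C"
      using bg[OF r] unfolding bounded_iff by auto
    have "dirichlet_limit (coeff (dilate r a)) g"
      by (rule dirichlet_limit_cong[THEN iffD1, OF _ g(1)]) (simp add: ab)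
    then show ?thesis using g(2) by (auto simp: bd_H_def right_half_plane_def)
  qed
  show "H.tame a"
  proof (rule H.tameI)
    fix q :: real assume q: "q > 1"
    then obtain C where C: "bd_H (dilate (1 / q) a) C" using dil[of "1 / q"] by auto
    have "bd_H (hom_part m a) (C * q ^ m)" for m
    proof -
      have "hom_part m a = fconst (of_real (q ^ m)) * hom_part m (dilate (1 / q) a)"
        using q by (intro fds_eqI) (simp add: coeff_hom_part power_divide)
      moreover have "bd_H (fconst (of_real (q ^ m)) * hom_part m (dilate (1 / q) a)) (norm (of_real (q ^ m) :: complex) * C)"
        by (intro H.bd_scale bd_H_hom_part C)
      moreover have "norm (of_real (q ^ m) :: complex) * C = C * q ^ m"
        using q by (simp add: norm_power)
      ultimately show ?thesis by (simp only:)
    qed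
    then show "\<exists>K. \<forall>m. bd_H (hom_part m a) (K * q ^ m)" by blast
  qed
next
  assume a: "H.tame a"
  have "\<exists>g\<in>O_u. dirichlet_limit (\<lambda>n. of_real (r ^ big_omega n) * coeff a n) g \<and> bounded (g ` RHP)"
    if r: "0 < r" "r < 1" for r
  proof -
    obtain C where "bd_H (dilate r a) C" using H.bd_dilate_tame[OF a r] by blast
    then obtain g where g: "dirichlet_limit (coeff (dilate r a)) g" "\<And>s. Re s > 0 \<Longrightarrow> norm (g s) \<le> C"
      by (auto simp: bd_H_def)
    moreover have "coeff (dilate r a) = (\<lambda>n. of_real (r ^ big_omega n) * coeff a n)"
      by (simp add: fun_eq_iff)
    moreover have "bounded (g ` RHP)"
      using g(2) by (auto simp: bounded_iff right_half_plane_def)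
    ultimately show ?thesis using O_u_iff by auto
  qed
  then show "f \<in> O_b" using af O_u_iff unfolding O_b_def by blast
qed

text \<open>A function may satisfy the condition defining X and the symmetry condition with
  different coefficient sequences; these agree because the coefficients are unique.\<close>

lemma symmetric_part_eq:
  assumes G: "\<And>\<sigma>. \<sigma> \<in> G \<Longrightarrow> bij_betw \<sigma> {1..} {1..}"
    and X: "X \<subseteq> O_u" "\<And>a f. dirichlet_limit (coeff a) f \<Longrightarrow> f \<in> X \<longleftrightarrow> B a"
  shows "symmetric_part G X = {f. \<exists>a. (B a \<and> symmetric G a) \<and> dirichlet_limit (coeff a) f}"
proof (intro equalityI subsetI)
  fix f assume "f \<in> symmetric_part G X"
  then obtain a where f: "f \<in> X" and a: "dirichlet_limit a f" "\<forall>\<sigma>\<in>G. \<forall>n\<ge>1. a (prime_perm \<sigma> n) = a n"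
    by (auto simp: symmetric_part_def)
  have l: "dirichlet_limit (coeff (mk_fds a)) f" using a(1) by (simp add: dirichlet_limit_mk_fds)
  have "symmetric G (mk_fds a)"
    unfolding symmetric_def
  proof (intro ballI allI impI)
    fix \<sigma> and n :: nat assume "\<sigma> \<in> G" "n \<ge> 1"
    then show "coeff (mk_fds a) (prime_perm \<sigma> n) = coeff (mk_fds a) n"
      using a(2) prime_perm_pos[OF G, of \<sigma> n] by (simp add: coeff_mk_fds)
  qed
  then show "f \<in> {f. \<exists>a. (B a \<and> symmetric G a) \<and> dirichlet_limit (coeff a) f}"
    using l X(2)[OF l] f by blast
next
  fix f assume "f \<in> {f. \<exists>a. (B a \<and> symmetric G a) \<and> dirichlet_limit (coeff a) f}"
  then obtain a where "B a" "symmetric G a" "dirichlet_limit (coeff a) f" by blast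
  then show "f \<in> symmetric_part G X"
    using X(2) unfolding symmetric_part_def symmetric_def by blast
qed

theorem theorem3p5:
  fixes G :: "(nat \<Rightarrow> nat) set"
  assumes "subgroup G (BijGroup {1..})"
  shows "projective_free TYPE('m) (function_ring (symmetric_part G W_alg)) \<and>
         projective_free TYPE('m) (function_ring (symmetric_part G A_alg)) \<and>
         projective_free TYPE('m) (function_ring (symmetric_part G O_b))"
proof (intro conjI)
  have G: "bij_betw \<sigma> {1..} {1..}" if "\<sigma> \<in> G" for \<sigma>
    using subgroup.subset[OF assms] that by (auto simp: BijGroup_def Bij_def)
  have W_O: "W_alg \<subseteq> O_u" and A_O: "A_alg \<subseteq> O_u" and O_O: "O_b \<subseteq> O_u"
    by (auto simp: W_alg_def A_alg_def O_b_def O_u_iff)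
  have H_lim: "\<exists>f. dirichlet_limit (coeff a) f" if "bd_H a C" for a C using that by (auto simp: bd_H_def)
  interpret WG: dilation_continuous_algebra "\<lambda>a C. bd_W a C \<and> symmetric G a"
    by (intro dilation_continuous_algebra_symmetric G W.dilation_continuous_algebra_axioms)
  interpret AG: dilation_continuous_algebra "\<lambda>a C. bd_A a C \<and> symmetric G a"
    by (intro dilation_continuous_algebra_symmetric G A.dilation_continuous_algebra_axioms)
  interpret HG: graded_algebra "\<lambda>a C. bd_H a C \<and> symmetric G a"
    by (intro graded_algebra_symmetric G H.graded_algebra_axioms)
  have "projective_free TYPE('m) (function_ring
      {f. \<exists>a. (\<exists>C. bd_W a C \<and> symmetric G a) \<and> dirichlet_limit (coeff a) f})"
  proof (rule projective_free_coefficient_algebra)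
    show "\<exists>f. dirichlet_limit (coeff a) f" if "\<exists>C. bd_W a C \<and> symmetric G a" for a
      using that H_lim bd_W_imp_bd_H by blast
  qed (use WG.bd_fconst in blast, use WG.bd_add in blast, use WG.bd_mult in blast,
       rule WG.idempotent_factorization)
  then show "projective_free TYPE('m) (function_ring (symmetric_part G W_alg))"
    by (simp add: symmetric_part_eq[of G W_alg "\<lambda>a. \<exists>C. bd_W a C", OF G W_O W_alg_iff])
  have "projective_free TYPE('m) (function_ring
      {f. \<exists>a. (\<exists>C. bd_A a C \<and> symmetric G a) \<and> dirichlet_limit (coeff a) f})"
  proof (rule projective_free_coefficient_algebra)
    show "\<exists>f. dirichlet_limit (coeff a) f" if "\<exists>C. bd_A a C \<and> symmetric G a" for a
      using that H_lim by (auto simp: bd_A_def)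
  qed (use AG.bd_fconst in blast, use AG.bd_add in blast, use AG.bd_mult in blast,
       rule AG.idempotent_factorization)
  then show "projective_free TYPE('m) (function_ring (symmetric_part G A_alg))"
    by (simp add: symmetric_part_eq[of G A_alg "\<lambda>a. \<exists>C. bd_A a C", OF G A_O A_alg_iff])
  have tame: "HG.tame a \<longleftrightarrow> H.tame a \<and> symmetric G a" for a
  proof
    assume a: "HG.tame a"
    have hom: "symmetric G (hom_part m a)" for m using a unfolding HG.tame_def by (meson gt_ex)
    have "symmetric G a"
      unfolding symmetric_def
    proof (intro ballI allI impI)
      fix \<sigma> and n :: nat assume "\<sigma> \<in> G" "n \<ge> 1"
      then show "coeff a (prime_perm \<sigma> n) = coeff a n"
        using hom[of "big_omega n"] big_omega_prime_perm[OF G, of \<sigma> n]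
        unfolding symmetric_def by (metis coeff_hom_part)
    qed
    then show "H.tame a \<and> symmetric G a" using a unfolding HG.tame_def H.tame_def by blast
  next
    assume "H.tame a \<and> symmetric G a"
    then show "HG.tame a"
      using symmetric_hom_part[OF G] unfolding HG.tame_def H.tame_def by blast
  qed
  have "projective_free TYPE('m) (function_ring {f. \<exists>a. HG.tame a \<and> dirichlet_limit (coeff a) f})"
  proof (rule projective_free_coefficient_algebra)
    show "\<exists>f. dirichlet_limit (coeff a) f" if "HG.tame a" for a
      using that tame tame_dirichlet_limit by blast
    fix n E assume E: "mmul n E E = E" "\<And>i j. \<not> (i < n \<and> j < n) \<Longrightarrow> E i j = 0"
      "\<And>i j. i < n \<Longrightarrow> j < n \<Longrightarrow> HG.tame (E i j)"
    have "HG.tame (E i j)" for i j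
      using E(2,3)[of i j] HG.tame_zero by (cases "i < n \<and> j < n") auto
    then show "\<exists>k X Y. (\<forall>i<n. \<forall>j<n. mmul k X Y i j = E i j)
          \<and> (\<forall>i<k. \<forall>j<k. mmul n Y X i j = (if i = j then 1 else 0))
          \<and> (\<forall>i<n. \<forall>j<k. HG.tame (X i j)) \<and> (\<forall>j<k. \<forall>i<n. HG.tame (Y j i))"
      by (rule HG.tame_idempotent_factorization[OF E(1)])
  qed (fact HG.tame_fconst HG.tame_add HG.tame_mult)+
  then show "projective_free TYPE('m) (function_ring (symmetric_part G O_b))"
    by (simp add: symmetric_part_eq[of G O_b H.tame, OF G O_O O_b_iff] tame)
qed

end
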